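(* Let $(M,F)$ be an $n$-dimensional Finsler manifold, let $\Gamma$ be the vertical Liouville vector field on $TM^0$, and let $\mathcal{L}_\Gamma^\perp$ be the $G$-orthogonal complement of $\mathcal{L}_\Gamma=\mathrm{span}\{\Gamma\}$ in $T(TM^0)$. A connection $\nabla$ on $\mathcal{L}_\Gamma^\perp$ is basic with respect to the line foliation $\mathcal{F}_\Gamma$ if and only if in the adapted local systems $\left\{\frac{\delta}{\delta x^i},\frac{\overline\partial}{\overline\partial y^i}\right\}$ spanning $\mathcal{L}_\Gamma^\perp$ one has $$\nabla_\Gamma\frac{\delta}{\delta x^i}=0,\qquad \nabla_\Gamma\frac{\overline\partial}{\overline\partial y^i}=-\frac{\overline\partial}{\overline\partial y^i}\qquad\text{for all } i=1,\dots,n.$$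
   Context: $(M,F)$ is a Finsler manifold of dimension $n$; $TM^0=TM\setminus\{\text{zero section}\}$, with induced local coordinates $(x^i,y^i)$, $i=1,\dots,n$, and summation over repeated indices. For a vector bundle $E$, $\Gamma(E)$ denotes its sections. Put $g_{ij}=\frac12\frac{\partial^2F^2}{\partial y^i\partial y^j}$, with inverse $(g^{ij})$. The vertical bundle $V(TM^0)$ is locally spanned by $\{\partial/\partial y^i\}$. Put $G^i=\frac14g^{ik}\left(\frac{\partial^2F^2}{\partial y^k\partial x^h}y^h-\frac{\partial F^2}{\partial x^k}\right)$, $G_i^j=\frac{\partial G^j}{\partial y^i}$, $\frac{\delta}{\delta x^i}=\frac{\partial}{\partial x^i}-G_i^j\frac{\partial}{\partial y^j}$; these span the horizontal distribution $H(TM^0)$, and $T(TM^0)=H(TM^0)\oplus V(TM^0)$. The Riemannian metric $G$ on $TM^0$ is the Sasaki lift: $G(\frac{\delta}{\delta x^i},\frac{\delta}{\delta x^j})=G(\frac{\partial}{\partial y^i},\frac{\partial}{\partial y^j})=g_{ij}$, $G(\frac{\delta}{\delta x^i},\frac{\partial}{\partial y^j})=0$. The vertical Liouville vector field is $\Gamma=y^i\frac{\partial}{\partial y^i}$; $\mathcal{L}_\Gamma$ is the line distribution spanned by $\Gamma$, with foliation $\mathcal{F}_\Gamma$; $\mathcal{L}_\Gamma'=\{X\in V(TM^0): G(X,\Gamma)=0\}$ and $\mathcal{L}_\Gamma^\perp=\{X\in T(TM^0): G(X,\Gamma)=0\}=H(TM^0)\oplus\mathcal{L}_\Gamma'$.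 Let $\pi_2:T(TM^0)\to\mathcal{L}_\Gamma^\perp$ be the projection along $\mathcal{L}_\Gamma$ (so the normal bundle of $\mathcal{F}_\Gamma$ is identified with $\mathcal{L}_\Gamma^\perp$). The local vector fields $\frac{\overline\partial}{\overline\partial y^k}=\frac{\partial}{\partial y^k}-t_k\Gamma$, $k=1,\dots,n$, with $t_k=\frac1{F^2}y^ig_{ki}=\frac1F\frac{\partial F}{\partial y^k}$, are orthogonal to $\Gamma$ and span $\mathcal{L}_\Gamma'$ (of rank $n-1$); they satisfy the single linear relation $y^k\frac{\overline\partial}{\overline\partial y^k}=0$. Definition. A connection $\nabla$ on $\mathcal{L}_\Gamma^\perp$ is basic with respect to $\mathcal{F}_\Gamma$ if $\nabla_XY=\pi_2[X,\widetilde Y]$ for all $X\in\Gamma(\mathcal{L}_\Gamma)$, $Y\in\Gamma(\mathcal{L}_\Gamma^\perp)$ and all $\widetilde Y\in\Gamma(T(TM^0))$ with $\pi_2(\widetilde Y)=Y$. *)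

theory Defs
  imports "HOL-Analysis.Analysis" "HOL-Library.Function_Algebras"
begin

section \<open>Smooth manifolds given by an atlas\<close>

primrec Ck_on :: "nat \<Rightarrow> ('a::real_normed_vector \<Rightarrow> 'b::real_normed_vector) \<Rightarrow> 'a set \<Rightarrow> bool" where
  "Ck_on 0 f S \<longleftrightarrow> continuous_on S f"
| "Ck_on (Suc k) f S \<longleftrightarrow> (\<forall>x\<in>S. f differentiable (at x)) \<and>
     (\<forall>v. Ck_on k (\<lambda>x. frechet_derivative f (at x) v) S)"

text \<open>Only used for open sets \<open>S\<close>.\<close>
definition smooth_on :: "'a::real_normed_vector set \<Rightarrow> ('a \<Rightarrow> 'b::real_normed_vector) \<Rightarrow> bool" where
  "smooth_on S f \<longleftrightarrow> (\<forall>k. Ck_on k f S)"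

text \<open>A chart is its domain together with its coordinate map (irrelevant off the domain).\<close>
type_synonym ('a, 'e) chart = "'a set \<times> ('a \<Rightarrow> 'e)"

definition chart_image :: "('a, 'e) chart \<Rightarrow> 'e set" where
  "chart_image c = snd c ` fst c"

definition chart_inv :: "('a, 'e) chart \<Rightarrow> 'e \<Rightarrow> 'a" where
  "chart_inv c = inv_into (fst c) (snd c)"

definition transition :: "('a, 'e) chart \<Rightarrow> ('a, 'e) chart \<Rightarrow> 'e \<Rightarrow> 'e" where
  "transition c d = snd d \<circ> chart_inv c"

definition points :: "('a, 'e) chart set \<Rightarrow> 'a set" where
  "points A = (\<Union>c\<in>A. fst c)"

definition smooth_atlas :: "('a, 'e::euclidean_space) chart set \<Rightarrow> bool" where
  "smooth_atlas A \<longleftrightarrow>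
     (\<forall>c\<in>A. inj_on (snd c) (fst c) \<and> open (chart_image c)) \<and>
     (\<forall>c\<in>A. \<forall>d\<in>A. open (snd c ` (fst c \<inter> fst d)) \<and>
        smooth_on (snd c ` (fst c \<inter> fst d)) (transition c d))"

definition atlas_open :: "('a, 'e::euclidean_space) chart set \<Rightarrow> 'a set \<Rightarrow> bool" where
  "atlas_open A W \<longleftrightarrow> W \<subseteq> points A \<and> (\<forall>c\<in>A. open (snd c ` (fst c \<inter> W)))"

lemma istopology_atlas_open:
  assumes "smooth_atlas A"
  shows "istopology (atlas_open A)"
proof -
  have inj: "\<And>c. c \<in> A \<Longrightarrow> inj_on (snd c) (fst c)"
    using assms by (simp add: smooth_atlas_def)
  have "atlas_open A (S \<inter> T)" if "atlas_open A S" "atlas_open A T" for S T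
  proof -
    have "open (snd c ` (fst c \<inter> (S \<inter> T)))" if c: "c \<in> A" for c
    proof -
      have "snd c ` ((fst c \<inter> S) \<inter> (fst c \<inter> T)) = snd c ` (fst c \<inter> S) \<inter> snd c ` (fst c \<inter> T)"
        by (rule inj_on_image_Int[OF inj[OF c]]) auto
      moreover have "(fst c \<inter> S) \<inter> (fst c \<inter> T) = fst c \<inter> (S \<inter> T)" by blast
      ultimately show ?thesis
        using \<open>atlas_open A S\<close> \<open>atlas_open A T\<close> c by (simp add: atlas_open_def open_Int)
    qed
    then show ?thesis using \<open>atlas_open A S\<close> by (auto simp: atlas_open_def)
  qed
  moreover have "atlas_open A (\<Union>K)" if "\<forall>S\<in>K. atlas_open A S" for K
  proof -
    have "open (snd c ` (fst c \<inter> \<Union>K))" if c: "c \<in> A" for c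
    proof -
      have "snd c ` (fst c \<inter> \<Union>K) = (\<Union>S\<in>K. snd c ` (fst c \<inter> S))" by blast
      then show ?thesis
        using \<open>\<forall>S\<in>K. atlas_open A S\<close> c by (simp add: atlas_open_def open_UN)
    qed
    then show ?thesis using that by (auto simp: atlas_open_def)
  qed
  ultimately show ?thesis by (simp add: istopology_def)
qed

definition atlas_topology :: "('a, 'e::euclidean_space) chart set \<Rightarrow> 'a topology" where
  "atlas_topology A = topology (atlas_open A)"

definition smooth_manifold :: "('a, 'e::euclidean_space) chart set \<Rightarrow> bool" where
  "smooth_manifold A \<longleftrightarrow> smooth_atlas A \<and>
     Hausdorff_space (atlas_topology A) \<and> second_countable (atlas_topology A)"

definition smooth_functions :: "('a, 'e::euclidean_space) chart set \<Rightarrow> ('a \<Rightarrow> real) set" where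
  "smooth_functions A = {f. \<forall>c\<in>A. smooth_on (chart_image c) (f \<circ> chart_inv c)}"


section \<open>Tangent vectors and vector fields\<close>

text \<open>A tangent vector at \<open>p\<close> is the family of its components in all charts around \<open>p\<close>, related
  by the derivatives of the transition maps. Components in charts not containing \<open>p\<close>
  are \<open>0\<close>, so that the vector space operations are the pointwise ones (addition, zero and negation
  are those of Function_Algebras).\<close>
type_synonym ('a, 'e) tvec = "('a, 'e) chart \<Rightarrow> 'e"

definition vscale :: "real \<Rightarrow> ('c \<Rightarrow> 'e::real_vector) \<Rightarrow> 'c \<Rightarrow> 'e"  (infixr "\<odot>" 75) where
  "a \<odot> v = (\<lambda>c. a *\<^sub>R v c)"

definition fscale :: "('a \<Rightarrow> real) \<Rightarrow> ('a \<Rightarrow> 'c \<Rightarrow> 'e::real_vector) \<Rightarrow> 'a \<Rightarrow> 'c \<Rightarrow> 'e" where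
  "fscale f X = (\<lambda>u. f u \<odot> X u)"

definition tangent_space :: "('a, 'e::euclidean_space) chart set \<Rightarrow> 'a \<Rightarrow> ('a, 'e) tvec set" where
  "tangent_space A p = {v.
     (\<forall>c. \<not> (c \<in> A \<and> p \<in> fst c) \<longrightarrow> v c = 0) \<and>
     (\<forall>c\<in>A. \<forall>d\<in>A. p \<in> fst c \<inter> fst d \<longrightarrow>
        v d = frechet_derivative (transition c d) (at (snd c p)) (v c))}"

text \<open>The tangent vector at \<open>p\<close> with components \<open>e\<close> in the chart \<open>d\<close>.\<close>
definition vec_in_chart ::
    "('a, 'e::euclidean_space) chart set \<Rightarrow> ('a, 'e) chart \<Rightarrow> 'a \<Rightarrow> 'e \<Rightarrow> ('a, 'e) tvec" where
  "vec_in_chart A d p e = (\<lambda>c. if c \<in> A \<and> p \<in> fst c \<inter> fst d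
     then frechet_derivative (transition d c) (at (snd d p)) e else 0)"

definition field_in_chart ::
    "('a, 'e) chart \<Rightarrow> ('a \<Rightarrow> ('a, 'e) tvec) \<Rightarrow> 'e \<Rightarrow> 'e" where
  "field_in_chart c X = (\<lambda>z. X (chart_inv c z) c)"

text \<open>Vector fields are \<open>0\<close> off the manifold, so that equality of fields is equality of functions.\<close>
definition vector_fields ::
    "('a, 'e::euclidean_space) chart set \<Rightarrow> ('a \<Rightarrow> ('a, 'e) tvec) set" where
  "vector_fields A = {X.
     (\<forall>p\<in>points A. X p \<in> tangent_space A p) \<and> (\<forall>p. p \<notin> points A \<longrightarrow> X p = 0) \<and>
     (\<forall>c\<in>A. smooth_on (chart_image c) (field_in_chart c X))}"

text \<open>Smooth global sections of the subbundle with fibres \<open>D p\<close>.\<close>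
definition sections ::
    "('a, 'e::euclidean_space) chart set \<Rightarrow> ('a \<Rightarrow> ('a, 'e) tvec set) \<Rightarrow> ('a \<Rightarrow> ('a, 'e) tvec) set" where
  "sections A D = {X \<in> vector_fields A. \<forall>p\<in>points A. X p \<in> D p}"

text \<open>\<open>X f\<close>; the value does not depend on the chart.\<close>
definition deriv_along ::
    "('a, 'e::euclidean_space) chart set \<Rightarrow> ('a \<Rightarrow> ('a, 'e) tvec) \<Rightarrow> ('a \<Rightarrow> real) \<Rightarrow> 'a \<Rightarrow> real" where
  "deriv_along A X f p = (THE r. \<forall>c\<in>A. p \<in> fst c \<longrightarrow>
     r = frechet_derivative (f \<circ> chart_inv c) (at (snd c p)) (X p c))"

definition lie_bracket ::
    "('a, 'e::euclidean_space) chart set \<Rightarrow> ('a \<Rightarrow> ('a, 'e) tvec) \<Rightarrow> ('a \<Rightarrow> ('a, 'e) tvec)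
      \<Rightarrow> 'a \<Rightarrow> ('a, 'e) tvec" where
  "lie_bracket A X Y p = (\<lambda>c. if c \<in> A \<and> p \<in> fst c
     then frechet_derivative (field_in_chart c Y) (at (snd c p)) (X p c)
        - frechet_derivative (field_in_chart c X) (at (snd c p)) (Y p c)
     else 0)"


section \<open>Connections on a subbundle of the tangent bundle\<close>

definition connection_on ::
    "('a, 'e::euclidean_space) chart set \<Rightarrow> ('a \<Rightarrow> ('a, 'e) tvec set)
      \<Rightarrow> (('a \<Rightarrow> ('a, 'e) tvec) \<Rightarrow> ('a \<Rightarrow> ('a, 'e) tvec) \<Rightarrow> ('a \<Rightarrow> ('a, 'e) tvec)) \<Rightarrow> bool" where
  "connection_on A D conn \<longleftrightarrow>
     (\<forall>X\<in>vector_fields A. \<forall>Y\<in>sections A D. conn X Y \<in> sections A D) \<and>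
     (\<forall>X\<in>vector_fields A. \<forall>X'\<in>vector_fields A. \<forall>Y\<in>sections A D.
        conn (X + X') Y = conn X Y + conn X' Y) \<and>
     (\<forall>f\<in>smooth_functions A. \<forall>X\<in>vector_fields A. \<forall>Y\<in>sections A D.
        conn (fscale f X) Y = fscale f (conn X Y)) \<and>
     (\<forall>X\<in>vector_fields A. \<forall>Y\<in>sections A D. \<forall>Y'\<in>sections A D.
        conn X (Y + Y') = conn X Y + conn X Y') \<and>
     (\<forall>f\<in>smooth_functions A. \<forall>X\<in>vector_fields A. \<forall>Y\<in>sections A D.
        conn X (fscale f Y) = fscale f (conn X Y) + fscale (deriv_along A X f) Y)"

text \<open>The induced operator on a section \<open>Y\<close> that is only defined near \<open>u\<close>: as connections are
  local, \<open>conn X Y'\<close> has at \<open>u\<close> the same value for every global section \<open>Y'\<close> with the germ of \<open>Y\<close>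
  at \<open>u\<close>.\<close>
definition local_connection ::
    "('a, 'e::euclidean_space) chart set \<Rightarrow> ('a \<Rightarrow> ('a, 'e) tvec set)
      \<Rightarrow> (('a \<Rightarrow> ('a, 'e) tvec) \<Rightarrow> ('a \<Rightarrow> ('a, 'e) tvec) \<Rightarrow> ('a \<Rightarrow> ('a, 'e) tvec))
      \<Rightarrow> ('a \<Rightarrow> ('a, 'e) tvec) \<Rightarrow> ('a \<Rightarrow> ('a, 'e) tvec) \<Rightarrow> 'a \<Rightarrow> ('a, 'e) tvec" where
  "local_connection A D conn X Y u = (THE w. \<exists>Y'\<in>sections A D.
     (\<exists>W. openin (atlas_topology A) W \<and> u \<in> W \<and> (\<forall>q\<in>W. Y' q = Y q)) \<and> w = conn X Y' u)"


section \<open>The slit tangent bundle\<close>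

definition tangent_bundle :: "('m, 'e::euclidean_space) chart set \<Rightarrow> ('m \<times> ('m, 'e) tvec) set" where
  "tangent_bundle A = {(p, v). p \<in> points A \<and> v \<in> tangent_space A p}"

definition slit_bundle :: "('m, 'e::euclidean_space) chart set \<Rightarrow> ('m \<times> ('m, 'e) tvec) set" where
  "slit_bundle A = {(p, v) \<in> tangent_bundle A. v \<noteq> 0}"

text \<open>The induced coordinates \<open>(x, y)\<close>.\<close>
definition slit_chart :: "('m, 'e::euclidean_space) chart set \<Rightarrow> ('m, 'e) chart
    \<Rightarrow> ('m \<times> ('m, 'e) tvec, 'e \<times> 'e) chart" where
  "slit_chart A c = ({(p, v) \<in> slit_bundle A. p \<in> fst c}, \<lambda>(p, v). (snd c p, v c))"

definition slit_atlas :: "('m, 'e::euclidean_space) chart set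
    \<Rightarrow> ('m \<times> ('m, 'e) tvec, 'e \<times> 'e) chart set" where
  "slit_atlas A = slit_chart A ` A"


section \<open>Finsler manifolds\<close>

text \<open>In this section \<open>d\<close> is an induced chart on the slit tangent bundle and \<open>z = (x, y)\<close> are
  coordinates in it.\<close>

type_synonym ('m, 'n) slit_pt = "'m \<times> ('m, real^'n) tvec"
type_synonym ('m, 'n) slit_ch = "(('m, 'n) slit_pt, (real^'n) \<times> (real^'n)) chart"
type_synonym ('m, 'n) slit_vec = "(('m, 'n) slit_pt, (real^'n) \<times> (real^'n)) tvec"

definition pd_x :: "'n::finite \<Rightarrow> ((real^'n) \<times> (real^'n) \<Rightarrow> real) \<Rightarrow> (real^'n) \<times> (real^'n) \<Rightarrow> real" where
  "pd_x i f z = frechet_derivative f (at z) (axis i 1, 0)"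

definition pd_y :: "'n::finite \<Rightarrow> ((real^'n) \<times> (real^'n) \<Rightarrow> real) \<Rightarrow> (real^'n) \<times> (real^'n) \<Rightarrow> real" where
  "pd_y i f z = frechet_derivative f (at z) (0, axis i 1)"

definition F_sq :: "(('m, 'n::finite) slit_pt \<Rightarrow> real) \<Rightarrow> ('m, 'n) slit_ch
    \<Rightarrow> (real^'n) \<times> (real^'n) \<Rightarrow> real" where
  "F_sq F d z = (F (chart_inv d z))\<^sup>2"

definition fund_tensor :: "(('m, 'n::finite) slit_pt \<Rightarrow> real) \<Rightarrow> ('m, 'n) slit_ch
    \<Rightarrow> (real^'n) \<times> (real^'n) \<Rightarrow> real^'n^'n" where
  "fund_tensor F d z = (\<chi> i j. 1/2 * pd_y i (pd_y j (F_sq F d)) z)"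

definition finsler_manifold :: "('m, real^'n::finite) chart set \<Rightarrow> (('m, 'n) slit_pt \<Rightarrow> real) \<Rightarrow> bool" where
  "finsler_manifold A F \<longleftrightarrow> smooth_manifold A \<and>
     F \<in> smooth_functions (slit_atlas A) \<and>
     (\<forall>u\<in>slit_bundle A. F u > 0) \<and>
     (\<forall>p\<in>points A. F (p, 0) = 0) \<and>
     (\<forall>(p, v)\<in>tangent_bundle A. \<forall>t>0. F (p, t \<odot> v) = t * F (p, v)) \<and>
     (\<forall>d\<in>slit_atlas A. \<forall>z\<in>chart_image d. \<forall>w. w \<noteq> 0 \<longrightarrow>
        (\<Sum>i\<in>UNIV. \<Sum>j\<in>UNIV. fund_tensor F d z $ i $ j * w $ i * w $ j) > 0)"

definition spray_coeff :: "(('m, 'n::finite) slit_pt \<Rightarrow> real) \<Rightarrow> ('m, 'n) slit_ch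
    \<Rightarrow> 'n \<Rightarrow> (real^'n) \<times> (real^'n) \<Rightarrow> real" where
  "spray_coeff F d i z = 1/4 * (\<Sum>k\<in>UNIV. matrix_inv (fund_tensor F d z) $ i $ k *
     ((\<Sum>h\<in>UNIV. pd_y k (pd_x h (F_sq F d)) z * snd z $ h) - pd_x k (F_sq F d) z))"

text \<open>\<open>nonlin_coeff F d i j\<close> is \<open>G\<^sub>i\<^sup>j\<close>.\<close>
definition nonlin_coeff :: "(('m, 'n::finite) slit_pt \<Rightarrow> real) \<Rightarrow> ('m, 'n) slit_ch
    \<Rightarrow> 'n \<Rightarrow> 'n \<Rightarrow> (real^'n) \<times> (real^'n) \<Rightarrow> real" where
  "nonlin_coeff F d i j z = pd_y i (spray_coeff F d j) z"

definition dx_field :: "('m, real^'n::finite) chart set \<Rightarrow> ('m, 'n) slit_ch \<Rightarrow> 'n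
    \<Rightarrow> ('m, 'n) slit_pt \<Rightarrow> ('m, 'n) slit_vec" where
  "dx_field A d i u = vec_in_chart (slit_atlas A) d u (axis i 1, 0)"

definition dy_field :: "('m, real^'n::finite) chart set \<Rightarrow> ('m, 'n) slit_ch \<Rightarrow> 'n
    \<Rightarrow> ('m, 'n) slit_pt \<Rightarrow> ('m, 'n) slit_vec" where
  "dy_field A d i u = vec_in_chart (slit_atlas A) d u (0, axis i 1)"

definition delta_field :: "('m, real^'n::finite) chart set \<Rightarrow> (('m, 'n) slit_pt \<Rightarrow> real)
    \<Rightarrow> ('m, 'n) slit_ch \<Rightarrow> 'n \<Rightarrow> ('m, 'n) slit_pt \<Rightarrow> ('m, 'n) slit_vec" where
  "delta_field A F d i u =
     dx_field A d i u - (\<Sum>j\<in>UNIV. nonlin_coeff F d i j (snd d u) \<odot> dy_field A d j u)"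

text \<open>The field \<open>y\<^sup>i \<partial>/\<partial>y\<^sup>i\<close>: its components in every induced chart are \<open>(0, y)\<close>.\<close>
definition liouville :: "('m, real^'n::finite) chart set \<Rightarrow> ('m, 'n) slit_pt \<Rightarrow> ('m, 'n) slit_vec" where
  "liouville A u = (\<lambda>d. if d \<in> slit_atlas A \<and> u \<in> fst d then (0, snd (snd d u)) else 0)"

definition t_coeff :: "(('m, 'n::finite) slit_pt \<Rightarrow> real) \<Rightarrow> ('m, 'n) slit_ch
    \<Rightarrow> 'n \<Rightarrow> (real^'n) \<times> (real^'n) \<Rightarrow> real" where
  "t_coeff F d k z = 1 / F_sq F d z * (\<Sum>i\<in>UNIV. snd z $ i * fund_tensor F d z $ k $ i)"

definition bar_dy_field :: "('m, real^'n::finite) chart set \<Rightarrow> (('m, 'n) slit_pt \<Rightarrow> real)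
    \<Rightarrow> ('m, 'n) slit_ch \<Rightarrow> 'n \<Rightarrow> ('m, 'n) slit_pt \<Rightarrow> ('m, 'n) slit_vec" where
  "bar_dy_field A F d k u = dy_field A d k u - t_coeff F d k (snd d u) \<odot> liouville A u"

text \<open>\<open>G u\<close> is the inner product on the tangent space at \<open>u\<close>. Its values on the adapted frames
  determine it on tangent vectors and make it positive definite and smooth in \<open>u\<close>.\<close>
definition sasaki_metric :: "('m, real^'n::finite) chart set \<Rightarrow> (('m, 'n) slit_pt \<Rightarrow> real)
    \<Rightarrow> (('m, 'n) slit_pt \<Rightarrow> ('m, 'n) slit_vec \<Rightarrow> ('m, 'n) slit_vec \<Rightarrow> real) \<Rightarrow> bool" where
  "sasaki_metric A F G \<longleftrightarrow>
     (\<forall>u\<in>slit_bundle A.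
        (\<forall>v\<in>tangent_space (slit_atlas A) u. \<forall>w\<in>tangent_space (slit_atlas A) u.
           G u v w = G u w v \<and>
           (\<forall>a. G u (a \<odot> v) w = a * G u v w) \<and>
           (\<forall>v'\<in>tangent_space (slit_atlas A) u. G u (v + v') w = G u v w + G u v' w))) \<and>
     (\<forall>d\<in>slit_atlas A. \<forall>u\<in>fst d. \<forall>i j.
        G u (delta_field A F d i u) (delta_field A F d j u) = fund_tensor F d (snd d u) $ i $ j \<and>
        G u (dy_field A d i u) (dy_field A d j u) = fund_tensor F d (snd d u) $ i $ j \<and>
        G u (delta_field A F d i u) (dy_field A d j u) = 0)"

definition liouville_line :: "('m, real^'n::finite) chart set
    \<Rightarrow> ('m, 'n) slit_pt \<Rightarrow> ('m, 'n) slit_vec set" where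
  "liouville_line A u = {a \<odot> liouville A u | a. True}"

definition liouville_perp :: "('m, real^'n::finite) chart set
    \<Rightarrow> (('m, 'n) slit_pt \<Rightarrow> ('m, 'n) slit_vec \<Rightarrow> ('m, 'n) slit_vec \<Rightarrow> real)
    \<Rightarrow> ('m, 'n) slit_pt \<Rightarrow> ('m, 'n) slit_vec set" where
  "liouville_perp A G u = {v \<in> tangent_space (slit_atlas A) u. G u v (liouville A u) = 0}"

definition proj_perp :: "('m, real^'n::finite) chart set
    \<Rightarrow> (('m, 'n) slit_pt \<Rightarrow> ('m, 'n) slit_vec \<Rightarrow> ('m, 'n) slit_vec \<Rightarrow> real)
    \<Rightarrow> ('m, 'n) slit_pt \<Rightarrow> ('m, 'n) slit_vec \<Rightarrow> ('m, 'n) slit_vec" where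
  "proj_perp A G u v = (THE w. w \<in> liouville_perp A G u \<and> v - w \<in> liouville_line A u)"

definition basic_connection :: "('m, real^'n::finite) chart set
    \<Rightarrow> (('m, 'n) slit_pt \<Rightarrow> ('m, 'n) slit_vec \<Rightarrow> ('m, 'n) slit_vec \<Rightarrow> real)
    \<Rightarrow> ((('m, 'n) slit_pt \<Rightarrow> ('m, 'n) slit_vec) \<Rightarrow> (('m, 'n) slit_pt \<Rightarrow> ('m, 'n) slit_vec)
        \<Rightarrow> ('m, 'n) slit_pt \<Rightarrow> ('m, 'n) slit_vec) \<Rightarrow> bool" where
  "basic_connection A G conn \<longleftrightarrow>
     (\<forall>X\<in>sections (slit_atlas A) (liouville_line A).
      \<forall>Y\<in>sections (slit_atlas A) (liouville_perp A G).
      \<forall>Y'\<in>vector_fields (slit_atlas A).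
        (\<forall>u\<in>slit_bundle A. proj_perp A G u (Y' u) = Y u) \<longrightarrow>
        (\<forall>u\<in>slit_bundle A. conn X Y u = proj_perp A G u (lie_bracket (slit_atlas A) X Y' u)))"

end

theory Submission
  imports Defs
begin

text \<open>Both \<open>Y \<mapsto> \<nabla>\<^sub>\<Gamma> Y\<close> and \<open>Y \<mapsto> \<pi>\<^sub>2 [\<Gamma>, Y]\<close> satisfy the Leibniz rule along \<open>\<Gamma>\<close>, so their difference
  is linear over the smooth functions. It therefore vanishes on all sections if and only if it
  vanishes on the adapted local frames, which bump functions extend to global sections. As
  \<open>G\<^sub>i\<^sup>j\<close> is homogeneous of degree \<open>1\<close> and \<open>t\<^sub>k\<close> of degree \<open>-1\<close> in \<open>y\<close>, Euler's theorem gives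
  \<open>[\<Gamma>, \<delta>/\<delta>x\<^sup>i] = 0\<close>, while the bracket of \<open>\<Gamma>\<close> with the \<open>k\<close>-th vertical frame field is its negative.\<close>

section \<open>Smooth maps between normed spaces\<close>

text \<open>A connection and \<open>basic_connection\<close> speak of global sections, whereas the
  frames live on one induced chart and enter through \<open>local_connection\<close>. Passing
  between the two needs bump functions on the slit bundle, hence its Hausdorff property, which is
  carried over from the base. The Leibniz terms in the difference of the two operators cancel
  because the projection fixes sections of the complement. The vertical frame has n members in a
  bundle of rank n - 1, so coefficients are not unique; the argument rests on spanning alone, with
  explicit coefficients that are visibly smooth. A tangent vector is a family of components over all
  charts, so the bracket with \<Gamma> has to be shown to transform correctly. This involves second
  derivatives of the coordinate changes, and these are evaluated by the same Euler theorem as the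
  Finsler coefficients, since the coordinate changes of the slit bundle are homogeneous in the fibre
  variable.\<close>

lemma frechet_derivative_cong_open:
  assumes "open S" "x \<in> S" "\<And>y. y \<in> S \<Longrightarrow> f y = g y"
  shows "frechet_derivative f (at x) = frechet_derivative g (at x)"
proof -
  have "(f has_derivative f') (at x) \<longleftrightarrow> (g has_derivative f') (at x)" for f'
    using assms has_derivative_transform_within_open[of f f' x UNIV S g]
      has_derivative_transform_within_open[of g f' x UNIV S f] by auto
  then show ?thesis by (simp add: frechet_derivative_def)
qed

lemma differentiable_cong_open:
  assumes "open S" "x \<in> S" "\<And>y. y \<in> S \<Longrightarrow> f y = g y"
  shows "f differentiable (at x) \<longleftrightarrow> g differentiable (at x)"
  using assms has_derivative_transform_within_open[of f _ x UNIV S g]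
    has_derivative_transform_within_open[of g _ x UNIV S f]
  by (auto simp: differentiable_def)

lemma frechet_derivative_apply:
  "(f has_derivative f') (at x) \<Longrightarrow> frechet_derivative f (at x) v = f' v"
  using frechet_derivative_at[of f f' x] by simp

lemma Ck_on_cong:
  assumes "open S" "\<And>x. x \<in> S \<Longrightarrow> f x = g x"
  shows "Ck_on k f S \<longleftrightarrow> Ck_on k g S"
  using assms(2)
proof (induction k arbitrary: f g)
  case 0
  then show ?case by (simp cong: continuous_on_cong)
next
  case (Suc k)
  have "Ck_on k (\<lambda>x. frechet_derivative f (at x) v) S \<longleftrightarrow> Ck_on k (\<lambda>x. frechet_derivative g (at x) v) S" for v
    by (rule Suc.IH) (metis Suc.prems assms(1) frechet_derivative_cong_open)
  moreover have "\<And>x. x \<in> S \<Longrightarrow> f differentiable (at x) \<longleftrightarrow> g differentiable (at x)"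
    using Suc.prems assms(1) differentiable_cong_open by blast
  ultimately show ?case by simp
qed

text \<open>Each differentiation rule can supply its own formula for the derivative; the passage to
  \<open>frechet_derivative\<close>, through which \<open>Ck_on\<close> is defined, is hidden
  here.\<close>

lemma Ck_on_SucI:
  assumes "open S" "\<And>x. x \<in> S \<Longrightarrow> (f has_derivative f' x) (at x)"
    and "\<And>v. Ck_on k (\<lambda>x. f' x v) S"
  shows "Ck_on (Suc k) f S"
proof -
  have "frechet_derivative f (at x) = f' x" if "x \<in> S" for x
    using assms(2)[OF that] frechet_derivative_at by metis
  then have "Ck_on k (\<lambda>x. frechet_derivative f (at x) v) S" for v
    using assms(3)[of v] by (subst Ck_on_cong[OF assms(1), where g = "\<lambda>x. f' x v"]) auto
  moreover have "f differentiable (at x)" if "x \<in> S" for x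
    using assms(2)[OF that] by (auto simp: differentiable_def)
  ultimately show ?thesis by simp
qed

lemma Ck_on_has_derivative:
  "Ck_on (Suc k) f S \<Longrightarrow> x \<in> S \<Longrightarrow> (f has_derivative frechet_derivative f (at x)) (at x)"
  by (simp add: frechet_derivative_works[symmetric])

lemma Ck_on_SucD: "Ck_on (Suc k) f S \<Longrightarrow> Ck_on k f S"
proof (induction k arbitrary: f)
  case 0
  then show ?case
    by (simp add: continuous_at_imp_continuous_on differentiable_imp_continuous_within)
next
  case (Suc k)
  then show ?case by simp
qed

lemma Ck_on_subset: "Ck_on k f S \<Longrightarrow> T \<subseteq> S \<Longrightarrow> Ck_on k f T"
  by (induction k arbitrary: f) (auto intro: continuous_on_subset)

lemma Ck_on_locally:
  assumes "\<And>x. x \<in> S \<Longrightarrow> \<exists>U. open U \<and> x \<in> U \<and> Ck_on k f U"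
  shows "Ck_on k f S"
  using assms
proof (induction k arbitrary: f)
  case 0
  then have "\<And>x. x \<in> S \<Longrightarrow> isCont f x"
    by (metis Ck_on.simps(1) continuous_on_eq_continuous_at)
  then show ?case by (simp add: continuous_at_imp_continuous_on)
next
  case (Suc k)
  have "Ck_on k (\<lambda>x. frechet_derivative f (at x) v) S" for v
  proof (rule Suc.IH)
    fix x assume "x \<in> S"
    from Suc.prems[OF this] show "\<exists>U. open U \<and> x \<in> U \<and> Ck_on k (\<lambda>x. frechet_derivative f (at x) v) U"
      by auto
  qed
  moreover have "f differentiable (at x)" if "x \<in> S" for x
    using Suc.prems[OF that] by auto
  ultimately show ?case by simp
qed

lemma Ck_on_const: "open S \<Longrightarrow> Ck_on k (\<lambda>x. c) S"
proof (induction k arbitrary: c)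
  case 0
  show ?case by (simp add: continuous_on_const)
next
  case (Suc k)
  have 1: "((\<lambda>x. c) has_derivative (\<lambda>v. 0)) (at x)" for x
    by (rule has_derivative_const)
  show ?case
    by (rule Ck_on_SucI[OF Suc.prems 1]) (rule Suc.IH[OF Suc.prems])
qed

lemma Ck_on_bounded_linear:
  assumes "open S" "bounded_linear L"
  shows "Ck_on k L S"
proof (cases k)
  case 0
  then show ?thesis using assms by (simp add: linear_continuous_on)
next
  case (Suc m)
  show ?thesis unfolding Suc
    by (rule Ck_on_SucI[where f' = "\<lambda>x. L"]) (use assms in \<open>simp_all add: Ck_on_const bounded_linear.has_derivative[OF assms(2) has_derivative_ident]\<close>)
qed

lemma Ck_on_add: "open S \<Longrightarrow> Ck_on k f S \<Longrightarrow> Ck_on k g S \<Longrightarrow> Ck_on k (\<lambda>x. f x + g x) S"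
proof (induction k arbitrary: f g)
  case 0
  then show ?case by (simp add: continuous_on_add)
next
  case (Suc k)
  show ?case
  proof (rule Ck_on_SucI)
    show "((\<lambda>x. f x + g x) has_derivative
        (\<lambda>v. frechet_derivative f (at x) v + frechet_derivative g (at x) v)) (at x)" if "x \<in> S" for x
      using Ck_on_has_derivative[OF Suc.prems(2) that] Ck_on_has_derivative[OF Suc.prems(3) that]
      by (rule has_derivative_add)
  qed (use Suc in auto)
qed

text \<open>One product rule for scaling, real multiplication and the inner product. The
  undifferentiated factors are one order better than required, so \<open>Ck_on_SucD\<close> lowers
  them and the induction hypothesis applies to both Leibniz summands.\<close>

lemma Ck_on_bilinear:
  assumes B: "bounded_bilinear B" and S: "open S"
  shows "Ck_on k f S \<Longrightarrow> Ck_on k g S \<Longrightarrow> Ck_on k (\<lambda>x. B (f x) (g x)) S"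
proof (induction k arbitrary: f g)
  case 0
  then show ?case by (simp add: bounded_bilinear.continuous_on[OF B])
next
  case (Suc k)
  show ?case
  proof (rule Ck_on_SucI[OF S])
    show "((\<lambda>x. B (f x) (g x)) has_derivative
        (\<lambda>v. B (f x) (frechet_derivative g (at x) v) + B (frechet_derivative f (at x) v) (g x))) (at x)"
      if "x \<in> S" for x
      using Ck_on_has_derivative[OF Suc.prems(1) that] Ck_on_has_derivative[OF Suc.prems(2) that]
      by (rule bounded_bilinear.FDERIV[OF B])
    show "Ck_on k (\<lambda>x. B (f x) (frechet_derivative g (at x) v) + B (frechet_derivative f (at x) v) (g x)) S" for v
      using Suc.prems Ck_on_SucD[OF Suc.prems(1)] Ck_on_SucD[OF Suc.prems(2)]
      by (intro Ck_on_add S Suc.IH) auto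
  qed
qed

lemma Ck_on_sum:
  "open S \<Longrightarrow> (\<And>i. i \<in> I \<Longrightarrow> Ck_on k (f i) S) \<Longrightarrow> Ck_on k (\<lambda>x. \<Sum>i\<in>I. f i x) S"
  by (induction I rule: infinite_finite_induct) (auto intro: Ck_on_const Ck_on_add)

text \<open>\<open>Ck_on\<close> differentiates in fixed directions, whereas the chain rule produces
  directions that vary with the point. The basis expansion turns the latter into sums of the former
  with scalar coefficients.\<close>

lemma linear_basis_expansion:
  fixes L :: "'a::euclidean_space \<Rightarrow> 'b::real_vector"
  assumes "linear L"
  shows "L v = (\<Sum>b\<in>Basis. (v \<bullet> b) *\<^sub>R L b)"
proof -
  have "L v = L (\<Sum>b\<in>Basis. (v \<bullet> b) *\<^sub>R b)" by (simp add: euclidean_representation)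
  also have "\<dots> = (\<Sum>b\<in>Basis. (v \<bullet> b) *\<^sub>R L b)"
    using assms by (simp add: linear_sum linear_cmul)
  finally show ?thesis .
qed

lemma Ck_on_compose:
  fixes f :: "'a::real_normed_vector \<Rightarrow> 'b::euclidean_space" and g :: "'b \<Rightarrow> 'c::real_normed_vector"
  assumes S: "open S" and T: "open T" and fST: "f ` S \<subseteq> T"
  shows "Ck_on k f S \<Longrightarrow> Ck_on k g T \<Longrightarrow> Ck_on k (\<lambda>x. g (f x)) S"
proof (induction k arbitrary: g)
  case 0
  then show ?case using fST by (auto intro: continuous_on_compose2)
next
  case (Suc k)
  let ?f' = "\<lambda>x. frechet_derivative f (at x)" and ?g' = "\<lambda>y. frechet_derivative g (at y)"
  have dg: "(g has_derivative ?g' (f x)) (at (f x))" if "x \<in> S" for x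
    using Ck_on_has_derivative[OF Suc.prems(2)] fST that by auto
  show ?case
  proof (rule Ck_on_SucI[OF S])
    show "((\<lambda>x. g (f x)) has_derivative (\<lambda>v. ?g' (f x) (?f' x v))) (at x)" if "x \<in> S" for x
      using has_derivative_compose[OF Ck_on_has_derivative[OF Suc.prems(1) that] dg[OF that]] .
    fix v
    have "Ck_on k (\<lambda>x. \<Sum>b\<in>Basis. (?f' x v \<bullet> b) *\<^sub>R ?g' (f x) b) S"
    proof (intro Ck_on_sum S Ck_on_bilinear[OF bounded_bilinear_scaleR] Ck_on_bilinear[OF bounded_bilinear_inner])
      show "Ck_on k (\<lambda>x. ?g' (f x) b) S" for b
        using Suc.IH[of "\<lambda>y. ?g' y b"] Suc.prems Ck_on_SucD by auto
    qed (use Suc.prems in \<open>auto intro: Ck_on_const S\<close>)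
    moreover have "(\<Sum>b\<in>Basis. (?f' x v \<bullet> b) *\<^sub>R ?g' (f x) b) = ?g' (f x) (?f' x v)" if "x \<in> S" for x
      using linear_basis_expansion[OF has_derivative_linear[OF dg[OF that]], of "?f' x v"] by simp
    ultimately show "Ck_on k (\<lambda>x. ?g' (f x) (?f' x v)) S"
      by (subst Ck_on_cong[OF S, symmetric]) assumption+
  qed
qed

section \<open>Calculus rules for infinitely differentiable maps\<close>

lemma smooth_on_cong:
  "open S \<Longrightarrow> (\<And>x. x \<in> S \<Longrightarrow> f x = g x) \<Longrightarrow> smooth_on S f \<longleftrightarrow> smooth_on S g"
  by (simp add: smooth_on_def Ck_on_cong[of S f g])

lemma smooth_on_transform:
  "open S \<Longrightarrow> smooth_on S g \<Longrightarrow> (\<And>x. x \<in> S \<Longrightarrow> g x = f x) \<Longrightarrow> smooth_on S f"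
  using smooth_on_cong[of S g f] by blast

lemma smooth_on_subset: "smooth_on S f \<Longrightarrow> T \<subseteq> S \<Longrightarrow> smooth_on T f"
  unfolding smooth_on_def using Ck_on_subset by blast

lemma smooth_on_locally:
  "(\<And>x. x \<in> S \<Longrightarrow> \<exists>U. open U \<and> x \<in> U \<and> smooth_on U f) \<Longrightarrow> smooth_on S f"
  unfolding smooth_on_def using Ck_on_locally by metis

lemma smooth_on_differentiable: "smooth_on S f \<Longrightarrow> x \<in> S \<Longrightarrow> f differentiable (at x)"
  unfolding smooth_on_def by (metis Ck_on.simps(2))

lemma smooth_on_has_derivative:
  "smooth_on S f \<Longrightarrow> x \<in> S \<Longrightarrow> (f has_derivative frechet_derivative f (at x)) (at x)"
  by (simp add: smooth_on_differentiable frechet_derivative_works[symmetric])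

lemma smooth_on_linear_derivative:
  "smooth_on S f \<Longrightarrow> x \<in> S \<Longrightarrow> linear (frechet_derivative f (at x))"
  using smooth_on_has_derivative has_derivative_linear by blast

lemma smooth_on_continuous_on: "smooth_on S f \<Longrightarrow> continuous_on S f"
  unfolding smooth_on_def by (metis Ck_on.simps(1))

lemma smooth_on_derivative: "smooth_on S f \<Longrightarrow> smooth_on S (\<lambda>x. frechet_derivative f (at x) v)"
  unfolding smooth_on_def by (metis Ck_on.simps(2))

lemma smooth_on_const: "open S \<Longrightarrow> smooth_on S (\<lambda>x. c)"
  by (simp add: smooth_on_def Ck_on_const)

lemma smooth_on_bounded_linear: "open S \<Longrightarrow> bounded_linear L \<Longrightarrow> smooth_on S L"
  by (simp add: smooth_on_def Ck_on_bounded_linear)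

lemma smooth_on_id: "open S \<Longrightarrow> smooth_on S (\<lambda>x. x)"
  by (rule smooth_on_bounded_linear) (auto intro: bounded_linear_ident)

lemma smooth_on_add: "open S \<Longrightarrow> smooth_on S f \<Longrightarrow> smooth_on S g \<Longrightarrow> smooth_on S (\<lambda>x. f x + g x)"
  by (simp add: smooth_on_def Ck_on_add)

lemma smooth_on_sum:
  "open S \<Longrightarrow> (\<And>i. i \<in> I \<Longrightarrow> smooth_on S (f i)) \<Longrightarrow> smooth_on S (\<lambda>x. \<Sum>i\<in>I. f i x)"
  by (simp add: smooth_on_def Ck_on_sum)

lemma smooth_on_bilinear:
  "bounded_bilinear B \<Longrightarrow> open S \<Longrightarrow> smooth_on S f \<Longrightarrow> smooth_on S g \<Longrightarrow> smooth_on S (\<lambda>x. B (f x) (g x))"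
  by (simp add: smooth_on_def Ck_on_bilinear)

lemmas smooth_on_scaleR = smooth_on_bilinear[OF bounded_bilinear_scaleR]
lemmas smooth_on_mult = smooth_on_bilinear[OF bounded_bilinear_mult]
lemmas smooth_on_inner = smooth_on_bilinear[OF bounded_bilinear_inner]

lemma smooth_on_uminus: "open S \<Longrightarrow> smooth_on S f \<Longrightarrow> smooth_on S (\<lambda>x. - f x)"
  using smooth_on_scaleR[of S "\<lambda>x. -1" f] by (simp add: smooth_on_const)

lemma smooth_on_diff: "open S \<Longrightarrow> smooth_on S f \<Longrightarrow> smooth_on S g \<Longrightarrow> smooth_on S (\<lambda>x. f x - g x)"
  using smooth_on_add[of S f "\<lambda>x. - g x"] by (simp add: smooth_on_uminus)

lemma smooth_on_prod:
  fixes f :: "'i \<Rightarrow> 'a::real_normed_vector \<Rightarrow> real"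
  shows "open S \<Longrightarrow> (\<And>i. i \<in> I \<Longrightarrow> smooth_on S (f i)) \<Longrightarrow> smooth_on S (\<lambda>x. \<Prod>i\<in>I. f i x)"
  by (induction I rule: infinite_finite_induct) (auto intro: smooth_on_const smooth_on_mult)

lemma smooth_on_compose:
  fixes f :: "'a::real_normed_vector \<Rightarrow> 'b::euclidean_space" and g :: "'b \<Rightarrow> 'c::real_normed_vector"
  assumes "open S" "open T" "f ` S \<subseteq> T" "smooth_on S f" "smooth_on T g"
  shows "smooth_on S (\<lambda>x. g (f x))"
  using assms Ck_on_compose unfolding smooth_on_def by blast

lemma smooth_on_bounded_linear_compose:
  assumes "open S" "bounded_linear L" "smooth_on S f"
  shows "smooth_on S (\<lambda>x. L (f x))"
proof -
  have "Ck_on k f S \<Longrightarrow> Ck_on k (\<lambda>x. L (f x)) S" for k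
  proof (induction k arbitrary: f)
    case 0
    then show ?case using bounded_linear.continuous_on[OF assms(2)] by simp
  next
    case (Suc k)
    show ?case
    proof (rule Ck_on_SucI[OF assms(1)])
      show "((\<lambda>x. L (f x)) has_derivative (\<lambda>v. L (frechet_derivative f (at x) v))) (at x)" if "x \<in> S" for x
        by (rule bounded_linear.has_derivative[OF assms(2) Ck_on_has_derivative[OF Suc.prems that]])
    qed (use Suc in auto)
  qed
  then show ?thesis using assms(3) by (simp add: smooth_on_def)
qed

text \<open>Joint smoothness of the derivative in base point and direction. It serves the tangent
  map of a coordinate change, both for components of vector fields and for the transition maps of
  the slit bundle.\<close>

lemma smooth_on_derivative_apply:
  fixes f :: "'a::real_normed_vector \<Rightarrow> 'b::euclidean_space" and g :: "'b \<Rightarrow> 'c::real_normed_vector"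
  assumes S: "open S" and T: "open T" "f ` S \<subseteq> T" "smooth_on S f" "smooth_on T g" and w: "smooth_on S w"
  shows "smooth_on S (\<lambda>x. frechet_derivative g (at (f x)) (w x))"
proof -
  have "smooth_on S (\<lambda>x. \<Sum>b\<in>Basis. (w x \<bullet> b) *\<^sub>R frechet_derivative g (at (f x)) b)"
    by (intro smooth_on_sum smooth_on_scaleR smooth_on_inner S w smooth_on_const
        smooth_on_compose[OF S T(1-3)] smooth_on_derivative T)
  moreover have "\<And>x. x \<in> S \<Longrightarrow> (\<Sum>b\<in>Basis. (w x \<bullet> b) *\<^sub>R frechet_derivative g (at (f x)) b) =
      frechet_derivative g (at (f x)) (w x)"
    using T(2) by (intro linear_basis_expansion[symmetric] smooth_on_linear_derivative[OF T(4)]) auto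
  ultimately show ?thesis by (rule smooth_on_transform[OF S])
qed

text \<open>Product rule for the pairing of the derivative of \<open>T\<close> with a moving vector.
  The second term, with the vector frozen at \<open>w z\<close>, is the second derivative that
  enters the transformation law of a bracket.\<close>

lemma frechet_derivative_of_derivative_apply:
  fixes T :: "'a::euclidean_space \<Rightarrow> 'b::real_normed_vector"
  assumes S: "open S" "z \<in> S" and T: "smooth_on S T" and w: "smooth_on S w"
  shows "frechet_derivative (\<lambda>x. frechet_derivative T (at x) (w x)) (at z) v =
      frechet_derivative T (at z) (frechet_derivative w (at z) v)
    + frechet_derivative (\<lambda>x. frechet_derivative T (at x) (w z)) (at z) v"
proof -
  let ?T = "\<lambda>b x. frechet_derivative T (at x) b"
  let ?T' = "\<lambda>b. frechet_derivative (?T b) (at z)"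
  let ?w' = "frechet_derivative w (at z)"
  have exp: "?T e x = (\<Sum>b\<in>Basis. (e \<bullet> b) *\<^sub>R ?T b x)" if "x \<in> S" for x e
    by (rule linear_basis_expansion[OF smooth_on_linear_derivative[OF T that]])
  have dT: "(?T b has_derivative ?T' b) (at z)" for b
    by (rule smooth_on_has_derivative[OF smooth_on_derivative[OF T] S(2)])
  have dw: "(w has_derivative ?w') (at z)" by (rule smooth_on_has_derivative[OF w S(2)])
  have "((\<lambda>x. \<Sum>b\<in>Basis. (w x \<bullet> b) *\<^sub>R ?T b x) has_derivative
      (\<lambda>v. \<Sum>b\<in>Basis. (w z \<bullet> b) *\<^sub>R ?T' b v + (?w' v \<bullet> b) *\<^sub>R ?T b z)) (at z)"
    by (intro has_derivative_sum has_derivative_scaleR has_derivative_inner_left dw dT)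
  then have der: "((\<lambda>x. ?T (w x) x) has_derivative
      (\<lambda>v. \<Sum>b\<in>Basis. (w z \<bullet> b) *\<^sub>R ?T' b v + (?w' v \<bullet> b) *\<^sub>R ?T b z)) (at z)"
    by (rule has_derivative_transform_within_open[OF _ S]) (rule exp[symmetric])
  have 1: "frechet_derivative (\<lambda>x. ?T (w x) x) (at z) v =
      (\<Sum>b\<in>Basis. (w z \<bullet> b) *\<^sub>R ?T' b v) + (\<Sum>b\<in>Basis. (?w' v \<bullet> b) *\<^sub>R ?T b z)"
    unfolding sum.distrib[symmetric] by (rule fun_cong[OF frechet_derivative_at[OF der], symmetric])
  have "((\<lambda>x. \<Sum>b\<in>Basis. (w z \<bullet> b) *\<^sub>R ?T b x) has_derivative
      (\<lambda>v. \<Sum>b\<in>Basis. (w z \<bullet> b) *\<^sub>R ?T' b v)) (at z)"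
    by (intro has_derivative_sum has_derivative_scaleR_right dT)
  then have der: "(?T (w z) has_derivative (\<lambda>v. \<Sum>b\<in>Basis. (w z \<bullet> b) *\<^sub>R ?T' b v)) (at z)"
    by (rule has_derivative_transform_within_open[OF _ S]) (rule exp[symmetric])
  have 2: "?T' (w z) v = (\<Sum>b\<in>Basis. (w z \<bullet> b) *\<^sub>R ?T' b v)"
    by (rule fun_cong[OF frechet_derivative_at[OF der], symmetric])
  show ?thesis unfolding 1 2 exp[OF S(2), of "?w' v", symmetric] by (rule add.commute)
qed

lemma smooth_on_Pair:
  assumes "open S" "smooth_on S f" "smooth_on S g"
  shows "smooth_on S (\<lambda>x. (f x, g x))"
proof -
  have "smooth_on S (\<lambda>x. (f x, 0) + (0, g x))"
    by (intro smooth_on_add assms smooth_on_bounded_linear_compose[OF assms(1) _ assms(2), of "\<lambda>a. (a, 0)"]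
        smooth_on_bounded_linear_compose[OF assms(1) _ assms(3), of "\<lambda>a. (0, a)"]
        bounded_linear_Pair bounded_linear_ident bounded_linear_zero)
  then show ?thesis by simp
qed

lemma smooth_on_vec_lambda:
  assumes "open S" "\<And>i::'n::finite. smooth_on S (\<lambda>x. f x i)"
  shows "smooth_on S (\<lambda>x. (\<chi> i. f x i) :: real^'n)"
proof -
  have "smooth_on S (\<lambda>x. \<Sum>i\<in>UNIV. f x i *\<^sub>R (axis i 1 :: real^'n))"
    by (intro smooth_on_sum smooth_on_scaleR assms smooth_on_const)
  moreover have "(\<Sum>i\<in>UNIV. a i *\<^sub>R (axis i 1 :: real^'n)) = (\<chi> i. a i)" for a
    by (auto simp: vec_eq_iff axis_def if_distrib sum.delta cong: if_cong)
  ultimately show ?thesis by simp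
qed

section \<open>Reciprocals, determinants and inverse matrices\<close>

text \<open>The derivative \<open>- (inverse x * v * inverse x)\<close> is built from
  \<open>inverse\<close> by products, so the induction hypothesis for \<open>inverse\<close> itself
  suffices.\<close>

lemma smooth_on_inverse_real: "smooth_on (- {0::real}) inverse"
proof -
  have "Ck_on k inverse (- {0::real})" for k
  proof (induction k)
    case 0
    then show ?case by (auto intro!: continuous_intros)
  next
    case (Suc k)
    have "Ck_on k (\<lambda>x::real. - (inverse x * v * inverse x)) (- {0})" for v
      using Ck_on_bilinear[OF bounded_bilinear_mult _ Ck_on_bilinear[OF bounded_bilinear_mult _ Suc]
          Ck_on_bilinear[OF bounded_bilinear_mult _ Suc], of "\<lambda>_. -v" "\<lambda>_. 1"]
      by (simp add: Ck_on_const open_delete mult.commute mult.left_commute Compl_eq_Diff_UNIV)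
    then show ?case
      by (intro Ck_on_SucI[where f' = "\<lambda>x v. - (inverse x * v * inverse x)"])
        (auto intro!: has_derivative_inverse' simp: open_delete Compl_eq_Diff_UNIV)
  qed
  then show ?thesis by (simp add: smooth_on_def)
qed

lemma smooth_on_divide:
  fixes f g :: "'a::real_normed_vector \<Rightarrow> real"
  assumes "open S" "smooth_on S f" "smooth_on S g" "\<And>x. x \<in> S \<Longrightarrow> g x \<noteq> 0"
  shows "smooth_on S (\<lambda>x. f x / g x)"
proof -
  have "smooth_on S (\<lambda>x. inverse (g x))"
    by (rule smooth_on_compose[OF assms(1) _ _ assms(3) smooth_on_inverse_real])
      (use assms(4) in \<open>auto simp: open_delete Compl_eq_Diff_UNIV\<close>)
  from smooth_on_mult[OF assms(1,2) this] show ?thesis by (simp add: divide_inverse)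
qed

lemma smooth_on_det:
  assumes "open S" "\<And>i j::'n::finite. smooth_on S (\<lambda>x. M x $ i $ j)"
  shows "smooth_on S (\<lambda>x. det (M x :: real^'n^'n))"
  unfolding det_def by (intro smooth_on_sum smooth_on_mult smooth_on_prod smooth_on_const assms)

lemma matrix_inv_mult:
  fixes M :: "'a::semiring_1^'n^'n"
  assumes "invertible M"
  shows "M ** matrix_inv M = mat 1" "matrix_inv M ** M = mat 1"
  using assms someI_ex[of "\<lambda>M'. M ** M' = mat 1 \<and> M' ** M = mat 1"]
  by (auto simp: invertible_def matrix_inv_def)

text \<open>Cramer's rule writes each entry of the inverse as a quotient of determinants, which are
  polynomials in the entries, with a nonvanishing denominator.\<close>

lemma smooth_on_matrix_inv:
  assumes S: "open S" and M: "\<And>i j::'n::finite. smooth_on S (\<lambda>x. M x $ i $ j)"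
    and inv: "\<And>x. x \<in> S \<Longrightarrow> invertible (M x :: real^'n^'n)"
  shows "smooth_on S (\<lambda>x. matrix_inv (M x) $ i $ k)"
proof -
  \<comment> \<open>\<open>M x\<close> with column \<open>i\<close> replaced by the unit vector
    \<open>k\<close>: the numerator in Cramer's rule for the \<open>k\<close>-th column of the
    inverse.\<close>
  let ?N = "\<lambda>x. \<chi> a j. if j = i then axis k 1 $ a else M x $ a $ j"
  have eq: "matrix_inv (M x) $ i $ k = det (?N x) / det (M x)" if "x \<in> S" for x
  proof -
    have "M x *v (matrix_inv (M x) *v axis k 1) = axis k 1"
      using inv[OF that] by (simp add: matrix_vector_mul_assoc matrix_inv_mult)
    then have "matrix_inv (M x) *v axis k 1
        = (\<chi> l. det (\<chi> a j. if j = l then axis k 1 $ a else M x $ a $ j) / det (M x))"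
      using cramer[of "M x"] inv[OF that] by (simp add: invertible_det_nz)
    then have "(matrix_inv (M x) *v axis k 1) $ i = det (?N x) / det (M x)" by simp
    then show ?thesis by (simp add: matrix_vector_mult_basis column_def)
  qed
  moreover have "smooth_on S (\<lambda>x. det (?N x) / det (M x))"
  proof (intro smooth_on_divide smooth_on_det S M)
    show "smooth_on S (\<lambda>x. ?N x $ a $ j)" for a j
      by (cases "j = i") (auto intro: smooth_on_const S M)
  qed (use inv in \<open>auto simp: invertible_det_nz\<close>)
  ultimately show ?thesis by (auto intro: smooth_on_transform[OF S])
qed

section \<open>Bump functions\<close>

text \<open>The classical flat function at \<open>m = 0\<close>. The factor
  \<open>inverse t ^ m\<close> makes the family closed under differentiation up to linear
  combinations, so one induction on the order handles all \<open>m\<close>.\<close>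

definition flat_exp :: "nat \<Rightarrow> real \<Rightarrow> real" where
  "flat_exp m t = (if t > 0 then exp (- inverse t) * inverse t ^ m else 0)"

lemma flat_exp_tendsto: "((\<lambda>t. flat_exp m t) \<longlongrightarrow> 0) (at 0)"
proof -
  have "((\<lambda>s::real. s ^ m / exp s) \<longlongrightarrow> 0) at_top" by (rule tendsto_power_div_exp_0)
  then have "((\<lambda>t::real. inverse t ^ m / exp (inverse t)) \<longlongrightarrow> 0) (at_right 0)"
    by (rule filterlim_compose) (rule filterlim_inverse_at_top_right)
  then have r: "((\<lambda>t. flat_exp m t) \<longlongrightarrow> 0) (at_right 0)"
    by (rule Lim_transform_eventually)
      (auto simp: flat_exp_def eventually_at_right_less exp_minus field_simps
        intro!: eventually_mono[OF eventually_at_right_less])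
  have "((\<lambda>t. flat_exp m t) \<longlongrightarrow> 0) (at_left 0)"
    by (rule tendsto_eventually) (auto simp: flat_exp_def eventually_at_left_field intro!: exI[of _ "-1"])
  with r show ?thesis by (simp add: filterlim_at_split)
qed

lemma flat_exp_has_derivative:
  "(flat_exp m has_derivative (\<lambda>v. v * (flat_exp (m + 2) t - real m * flat_exp (m + 1) t))) (at t)"
proof -
  consider "t > 0" | "t < 0" | "t = 0" by linarith
  then have "(flat_exp m has_field_derivative (flat_exp (m + 2) t - real m * flat_exp (m + 1) t)) (at t)"
  proof cases
    case 1
    have "((\<lambda>t. exp (- inverse t) * inverse t ^ m) has_field_derivative
        (flat_exp (m + 2) t - real m * flat_exp (m + 1) t)) (at t)"
      using 1 by (cases m)
        (auto intro!: derivative_eq_intros simp: flat_exp_def power2_eq_square algebra_simps,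
         metis One_nat_def Suc_pred neq0_conv power_Suc)
    then show ?thesis
      by (rule has_field_derivative_transform_within_open[where S = "{0<..}"]) (use 1 in \<open>auto simp: flat_exp_def\<close>)
  next
    case 2
    have "((\<lambda>t. 0) has_field_derivative (flat_exp (m + 2) t - real m * flat_exp (m + 1) t)) (at t)"
      using 2 by (simp add: flat_exp_def)
    then show ?thesis
      by (rule has_field_derivative_transform_within_open[where S = "{..<0}"]) (use 2 in \<open>auto simp: flat_exp_def\<close>)
  next
    case 3
    have "((\<lambda>h. flat_exp (m + 1) h) \<longlongrightarrow> 0) (at 0)" by (rule flat_exp_tendsto)
    \<comment> \<open>As the value at 0 is 0, the difference quotient there is
      \<open>flat_exp (m + 1) h\<close>; its limit 0 is also the value of the claimed
      derivative.\<close>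
    then have "((\<lambda>h. (flat_exp m (0 + h) - flat_exp m 0) / h) \<longlongrightarrow> 0) (at 0)"
      by (rule Lim_transform_eventually) (auto simp: flat_exp_def divide_inverse eventually_at_filter)
    then show ?thesis using 3 by (simp add: DERIV_def flat_exp_def)
  qed
  then show ?thesis by (simp add: has_field_derivative_def mult.commute[of _ "_ - _"])
qed

lemma smooth_on_flat_exp: "smooth_on UNIV (flat_exp m)"
proof -
  have "Ck_on k (flat_exp m) UNIV" for k
  proof (induction k arbitrary: m)
    case 0
    then show ?case
      by (auto intro!: continuous_at_imp_continuous_on has_derivative_continuous[OF flat_exp_has_derivative])
  next
    case (Suc k)
    have "Ck_on k (\<lambda>t. v * (flat_exp (m + 2) t + (- real m) * flat_exp (m + 1) t)) UNIV" for v
      by (intro Ck_on_bilinear[OF bounded_bilinear_mult] Ck_on_const Ck_on_add Suc open_UNIV)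
    then show ?case
      by (intro Ck_on_SucI[OF _ flat_exp_has_derivative]) auto
  qed
  then show ?thesis by (simp add: smooth_on_def)
qed

text \<open>The quotient \<open>f / (f + g)\<close>, where \<open>f\<close> is positive exactly
  inside radius \<open>r\<close> and \<open>g\<close> exactly outside radius \<open>r / 2\<close>;
  the two regions cover the space, so the denominator is positive. The squared distance is used
  because it is smooth at \<open>x0\<close> as well.\<close>

lemma smooth_bump:
  fixes x0 :: "'a::euclidean_space"
  assumes "r > 0"
  obtains b :: "'a \<Rightarrow> real" where "smooth_on UNIV b" "\<And>x. dist x0 x < r / 2 \<Longrightarrow> b x = 1"
    "\<And>x. dist x0 x \<ge> r \<Longrightarrow> b x = 0"
proof
  define q where "q = (\<lambda>x::'a. (x - x0) \<bullet> (x - x0))"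
  have q: "q x = (dist x0 x)\<^sup>2" for x
    by (simp add: q_def dist_norm power2_norm_eq_inner norm_minus_commute inner_commute
        flip: power2_norm_eq_inner)
  define f where "f = (\<lambda>x. flat_exp 0 (r\<^sup>2 - q x))"
  define g where "g = (\<lambda>x. flat_exp 0 (q x - r\<^sup>2 / 4))"
  define b where "b = (\<lambda>x. f x / (f x + g x))"
  have sq: "smooth_on UNIV q" unfolding q_def
    by (intro smooth_on_inner smooth_on_diff smooth_on_id smooth_on_const open_UNIV)
  have sf: "smooth_on UNIV f" "smooth_on UNIV g" unfolding f_def g_def
    by (intro smooth_on_compose[OF _ _ _ _ smooth_on_flat_exp] smooth_on_diff sq smooth_on_const open_UNIV subset_UNIV)+
  have r2: "r\<^sup>2 > 0" using assms by simp
  have nonneg: "flat_exp 0 t \<ge> 0" and pos: "t > 0 \<Longrightarrow> flat_exp 0 t > 0" for t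
    by (auto simp: flat_exp_def)
  have fg: "f x + g x > 0" for x
  proof (cases "q x < r\<^sup>2")
    case True
    then show ?thesis using nonneg[of "q x - r\<^sup>2/4"] pos[of "r\<^sup>2 - q x"] by (simp add: f_def g_def)
  next
    case False
    then have "q x - r\<^sup>2 / 4 > 0" using r2 by linarith
    then show ?thesis using pos[of "q x - r\<^sup>2/4"] nonneg[of "r\<^sup>2 - q x"] by (simp add: f_def g_def)
  qed
  show "smooth_on UNIV b" unfolding b_def
    by (intro smooth_on_divide smooth_on_add sf open_UNIV) (metis fg less_irrefl)
  show "b x = 1" if "dist x0 x < r / 2" for x
  proof -
    have "q x < (r/2)\<^sup>2" unfolding q using that by (intro power_strict_mono) auto
    then have le: "q x < r\<^sup>2/4" by (simp add: power_divide)
    then have "g x = 0" by (simp add: g_def flat_exp_def)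
    moreover have "f x > 0" unfolding f_def by (rule pos) (use le r2 in linarith)
    ultimately show ?thesis by (simp add: b_def)
  qed
  show "b x = 0" if "dist x0 x \<ge> r" for x
  proof -
    have "r\<^sup>2 \<le> q x" unfolding q using that assms by (intro power_mono) auto
    then show ?thesis by (simp add: b_def f_def flat_exp_def)
  qed
qed

section \<open>Calculus on an atlas\<close>

lemma vscale_apply [simp]: "(a \<odot> v) c = a *\<^sub>R v c"
  by (simp add: vscale_def)

lemma fscale_apply [simp]: "fscale f X u = f u \<odot> X u"
  by (simp add: fscale_def)

lemma sum_fun_apply: "(\<Sum>i\<in>I. f i) x = (\<Sum>i\<in>I. f i x)"
  by (induction I rule: infinite_finite_induct) auto

lemma chart_inv_mem: "z \<in> chart_image c \<Longrightarrow> chart_inv c z \<in> fst c"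
  by (simp add: chart_image_def chart_inv_def inv_into_into)

lemma snd_chart_inv: "z \<in> chart_image c \<Longrightarrow> snd c (chart_inv c z) = z"
  by (simp add: chart_image_def chart_inv_def f_inv_into_f)

lemma snd_mem_chart_image: "p \<in> fst c \<Longrightarrow> snd c p \<in> chart_image c"
  by (simp add: chart_image_def)

lemma mem_points: "c \<in> B \<Longrightarrow> p \<in> fst c \<Longrightarrow> p \<in> points B"
  by (auto simp: points_def)

abbreviation dtrans :: "('a, 'e::euclidean_space) chart \<Rightarrow> ('a, 'e) chart \<Rightarrow> 'a \<Rightarrow> 'e \<Rightarrow> 'e" where
  "dtrans c d p \<equiv> frechet_derivative (transition c d) (at (snd c p))"

locale atlas =
  fixes B :: "('a, 'e::euclidean_space) chart set"
  assumes smooth: "smooth_atlas B"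
begin

lemma inj: "c \<in> B \<Longrightarrow> inj_on (snd c) (fst c)"
  and open_chart_image: "c \<in> B \<Longrightarrow> open (chart_image c)"
  and open_overlap: "c \<in> B \<Longrightarrow> d \<in> B \<Longrightarrow> open (snd c ` (fst c \<inter> fst d))"
  and smooth_transition: "c \<in> B \<Longrightarrow> d \<in> B \<Longrightarrow> smooth_on (snd c ` (fst c \<inter> fst d)) (transition c d)"
  using smooth by (auto simp: smooth_atlas_def)

lemma chart_inv_snd: "c \<in> B \<Longrightarrow> p \<in> fst c \<Longrightarrow> chart_inv c (snd c p) = p"
  by (simp add: chart_inv_def inv_into_f_f inj)

lemma transition_snd: "c \<in> B \<Longrightarrow> p \<in> fst c \<Longrightarrow> transition c d (snd c p) = snd d p"
  by (simp add: transition_def chart_inv_snd)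

lemma openin_iff: "openin (atlas_topology B) W \<longleftrightarrow> atlas_open B W"
  unfolding atlas_topology_def using topology_inverse'[OF istopology_atlas_open[OF smooth]] by simp

lemma open_chart_of_openin:
  "openin (atlas_topology B) W \<Longrightarrow> c \<in> B \<Longrightarrow> open (snd c ` (fst c \<inter> W))"
  by (simp add: openin_iff atlas_open_def)

lemma openin_subset_points: "openin (atlas_topology B) W \<Longrightarrow> W \<subseteq> points B"
  by (simp add: openin_iff atlas_open_def)

lemma openin_fst: "d \<in> B \<Longrightarrow> openin (atlas_topology B) (fst d)"
  by (auto simp: openin_iff atlas_open_def points_def open_overlap)

lemma topspace_atlas: "topspace (atlas_topology B) = points B"
proof
  show "topspace (atlas_topology B) \<subseteq> points B"
    by (rule openin_subset_points[OF openin_topspace])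
  show "points B \<subseteq> topspace (atlas_topology B)"
    using openin_fst openin_subset by (fastforce simp: points_def)
qed

text \<open>This makes the image of a closed coordinate ball compact in the manifold topology, as is
  required of the support of a bump function.\<close>

lemma continuous_map_chart_inv:
  assumes c: "c \<in> B"
  shows "continuous_map (top_of_set (chart_image c)) (atlas_topology B) (chart_inv c)"
proof -
  have eq: "{z \<in> chart_image c. chart_inv c z \<in> U} = snd c ` (fst c \<inter> U)" for U
  proof (intro set_eqI iffI)
    fix z assume "z \<in> {z \<in> chart_image c. chart_inv c z \<in> U}"
    then show "z \<in> snd c ` (fst c \<inter> U)"
      by (intro image_eqI[where x = "chart_inv c z"]) (auto simp: snd_chart_inv chart_inv_mem)
  qed (auto simp: chart_inv_snd[OF c] snd_mem_chart_image)
  show ?thesis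
    unfolding continuous_map_alt topspace_atlas
  proof (intro conjI allI impI)
    fix U assume "openin (atlas_topology B) U"
    then show "openin (top_of_set (chart_image c)) (chart_inv c -` U \<inter> topspace (top_of_set (chart_image c)))"
      using eq[of U] open_chart_of_openin[OF _ c] open_chart_image[OF c]
      by (auto simp: openin_open_eq vimage_def Int_def conj_commute)
  next
    show "chart_inv c \<in> topspace (top_of_set (chart_image c)) \<rightarrow> points B"
      using chart_inv_mem[of _ c] mem_points[OF c] by fastforce
  qed
qed

text \<open>\<open>V\<close> is the preimage of \<open>W\<close> under the transition map, open by
  continuity on the open overlap. Local expressions in two charts are compared on it.\<close>

lemma coordinate_change:
  assumes c: "c \<in> B" and d: "d \<in> B" and W: "open W" and p: "p \<in> fst c \<inter> fst d" "snd d p \<in> W"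
  obtains V where "open V" "snd c p \<in> V" "V \<subseteq> snd c ` (fst c \<inter> fst d)"
    "\<And>z. z \<in> V \<Longrightarrow> transition c d z \<in> W"
    "\<And>z. z \<in> V \<Longrightarrow> chart_inv d (transition c d z) = chart_inv c z"
    "\<And>z. z \<in> V \<Longrightarrow> transition c d z \<in> snd d ` (fst c \<inter> fst d)"
proof
  let ?S = "snd c ` (fst c \<inter> fst d)"
  let ?V = "?S \<inter> transition c d -` W"
  show "open ?V"
    using continuous_open_preimage[OF smooth_on_continuous_on[OF smooth_transition[OF c d]] open_overlap[OF c d] W] .
  show "snd c p \<in> ?V" "?V \<subseteq> ?S"
    using p by (auto simp: transition_snd[OF c])
  fix z assume "z \<in> ?V"
  then obtain q where q: "q \<in> fst c" "q \<in> fst d" "z = snd c q" "transition c d z \<in> W" by auto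
  then show "transition c d z \<in> W" "chart_inv d (transition c d z) = chart_inv c z"
    "transition c d z \<in> snd d ` (fst c \<inter> fst d)"
    by (auto simp: transition_snd[OF c] chart_inv_snd c d)
qed

lemma openin_chart_preimage:
  assumes d: "d \<in> B" and U: "open U"
  shows "openin (atlas_topology B) {p \<in> fst d. snd d p \<in> U}"
proof -
  have "snd c ` (fst c \<inter> {p \<in> fst d. snd d p \<in> U}) = snd c ` (fst c \<inter> fst d) \<inter> transition c d -` U"
    if "c \<in> B" for c
    by (auto simp: transition_snd[OF that])
  then have "open (snd c ` (fst c \<inter> {p \<in> fst d. snd d p \<in> U}))" if "c \<in> B" for c
    using that continuous_open_preimage[OF smooth_on_continuous_on[OF smooth_transition[OF that d]]
        open_overlap[OF that d] U] by simp
  then show ?thesis using mem_points[OF d] by (auto simp: openin_iff atlas_open_def)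
qed

lemma transition_has_derivative:
  "c \<in> B \<Longrightarrow> d \<in> B \<Longrightarrow> p \<in> fst c \<Longrightarrow> p \<in> fst d \<Longrightarrow> (transition c d has_derivative dtrans c d p) (at (snd c p))"
  by (rule smooth_on_has_derivative[OF smooth_transition]) auto

lemma linear_dtrans: "c \<in> B \<Longrightarrow> d \<in> B \<Longrightarrow> p \<in> fst c \<Longrightarrow> p \<in> fst d \<Longrightarrow> linear (dtrans c d p)"
  using transition_has_derivative has_derivative_linear by blast

text \<open>Chain rule through the transition map. The codomain of \<open>h\<close> is general: real
  \<open>h\<close> gives directional derivatives, and \<open>h = snd e\<close> gives the cocycle law
  \<open>dtrans_comp\<close>.\<close>

lemma frechet_derivative_coordinate_change:
  assumes c: "c \<in> B" and d: "d \<in> B" and p: "p \<in> fst c" "p \<in> fst d"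
    and h: "(h \<circ> chart_inv d) differentiable (at (snd d p))"
  shows "frechet_derivative (h \<circ> chart_inv c) (at (snd c p)) v =
      frechet_derivative (h \<circ> chart_inv d) (at (snd d p)) (dtrans c d p v)"
    and "(h \<circ> chart_inv c) differentiable (at (snd c p))"
proof -
  obtain V where V: "open V" "snd c p \<in> V"
    "\<And>z. z \<in> V \<Longrightarrow> chart_inv d (transition c d z) = chart_inv c z"
    using coordinate_change[OF c d open_UNIV] p by (metis Int_iff UNIV_I)
  have "((h \<circ> chart_inv d) has_derivative frechet_derivative (h \<circ> chart_inv d) (at (snd d p)))
      (at (transition c d (snd c p)))"
    using h by (simp add: frechet_derivative_works transition_snd c p)
  from has_derivative_compose[OF transition_has_derivative[OF c d p] this]
  have "((\<lambda>z. (h \<circ> chart_inv d) (transition c d z)) has_derivative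
      (\<lambda>v. frechet_derivative (h \<circ> chart_inv d) (at (snd d p)) (dtrans c d p v))) (at (snd c p))" .
  then have *: "((h \<circ> chart_inv c) has_derivative
      (\<lambda>v. frechet_derivative (h \<circ> chart_inv d) (at (snd d p)) (dtrans c d p v))) (at (snd c p))"
    by (rule has_derivative_transform_within_open[OF _ V(1,2)]) (simp add: V(3))
  show "frechet_derivative (h \<circ> chart_inv c) (at (snd c p)) v =
      frechet_derivative (h \<circ> chart_inv d) (at (snd d p)) (dtrans c d p v)"
    using frechet_derivative_at[OF *] by metis
  show "(h \<circ> chart_inv c) differentiable (at (snd c p))"
    using * by (auto simp: differentiable_def)
qed

lemma dtrans_comp:
  assumes "c \<in> B" "d \<in> B" "e \<in> B" "p \<in> fst c" "p \<in> fst d" "p \<in> fst e"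
  shows "dtrans d e p (dtrans c d p v) = dtrans c e p v"
proof -
  have "(snd e \<circ> chart_inv d) differentiable (at (snd d p))"
    using transition_has_derivative[of d e p] assms by (auto simp: transition_def differentiable_def)
  from frechet_derivative_coordinate_change(1)[OF assms(1,2,4,5) this, of v]
  show ?thesis by (simp add: transition_def)
qed

lemma dtrans_self:
  assumes c: "c \<in> B" "p \<in> fst c"
  shows "dtrans c c p v = v"
proof -
  have "(transition c c has_derivative (\<lambda>v. v)) (at (snd c p))"
    by (rule has_derivative_transform_within_open[OF has_derivative_ident open_chart_image[OF c(1)]])
      (auto simp: transition_def snd_chart_inv snd_mem_chart_image c)
  from frechet_derivative_at[OF this] show ?thesis by metis
qed

section \<open>Tangent vectors through their components\<close>

lemma tangent_spaceD:
  "v \<in> tangent_space B p \<Longrightarrow> c \<in> B \<Longrightarrow> d \<in> B \<Longrightarrow> p \<in> fst c \<Longrightarrow> p \<in> fst d \<Longrightarrow> v d = dtrans c d p (v c)"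
  unfolding tangent_space_def by blast

lemma tangent_space_outside: "v \<in> tangent_space B p \<Longrightarrow> \<not> (c \<in> B \<and> p \<in> fst c) \<Longrightarrow> v c = 0"
  unfolding tangent_space_def by blast

lemma tangent_spaceI:
  assumes "\<And>c. \<not> (c \<in> B \<and> p \<in> fst c) \<Longrightarrow> v c = 0"
    and "\<And>c d. c \<in> B \<Longrightarrow> d \<in> B \<Longrightarrow> p \<in> fst c \<Longrightarrow> p \<in> fst d \<Longrightarrow> v d = dtrans c d p (v c)"
  shows "v \<in> tangent_space B p"
  unfolding tangent_space_def mem_Collect_eq
  by (intro conjI ballI allI impI) (erule assms(1), rule assms(2), auto)

lemma vec_in_chart_mem: "d \<in> B \<Longrightarrow> p \<in> fst d \<Longrightarrow> vec_in_chart B d p e \<in> tangent_space B p"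
  by (rule tangent_spaceI) (auto simp: vec_in_chart_def dtrans_comp)

lemma vec_in_chart_self: "d \<in> B \<Longrightarrow> p \<in> fst d \<Longrightarrow> vec_in_chart B d p e d = e"
  by (simp add: vec_in_chart_def dtrans_self)

text \<open>Components in one chart fix those in all others through \<open>dtrans\<close>.
  Identities between tangent vectors thereby become computations in a single chart.\<close>

lemma tangent_eqI:
  assumes "v \<in> tangent_space B p" "w \<in> tangent_space B p" "d \<in> B" "p \<in> fst d" "v d = w d"
  shows "v = w"
proof
  fix c show "v c = w c"
  proof (cases "c \<in> B \<and> p \<in> fst c")
    case True
    then have c: "c \<in> B" "p \<in> fst c" by auto
    have "v c = dtrans d c p (v d)" by (rule tangent_spaceD[OF assms(1,3) c(1) assms(4) c(2)])
    also have "\<dots> = dtrans d c p (w d)" by (rule arg_cong[OF assms(5)])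
    also have "\<dots> = w c" by (rule tangent_spaceD[OF assms(2,3) c(1) assms(4) c(2), symmetric])
    finally show ?thesis .
  next
    case False
    show ?thesis
      unfolding tangent_space_outside[OF assms(1) False] tangent_space_outside[OF assms(2) False] ..
  qed
qed

lemma tangent_space_0: "0 \<in> tangent_space B p"
proof (rule tangent_spaceI)
  show "0 d = dtrans c d p (0 c)" if "c \<in> B" "d \<in> B" "p \<in> fst c" "p \<in> fst d" for c d
    using linear_0[OF linear_dtrans[OF that]] by (simp only: zero_fun_apply)
qed (simp only: zero_fun_apply)

lemma tangent_space_add:
  assumes v: "v \<in> tangent_space B p" and w: "w \<in> tangent_space B p"
  shows "v + w \<in> tangent_space B p"
  by (rule tangent_spaceI)
    (simp_all add: linear_add[OF linear_dtrans] tangent_space_outside[OF v] tangent_space_outside[OF w]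
      tangent_spaceD[OF v, symmetric] tangent_spaceD[OF w, symmetric])

lemma tangent_space_vscale:
  assumes v: "v \<in> tangent_space B p"
  shows "a \<odot> v \<in> tangent_space B p"
  by (rule tangent_spaceI)
    (simp_all add: linear_cmul[OF linear_dtrans] tangent_space_outside[OF v] tangent_spaceD[OF v, symmetric])

lemma tangent_space_uminus: "v \<in> tangent_space B p \<Longrightarrow> - v \<in> tangent_space B p"
  using tangent_space_vscale[of v p "-1"] by (simp add: vscale_def fun_Compl_def)

lemma tangent_space_diff: "v \<in> tangent_space B p \<Longrightarrow> w \<in> tangent_space B p \<Longrightarrow> v - w \<in> tangent_space B p"
  using tangent_space_add[of v p "- w"] tangent_space_uminus[of w p] by simp

lemma tangent_space_sum:
  "(\<And>i. i \<in> I \<Longrightarrow> v i \<in> tangent_space B p) \<Longrightarrow> (\<Sum>i\<in>I. v i) \<in> tangent_space B p"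
  by (induction I rule: infinite_finite_induct) (auto intro: tangent_space_0 tangent_space_add)

section \<open>Smooth functions and vector fields in coordinates\<close>

lemma field_in_chart_transition:
  assumes "X (chart_inv c z) \<in> tangent_space B (chart_inv c z)" "c \<in> B" "d \<in> B"
    and z: "z \<in> snd c ` (fst c \<inter> fst d)"
  shows "field_in_chart d X (transition c d z) =
    frechet_derivative (transition c d) (at z) (field_in_chart c X z)"
proof -
  obtain q where "q \<in> fst c" "q \<in> fst d" "z = snd c q" using z by auto
  then show ?thesis
    using assms tangent_spaceD[of "X q" q c d]
    by (simp add: field_in_chart_def transition_snd chart_inv_snd)
qed

text \<open>The definition quantifies over all charts; composition with a transition map reduces it
  to one convenient chart near each point.\<close>

lemma smooth_functionsI:
  assumes "\<And>p. p \<in> points B \<Longrightarrow>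
    \<exists>d\<in>B. p \<in> fst d \<and> (\<exists>U. open U \<and> snd d p \<in> U \<and> smooth_on U (f \<circ> chart_inv d))"
  shows "f \<in> smooth_functions B"
  unfolding smooth_functions_def mem_Collect_eq
proof (intro ballI smooth_on_locally)
  fix c z assume c: "c \<in> B" and z: "z \<in> chart_image c"
  let ?p = "chart_inv c z"
  have p: "?p \<in> fst c" "snd c ?p = z" using z by (auto simp: chart_inv_mem snd_chart_inv)
  obtain d U where d: "d \<in> B" "?p \<in> fst d" and U: "open U" "snd d ?p \<in> U" "smooth_on U (f \<circ> chart_inv d)"
    using assms[OF mem_points[OF c p(1)]] by blast
  obtain V where V: "open V" "snd c ?p \<in> V" "V \<subseteq> snd c ` (fst c \<inter> fst d)"
    "\<And>z. z \<in> V \<Longrightarrow> transition c d z \<in> U"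
    "\<And>z. z \<in> V \<Longrightarrow> chart_inv d (transition c d z) = chart_inv c z"
    using coordinate_change[OF c d(1) U(1)] p d U(2) by (metis IntI)
  have "smooth_on V (\<lambda>z. (f \<circ> chart_inv d) (transition c d z))"
    by (rule smooth_on_compose[OF V(1) U(1) _ smooth_on_subset[OF smooth_transition[OF c d(1)] V(3)] U(3)])
      (use V(4) in auto)
  then have "smooth_on V (f \<circ> chart_inv c)"
    by (rule smooth_on_transform[OF V(1)]) (simp add: V(5))
  then show "\<exists>U. open U \<and> z \<in> U \<and> smooth_on U (f \<circ> chart_inv c)"
    using V(1,2) p by auto
qed

text \<open>As for functions, but the components are also transformed by the derivative of the
  transition map, which is why smoothness jointly in point and direction is required.\<close>

lemma vector_fieldsI:
  assumes X: "\<And>p. p \<in> points B \<Longrightarrow> X p \<in> tangent_space B p" "\<And>p. p \<notin> points B \<Longrightarrow> X p = 0"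
    and sm: "\<And>p. p \<in> points B \<Longrightarrow>
    \<exists>d\<in>B. p \<in> fst d \<and> (\<exists>U. open U \<and> snd d p \<in> U \<and> smooth_on U (field_in_chart d X))"
  shows "X \<in> vector_fields B"
proof -
  have "smooth_on (chart_image c) (field_in_chart c X)" if c: "c \<in> B" for c
  proof (rule smooth_on_locally)
    fix z assume z: "z \<in> chart_image c"
    let ?p = "chart_inv c z"
    have p: "?p \<in> fst c" "snd c ?p = z" using z by (auto simp: chart_inv_mem snd_chart_inv)
    obtain d U where d: "d \<in> B" "?p \<in> fst d"
      and U: "open U" "snd d ?p \<in> U" "smooth_on U (field_in_chart d X)"
      using sm[OF mem_points[OF c p(1)]] by blast
    let ?O = "snd d ` (fst c \<inter> fst d)"
    obtain V where V: "open V" "snd c ?p \<in> V" "V \<subseteq> snd c ` (fst c \<inter> fst d)"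
      "\<And>z. z \<in> V \<Longrightarrow> transition c d z \<in> U"
      "\<And>z. z \<in> V \<Longrightarrow> chart_inv d (transition c d z) = chart_inv c z"
      "\<And>z. z \<in> V \<Longrightarrow> transition c d z \<in> ?O"
      using coordinate_change[OF c d(1) U(1)] p d U(2) by (metis IntI)
    note tr = smooth_on_subset[OF smooth_transition[OF c d(1)] V(3)]
    have O: "open ?O" "smooth_on ?O (transition d c)"
      using open_overlap[OF d(1) c] smooth_transition[OF d(1) c] by (simp_all add: Int_commute)
    have "smooth_on V (\<lambda>z. frechet_derivative (transition d c) (at (transition c d z))
        (field_in_chart d X (transition c d z)))"
    proof (rule smooth_on_derivative_apply[OF V(1) O(1) _ tr O(2)])
      show "smooth_on V (\<lambda>z. field_in_chart d X (transition c d z))"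
        by (rule smooth_on_compose[OF V(1) U(1) _ tr U(3)]) (use V(4) in auto)
    qed (use V(6) in auto)
    then have "smooth_on V (field_in_chart c X)"
    proof (rule smooth_on_transform[OF V(1)])
      fix w assume w: "w \<in> V"
      then obtain q where q: "q \<in> fst c" "q \<in> fst d" "w = snd c q" using V(3) by auto
      then show "frechet_derivative (transition d c) (at (transition c d w))
          (field_in_chart d X (transition c d w)) = field_in_chart c X w"
        using tangent_spaceD[OF X(1)[OF mem_points[OF c q(1)]] d(1) c]
        by (simp add: field_in_chart_def transition_snd chart_inv_snd c d)
    qed
    then show "\<exists>U. open U \<and> z \<in> U \<and> smooth_on U (field_in_chart c X)"
      using V(1,2) p by auto
  qed
  then show ?thesis using X by (simp add: vector_fields_def)
qed

lemma vector_fields_tangent: "X \<in> vector_fields B \<Longrightarrow> p \<in> points B \<Longrightarrow> X p \<in> tangent_space B p"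
  and vector_fields_outside: "X \<in> vector_fields B \<Longrightarrow> p \<notin> points B \<Longrightarrow> X p = 0"
  and vector_fields_smooth: "X \<in> vector_fields B \<Longrightarrow> c \<in> B \<Longrightarrow> smooth_on (chart_image c) (field_in_chart c X)"
  by (auto simp: vector_fields_def)

lemma vector_fields_has_derivative:
  "X \<in> vector_fields B \<Longrightarrow> c \<in> B \<Longrightarrow> p \<in> fst c \<Longrightarrow>
    (field_in_chart c X has_derivative frechet_derivative (field_in_chart c X) (at (snd c p))) (at (snd c p))"
  by (rule smooth_on_has_derivative[OF vector_fields_smooth]) (auto simp: snd_mem_chart_image)

lemma smooth_functions_smooth: "f \<in> smooth_functions B \<Longrightarrow> c \<in> B \<Longrightarrow> smooth_on (chart_image c) (f \<circ> chart_inv c)"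
  by (auto simp: smooth_functions_def)

lemma smooth_functions_has_derivative:
  "f \<in> smooth_functions B \<Longrightarrow> c \<in> B \<Longrightarrow> p \<in> fst c \<Longrightarrow>
    ((f \<circ> chart_inv c) has_derivative frechet_derivative (f \<circ> chart_inv c) (at (snd c p))) (at (snd c p))"
  by (rule smooth_on_has_derivative[OF smooth_functions_smooth]) (auto simp: snd_mem_chart_image)

lemma smooth_functions_const: "(\<lambda>p. a) \<in> smooth_functions B"
  by (simp add: smooth_functions_def comp_def smooth_on_const open_chart_image)

lemma field_in_chart_add: "field_in_chart c (X + Y) = (\<lambda>z. field_in_chart c X z + field_in_chart c Y z)"
  by (simp add: field_in_chart_def fun_eq_iff)

lemma field_in_chart_fscale:
  "field_in_chart c (fscale f X) = (\<lambda>z. (f \<circ> chart_inv c) z *\<^sub>R field_in_chart c X z)"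
  by (simp add: field_in_chart_def fun_eq_iff)

lemma vector_fields_add: "X \<in> vector_fields B \<Longrightarrow> Y \<in> vector_fields B \<Longrightarrow> X + Y \<in> vector_fields B"
  by (simp add: vector_fields_def tangent_space_add field_in_chart_add smooth_on_add open_chart_image)

lemma vector_fields_fscale:
  assumes f: "f \<in> smooth_functions B" and X: "X \<in> vector_fields B"
  shows "fscale f X \<in> vector_fields B"
proof -
  have "smooth_on (chart_image c) (field_in_chart c (fscale f X))" if "c \<in> B" for c
    unfolding field_in_chart_fscale using that
    by (intro smooth_on_scaleR open_chart_image smooth_functions_smooth[OF f] vector_fields_smooth[OF X])
  moreover have "fscale f X p \<in> tangent_space B p" if "p \<in> points B" for p
    using that by (simp add: tangent_space_vscale vector_fields_tangent[OF X])
  moreover have "fscale f X p = 0" if "p \<notin> points B" for p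
    by (simp add: vector_fields_outside[OF X that] vscale_def fun_eq_iff)
  ultimately show ?thesis by (simp add: vector_fields_def)
qed

section \<open>Derivatives along a field and the Lie bracket\<close>

text \<open>The description in \<open>deriv_along\<close> has a unique value: between charts the
  components of \<open>X p\<close> change by \<open>dtrans\<close> and the derivative of
  \<open>f\<close> by composition with it.\<close>

lemma deriv_along_eq:
  assumes f: "f \<in> smooth_functions B" and X: "X p \<in> tangent_space B p" and c: "c \<in> B" "p \<in> fst c"
  shows "deriv_along B X f p = frechet_derivative (f \<circ> chart_inv c) (at (snd c p)) (X p c)"
  unfolding deriv_along_def
proof (rule the_equality)
  show "\<forall>d\<in>B. p \<in> fst d \<longrightarrow> frechet_derivative (f \<circ> chart_inv c) (at (snd c p)) (X p c) =
      frechet_derivative (f \<circ> chart_inv d) (at (snd d p)) (X p d)"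
  proof (intro ballI impI)
    fix d assume d: "d \<in> B" "p \<in> fst d"
    have "(f \<circ> chart_inv d) differentiable (at (snd d p))"
      using smooth_functions_has_derivative[OF f d] by (auto simp: differentiable_def)
    from frechet_derivative_coordinate_change(1)[OF c(1) d(1) c(2) d(2) this, of "X p c"]
    show "frechet_derivative (f \<circ> chart_inv c) (at (snd c p)) (X p c) =
      frechet_derivative (f \<circ> chart_inv d) (at (snd d p)) (X p d)"
      using tangent_spaceD[OF X c(1) d(1) c(2) d(2)] by simp
  qed
qed (use c in auto)

lemma lie_bracket_chart:
  "c \<in> B \<Longrightarrow> p \<in> fst c \<Longrightarrow> lie_bracket B X Y p c =
      frechet_derivative (field_in_chart c Y) (at (snd c p)) (X p c)
    - frechet_derivative (field_in_chart c X) (at (snd c p)) (Y p c)"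
  by (simp add: lie_bracket_def)

lemma lie_bracket_outside: "\<not> (c \<in> B \<and> p \<in> fst c) \<Longrightarrow> lie_bracket B X Y p c = 0"
  by (auto simp: lie_bracket_def)

lemma lie_bracket_antisym: "lie_bracket B X Y p = - lie_bracket B Y X p"
  by (auto simp: lie_bracket_def fun_eq_iff)

lemma lie_bracket_add:
  assumes X: "X \<in> vector_fields B" and Y: "Y \<in> vector_fields B" and Z: "Z \<in> vector_fields B"
  shows "lie_bracket B X (Y + Z) p = lie_bracket B X Y p + lie_bracket B X Z p"
proof
  fix c
  show "lie_bracket B X (Y + Z) p c = (lie_bracket B X Y p + lie_bracket B X Z p) c"
  proof (cases "c \<in> B \<and> p \<in> fst c")
    case True
    then have c: "c \<in> B" "p \<in> fst c" by auto
    have "frechet_derivative (field_in_chart c (Y + Z)) (at (snd c p)) v =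
        frechet_derivative (field_in_chart c Y) (at (snd c p)) v + frechet_derivative (field_in_chart c Z) (at (snd c p)) v" for v
      unfolding field_in_chart_add
      using frechet_derivative_at[OF has_derivative_add[OF vector_fields_has_derivative[OF Y c] vector_fields_has_derivative[OF Z c]]]
      by metis
    moreover have "linear (frechet_derivative (field_in_chart c X) (at (snd c p)))"
      using vector_fields_has_derivative[OF X c] has_derivative_linear by blast
    ultimately show ?thesis using c by (simp add: lie_bracket_chart linear_add)
  qed (simp add: lie_bracket_outside)
qed

lemma lie_bracket_fscale:
  assumes X: "X \<in> vector_fields B" and Y: "Y \<in> vector_fields B" and f: "f \<in> smooth_functions B"
  shows "lie_bracket B X (fscale f Y) p = f p \<odot> lie_bracket B X Y p + deriv_along B X f p \<odot> Y p"
proof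
  fix c
  show "lie_bracket B X (fscale f Y) p c = (f p \<odot> lie_bracket B X Y p + deriv_along B X f p \<odot> Y p) c"
  proof (cases "c \<in> B \<and> p \<in> fst c")
    case True
    then have c: "c \<in> B" "p \<in> fst c" by auto
    have p: "p \<in> points B" by (rule mem_points[OF c])
    have "frechet_derivative (field_in_chart c (fscale f Y)) (at (snd c p)) v =
        f p *\<^sub>R frechet_derivative (field_in_chart c Y) (at (snd c p)) v
        + frechet_derivative (f \<circ> chart_inv c) (at (snd c p)) v *\<^sub>R Y p c" for v
      unfolding field_in_chart_fscale
      using frechet_derivative_at[OF has_derivative_scaleR[OF smooth_functions_has_derivative[OF f c] vector_fields_has_derivative[OF Y c]]]
      by (metis (no_types, lifting) chart_inv_snd[OF c] comp_apply field_in_chart_def)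
    moreover have "linear (frechet_derivative (field_in_chart c X) (at (snd c p)))"
      using vector_fields_has_derivative[OF X c] has_derivative_linear by blast
    ultimately show ?thesis using c deriv_along_eq[where X = X, OF f vector_fields_tangent[OF X p] c]
      by (simp add: lie_bracket_chart linear_cmul algebra_simps)
  next
    \<comment> \<open>In such a chart the brackets vanish by definition, so the Leibniz term must
      vanish too; tangent vectors, and fields off the manifold, have component 0 there.\<close>
    case False
    then have "Y p c = 0"
      using vector_fields_tangent[OF Y] vector_fields_outside[OF Y, of p] tangent_space_outside[of "Y p" p c]
      by (cases "p \<in> points B") auto
    with False show ?thesis by (simp add: lie_bracket_outside)
  qed
qed

end

section \<open>Extension of local sections\<close>

locale hausdorff_atlas = atlas B for B :: "('a, 'e::euclidean_space) chart set" +
  assumes hausdorff: "Hausdorff_space (atlas_topology B)"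
begin

text \<open>Besides the neighbourhood where \<psi> is 1, an open set is returned on which \<psi>
  vanishes and which together with \<open>W\<close> covers the manifold. A product of \<psi> with
  something defined only on \<open>W\<close> can then be continued by 0 and tested for smoothness on
  two open pieces.\<close>

lemma bump_function:
  assumes W: "openin (atlas_topology B) W" "u \<in> W"
  obtains \<psi> W' V where "\<psi> \<in> smooth_functions B"
    "openin (atlas_topology B) W'" "u \<in> W'" "W' \<subseteq> W" "\<And>p. p \<in> W' \<Longrightarrow> \<psi> p = 1"
    "openin (atlas_topology B) V" "points B \<subseteq> W \<union> V" "\<And>p. p \<in> V \<Longrightarrow> \<psi> p = 0"
proof -
  obtain c where c: "c \<in> B" "u \<in> fst c"
    using W openin_subset_points by (fastforce simp: points_def)
  define S where "S = snd c ` (fst c \<inter> W)"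
  have "open S" "snd c u \<in> S"
    using open_chart_of_openin[OF W(1) c(1)] c W(2) by (auto simp: S_def)
  then obtain r where r: "r > 0" "cball (snd c u) r \<subseteq> S"
    using open_contains_cball by blast
  obtain b :: "'e \<Rightarrow> real" where b: "smooth_on UNIV b" "\<And>x. dist (snd c u) x < r / 2 \<Longrightarrow> b x = 1"
    "\<And>x. dist (snd c u) x \<ge> r \<Longrightarrow> b x = 0"
    using smooth_bump[OF r(1)] by metis
  define \<psi> where "\<psi> p = (if p \<in> fst c then b (snd c p) else 0)" for p
  define K where "K = chart_inv c ` cball (snd c u) r"
  have S_image: "S \<subseteq> chart_image c" by (auto simp: S_def chart_image_def)
  \<comment> \<open>\<open>K\<close> is a continuous image of a closed ball, hence compact; the
    Hausdorff property makes it closed, so its complement is open.\<close>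
  have "compactin (atlas_topology B) K" unfolding K_def
    by (rule image_compactin[OF _ continuous_map_chart_inv[OF c(1)]])
      (use r S_image in \<open>auto simp: compactin_subtopology\<close>)
  then have "closedin (atlas_topology B) K"
    by (rule compactin_imp_closedin[OF hausdorff])
  then have V: "openin (atlas_topology B) (points B - K)"
    by (metis openin_diff openin_topspace topspace_atlas)
  have KW: "K \<subseteq> W"
  proof
    fix p assume "p \<in> K"
    then obtain z where z: "z \<in> S" "p = chart_inv c z" using r(2) by (auto simp: K_def)
    then obtain q where "q \<in> fst c" "q \<in> W" "z = snd c q" by (auto simp: S_def)
    then show "p \<in> W" using z chart_inv_snd[OF c(1)] by auto
  qed
  have \<psi>V: "\<psi> p = 0" if "p \<in> points B - K" for p
  proof (cases "p \<in> fst c")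
    case True
    have "snd c p \<notin> cball (snd c u) r"
      using that chart_inv_snd[OF c(1) True] by (metis DiffD2 K_def image_eqI)
    then show ?thesis using b(3) by (simp add: \<psi>_def)
  qed (simp add: \<psi>_def)
  have "\<psi> \<in> smooth_functions B"
  proof (rule smooth_functionsI)
    fix p assume p: "p \<in> points B"
    show "\<exists>d\<in>B. p \<in> fst d \<and> (\<exists>U. open U \<and> snd d p \<in> U \<and> smooth_on U (\<psi> \<circ> chart_inv d))"
    proof (cases "p \<in> fst c")
      case True
      have "smooth_on (chart_image c) b" by (rule smooth_on_subset[OF b(1)]) simp
      then have "smooth_on (chart_image c) (\<psi> \<circ> chart_inv c)"
        by (rule smooth_on_transform[OF open_chart_image[OF c(1)]])
          (auto simp: \<psi>_def chart_inv_mem snd_chart_inv)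
      then show ?thesis
        using True c(1) open_chart_image[OF c(1)] snd_mem_chart_image[OF True] by blast
    next
      case False
      obtain d where d: "d \<in> B" "p \<in> fst d" using p by (auto simp: points_def)
      have "K \<subseteq> fst c" using r(2) S_image by (auto simp: K_def intro!: chart_inv_mem)
      then have pV: "p \<in> points B - K" using p False by auto
      let ?U = "snd d ` (fst d \<inter> (points B - K))"
      have U: "open ?U" by (rule open_chart_of_openin[OF V d(1)])
      have "smooth_on ?U (\<lambda>z. 0::real)" using U by (rule smooth_on_const)
      then have "smooth_on ?U (\<psi> \<circ> chart_inv d)"
        by (rule smooth_on_transform[OF U]) (auto simp: chart_inv_snd d \<psi>V)
      then show ?thesis using U d pV by blast
    qed
  qed
  moreover have "openin (atlas_topology B) {p \<in> fst c. snd c p \<in> ball (snd c u) (r/2)}"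
    by (rule openin_chart_preimage[OF c(1) open_ball])
  moreover have "u \<in> {p \<in> fst c. snd c p \<in> ball (snd c u) (r/2)}"
    using c(2) r(1) by simp
  moreover have "{p \<in> fst c. snd c p \<in> ball (snd c u) (r/2)} \<subseteq> W"
  proof
    fix p assume "p \<in> {p \<in> fst c. snd c p \<in> ball (snd c u) (r/2)}"
    then have "p \<in> fst c" "snd c p \<in> cball (snd c u) r" using r(1) by auto
    then have "p \<in> K" using chart_inv_snd[OF c(1)] unfolding K_def by (metis image_eqI)
    then show "p \<in> W" using KW by blast
  qed
  moreover have "\<psi> p = 1" if "p \<in> {p \<in> fst c. snd c p \<in> ball (snd c u) (r/2)}" for p
    using that b(2) by (simp add: \<psi>_def)
  moreover have "points B \<subseteq> W \<union> (points B - K)" using KW by blast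
  ultimately show thesis using that[of \<psi> "{p \<in> fst c. snd c p \<in> ball (snd c u) (r/2)}" "points B - K"] V \<psi>V by blast
qed

lemma extend_smooth_function:
  assumes d: "d \<in> B" "u \<in> fst d" and f: "smooth_on (chart_image d) (f \<circ> chart_inv d)"
  obtains f' W where "f' \<in> smooth_functions B" "openin (atlas_topology B) W" "u \<in> W" "W \<subseteq> fst d"
    "\<And>p. p \<in> W \<Longrightarrow> f' p = f p"
proof -
  obtain \<psi> W V where \<psi>: "\<psi> \<in> smooth_functions B"
    and W: "openin (atlas_topology B) W" "u \<in> W" "W \<subseteq> fst d" "\<And>p. p \<in> W \<Longrightarrow> \<psi> p = 1"
    and V: "openin (atlas_topology B) V" "points B \<subseteq> fst d \<union> V" "\<And>p. p \<in> V \<Longrightarrow> \<psi> p = 0"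
    using bump_function[OF openin_fst[OF d(1)] d(2)] by metis
  define f' where "f' p = (if p \<in> fst d then \<psi> p * f p else 0)" for p
  have "f' \<in> smooth_functions B"
  proof (rule smooth_functionsI)
    fix p assume p: "p \<in> points B"
    show "\<exists>c\<in>B. p \<in> fst c \<and> (\<exists>U. open U \<and> snd c p \<in> U \<and> smooth_on U (f' \<circ> chart_inv c))"
    proof (cases "p \<in> fst d")
      case True
      have "smooth_on (chart_image d) (\<lambda>z. (\<psi> \<circ> chart_inv d) z * (f \<circ> chart_inv d) z)"
        by (rule smooth_on_mult[OF open_chart_image[OF d(1)] smooth_functions_smooth[OF \<psi> d(1)] f])
      then have "smooth_on (chart_image d) (f' \<circ> chart_inv d)"
        by (rule smooth_on_transform[OF open_chart_image[OF d(1)]]) (simp add: f'_def chart_inv_mem)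
      then show ?thesis
        using True d(1) open_chart_image[OF d(1)] snd_mem_chart_image[OF True] by blast
    next
      case False
      then have pV: "p \<in> V" using p V(2) by auto
      obtain c where c: "c \<in> B" "p \<in> fst c" using p by (auto simp: points_def)
      let ?U = "snd c ` (fst c \<inter> V)"
      have U: "open ?U" by (rule open_chart_of_openin[OF V(1) c(1)])
      have "smooth_on ?U (\<lambda>z. 0::real)" using U by (rule smooth_on_const)
      then have "smooth_on ?U (f' \<circ> chart_inv c)"
        by (rule smooth_on_transform[OF U]) (auto simp: chart_inv_snd c V(3) f'_def)
      then show ?thesis using U c pV by blast
    qed
  qed
  moreover have "f' p = f p" if "p \<in> W" for p
    using that W(3,4) by (auto simp: f'_def)
  ultimately show thesis using that[of f' W] W by blast
qed

text \<open>Cut-off by a bump function and continuation by 0. The assumptions on \<open>D\<close>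
  are what the resulting field meets: multiples of \<open>X p\<close> in the chart domain and 0
  outside.\<close>

lemma extend_section:
  assumes d: "d \<in> B" "u \<in> fst d" and X: "smooth_on (chart_image d) (field_in_chart d X)"
    and XT: "\<And>p. p \<in> fst d \<Longrightarrow> X p \<in> tangent_space B p"
    and XD: "\<And>p a. p \<in> fst d \<Longrightarrow> a \<odot> X p \<in> D p" "\<And>p. p \<in> points B \<Longrightarrow> 0 \<in> D p"
  obtains X' W where "X' \<in> sections B D" "openin (atlas_topology B) W" "u \<in> W" "W \<subseteq> fst d"
    "\<And>p. p \<in> W \<Longrightarrow> X' p = X p"
proof -
  obtain \<psi> W V where \<psi>: "\<psi> \<in> smooth_functions B"
    and W: "openin (atlas_topology B) W" "u \<in> W" "W \<subseteq> fst d" "\<And>p. p \<in> W \<Longrightarrow> \<psi> p = 1"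
    and V: "openin (atlas_topology B) V" "points B \<subseteq> fst d \<union> V" "\<And>p. p \<in> V \<Longrightarrow> \<psi> p = 0"
    using bump_function[OF openin_fst[OF d(1)] d(2)] by metis
  define X' where "X' p = (if p \<in> fst d then \<psi> p \<odot> X p else 0)" for p
  have "X' \<in> vector_fields B"
  proof (rule vector_fieldsI)
    show "X' p \<in> tangent_space B p" for p
      by (simp add: X'_def tangent_space_0 tangent_space_vscale XT)
    show "X' p = 0" if "p \<notin> points B" for p
      using that mem_points[OF d(1)] by (auto simp: X'_def)
    fix p assume p: "p \<in> points B"
    show "\<exists>c\<in>B. p \<in> fst c \<and> (\<exists>U. open U \<and> snd c p \<in> U \<and> smooth_on U (field_in_chart c X'))"
    proof (cases "p \<in> fst d")
      case True
      have "smooth_on (chart_image d) (\<lambda>z. (\<psi> \<circ> chart_inv d) z *\<^sub>R field_in_chart d X z)"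
        by (rule smooth_on_scaleR[OF open_chart_image[OF d(1)] smooth_functions_smooth[OF \<psi> d(1)] X])
      then have "smooth_on (chart_image d) (field_in_chart d X')"
        by (rule smooth_on_transform[OF open_chart_image[OF d(1)]])
          (simp add: X'_def chart_inv_mem field_in_chart_def)
      then show ?thesis
        using True d(1) open_chart_image[OF d(1)] snd_mem_chart_image[OF True] by blast
    next
      case False
      then have pV: "p \<in> V" using p V(2) by auto
      obtain c where c: "c \<in> B" "p \<in> fst c" using p by (auto simp: points_def)
      let ?U = "snd c ` (fst c \<inter> V)"
      have U: "open ?U" by (rule open_chart_of_openin[OF V(1) c(1)])
      have "smooth_on ?U (\<lambda>z. 0::'e)" using U by (rule smooth_on_const)
      then have "smooth_on ?U (field_in_chart c X')"
        by (rule smooth_on_transform[OF U]) (auto simp: chart_inv_snd c V(3) X'_def field_in_chart_def)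
      then show ?thesis using U c pV by blast
    qed
  qed
  then have "X' \<in> sections B D" using XD by (simp add: sections_def X'_def)
  moreover have "X' p = X p" if "p \<in> W" for p
    using that W(3,4) by (auto simp: X'_def fun_eq_iff)
  ultimately show thesis using that[of X' W] W by blast
qed

end

section \<open>Function-linear operators on sections\<close>

locale subbundle = hausdorff_atlas B for B :: "('a, 'e::euclidean_space) chart set" +
  fixes D :: "'a \<Rightarrow> ('a, 'e) tvec set"
  assumes D_tangent: "D p \<subseteq> tangent_space B p"
    and D_0: "p \<in> points B \<Longrightarrow> 0 \<in> D p"
    and D_add: "p \<in> points B \<Longrightarrow> v \<in> D p \<Longrightarrow> w \<in> D p \<Longrightarrow> v + w \<in> D p"
    and D_vscale: "p \<in> points B \<Longrightarrow> v \<in> D p \<Longrightarrow> a \<odot> v \<in> D p"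
begin

lemma sections_vector_fields: "Y \<in> sections B D \<Longrightarrow> Y \<in> vector_fields B"
  by (simp add: sections_def)

lemma sections_mem: "Y \<in> sections B D \<Longrightarrow> p \<in> points B \<Longrightarrow> Y p \<in> D p"
  by (simp add: sections_def)

lemma sections_add: "Y \<in> sections B D \<Longrightarrow> Z \<in> sections B D \<Longrightarrow> Y + Z \<in> sections B D"
  by (simp add: sections_def vector_fields_add D_add)

lemma sections_fscale: "f \<in> smooth_functions B \<Longrightarrow> Y \<in> sections B D \<Longrightarrow> fscale f Y \<in> sections B D"
  by (simp add: sections_def vector_fields_fscale D_vscale)

text \<open>A bump function \<psi> supported where \<open>Y\<close> and \<open>Z\<close> agree makes
  \<open>fscale \<psi> Y\<close> and \<open>fscale \<psi> Z\<close> equal everywhere. Evaluating the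
  Leibniz rule at \<open>u\<close>, where \<psi> is 1 and both fields agree, gives the claim. The
  arbitrary \<delta> covers connections as well as, with value 0, function-linear operators.\<close>

lemma germ_local:
  assumes leibniz: "\<And>f Y. f \<in> smooth_functions B \<Longrightarrow> Y \<in> sections B D \<Longrightarrow>
      T (fscale f Y) = f u \<odot> T Y + \<delta> f \<odot> Y u"
    and Y: "Y \<in> sections B D" "Z \<in> sections B D"
    and W: "openin (atlas_topology B) W" "u \<in> W" "\<And>p. p \<in> W \<Longrightarrow> Y p = Z p"
  shows "T Y = T Z"
proof -
  obtain \<psi> V where \<psi>: "\<psi> \<in> smooth_functions B" "\<psi> u = 1"
    and V: "points B \<subseteq> W \<union> V" "\<And>p. p \<in> V \<Longrightarrow> \<psi> p = 0"
    using bump_function[OF W(1,2)] by metis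
  have "fscale \<psi> Y = fscale \<psi> Z"
  proof
    fix p
    consider "p \<in> W" | "p \<in> V" | "p \<notin> points B" using V(1) by auto
    then show "fscale \<psi> Y p = fscale \<psi> Z p"
    proof cases
      case 3
      then show ?thesis using Y by (simp add: sections_vector_fields vector_fields_outside)
    qed (auto simp: W(3) V(2) vscale_def)
  qed
  then have "\<psi> u \<odot> T Y + \<delta> \<psi> \<odot> Y u = \<psi> u \<odot> T Z + \<delta> \<psi> \<odot> Z u"
    using leibniz[OF \<psi>(1) Y(1)] leibniz[OF \<psi>(1) Y(2)] by simp
  then show ?thesis using W(3)[OF W(2)] \<psi>(2) by (simp add: vscale_def fun_eq_iff)
qed

text \<open>By locality \<open>Y\<close> may be replaced by the global combination, on which each
  summand contributes \<open>f i u \<odot> T (E i) = 0\<close>. The \<open>E i\<close> only have to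
  generate \<open>Y\<close> near \<open>u\<close>; this accommodates the linearly dependent vertical
  frame.\<close>

lemma tensorial_vanish:
  fixes T :: "('a \<Rightarrow> ('a, 'e) tvec) \<Rightarrow> ('a, 'e) tvec"
  assumes add: "\<And>Y Z. Y \<in> sections B D \<Longrightarrow> Z \<in> sections B D \<Longrightarrow> T (Y + Z) = T Y + T Z"
    and scale: "\<And>f Y. f \<in> smooth_functions B \<Longrightarrow> Y \<in> sections B D \<Longrightarrow> T (fscale f Y) = f u \<odot> T Y"
    and E: "\<And>i. i \<in> I \<Longrightarrow> E i \<in> sections B D" "\<And>i. i \<in> I \<Longrightarrow> T (E i) = 0"
    and f: "\<And>i. i \<in> I \<Longrightarrow> f i \<in> smooth_functions B" and I: "finite I"
    and Y: "Y \<in> sections B D"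
    and W: "openin (atlas_topology B) W" "u \<in> W" "\<And>p. p \<in> W \<Longrightarrow> Y p = (\<Sum>i\<in>I. f i p \<odot> E i p)"
  shows "T Y = 0"
proof -
  let ?Z = "\<lambda>J. \<Sum>i\<in>J. fscale (f i) (E i)"
  \<comment> \<open>Written as a multiple of \<open>Y\<close>, the empty sum is a section by
    \<open>sections_fscale\<close>, and \<open>scale\<close> gives \<open>T 0 = 0\<close>.\<close>
  have 0: "0 = fscale (\<lambda>p. 0) Y" by (simp add: fscale_def vscale_def fun_eq_iff)
  have "?Z J \<in> sections B D \<and> T (?Z J) = 0" if "finite J" "J \<subseteq> I" for J
    using that
  proof (induction J rule: finite_induct)
    case empty
    have "T (fscale (\<lambda>p. 0) Y) = 0"
      using scale[OF smooth_functions_const Y, of 0] by (simp add: vscale_def fun_eq_iff)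
    then show ?case
      using sections_fscale[OF smooth_functions_const Y, of 0] unfolding sum.empty 0[symmetric] by (intro conjI)
  next
    case (insert i J)
    then have i: "fscale (f i) (E i) \<in> sections B D" "T (fscale (f i) (E i)) = 0"
      using E f scale sections_fscale by (auto simp: vscale_def fun_eq_iff)
    have "J \<subseteq> I" using insert.prems by simp
    from insert.IH[OF this] have J: "?Z J \<in> sections B D" "T (?Z J) = 0" by (rule conjunct1, rule conjunct2)
    show ?case
      unfolding sum.insert[OF insert.hyps]
    proof
      show "fscale (f i) (E i) + ?Z J \<in> sections B D" by (rule sections_add[OF i(1) J(1)])
      show "T (fscale (f i) (E i) + ?Z J) = 0" unfolding add[OF i(1) J(1)] i(2) J(2) by (rule add_0)
    qed
  qed
  then have Z: "?Z I \<in> sections B D" "T (?Z I) = 0" using I by auto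
  have "T Y = T (?Z I)"
    by (rule germ_local[where T = T and \<delta> = "\<lambda>f. 0" and W = W and u = u])
      (use scale Y Z W in \<open>auto simp: sum_fun_apply vscale_def fun_eq_iff\<close>)
  with Z show ?thesis by simp
qed

text \<open>Two global extensions of the same germ give the same value by \<open>germ_local\<close>,
  with the derivative along \<open>X\<close> at \<open>u\<close> as \<delta>. Hence the definite
  description denotes, and any extension computes it.\<close>

lemma local_connection_eq:
  assumes conn: "connection_on B D conn" and X: "X \<in> vector_fields B"
    and Y': "Y' \<in> sections B D" and W: "openin (atlas_topology B) W" "u \<in> W" "\<And>p. p \<in> W \<Longrightarrow> Y' p = Y p"
  shows "local_connection B D conn X Y u = conn X Y' u"
  unfolding local_connection_def
proof (rule the_equality)
  show "\<exists>Z\<in>sections B D. (\<exists>W. openin (atlas_topology B) W \<and> u \<in> W \<and> (\<forall>q\<in>W. Z q = Y q)) \<and> conn X Y' u = conn X Z u"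
    using Y' W by blast
  fix w assume "\<exists>Z\<in>sections B D. (\<exists>W. openin (atlas_topology B) W \<and> u \<in> W \<and> (\<forall>q\<in>W. Z q = Y q)) \<and> w = conn X Z u"
  then obtain Z V where Z: "Z \<in> sections B D" "w = conn X Z u"
    and V: "openin (atlas_topology B) V" "u \<in> V" "\<And>p. p \<in> V \<Longrightarrow> Z p = Y p" by blast
  have "conn X Z u = conn X Y' u"
  proof (rule germ_local[where T = "\<lambda>Y. conn X Y u" and \<delta> = "\<lambda>f. deriv_along B X f u"])
    show "conn X (fscale f Y) u = f u \<odot> conn X Y u + deriv_along B X f u \<odot> Y u"
      if "f \<in> smooth_functions B" "Y \<in> sections B D" for f Y
      using conn that X by (simp add: connection_on_def)
    show "openin (atlas_topology B) (W \<inter> V)" using W V by blast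
  qed (use Y' Z W V in auto)
  with Z show "w = conn X Y' u" by simp
qed

end

section \<open>Homogeneous functions\<close>

text \<open>Positive homogeneity in the fibre variable alone. A real exponent treats degree -1 and
  the loss of one degree under fibre derivatives uniformly.\<close>

definition homogeneous_on ::
    "('x \<times> 'y::real_vector) set \<Rightarrow> real \<Rightarrow> ('x \<times> 'y \<Rightarrow> 'z::real_vector) \<Rightarrow> bool" where
  "homogeneous_on S k f \<longleftrightarrow> (\<forall>z\<in>S. \<forall>t>0. f (fst z, t *\<^sub>R snd z) = t powr k *\<^sub>R f z)"

definition fibre_cone :: "('x \<times> 'y::real_vector) set \<Rightarrow> bool" where
  "fibre_cone S \<longleftrightarrow> (\<forall>z\<in>S. \<forall>t>0. (fst z, t *\<^sub>R snd z) \<in> S)"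

lemma homogeneous_onD:
  "homogeneous_on S k f \<Longrightarrow> z \<in> S \<Longrightarrow> t > 0 \<Longrightarrow> f (fst z, t *\<^sub>R snd z) = t powr k *\<^sub>R f z"
  by (simp add: homogeneous_on_def)

lemma homogeneous_on_sum:
  "(\<And>i. i \<in> I \<Longrightarrow> homogeneous_on S k (f i)) \<Longrightarrow> homogeneous_on S k (\<lambda>z. \<Sum>i\<in>I. f i z)"
  by (simp add: homogeneous_on_def scaleR_sum_right)

lemma homogeneous_on_diff:
  "homogeneous_on S k f \<Longrightarrow> homogeneous_on S k g \<Longrightarrow> homogeneous_on S k (\<lambda>z. f z - g z)"
  by (simp add: homogeneous_on_def scaleR_diff_right)

lemma homogeneous_on_mult:
  fixes f g :: "'x \<times> 'y::real_vector \<Rightarrow> real"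
  shows "homogeneous_on S k f \<Longrightarrow> homogeneous_on S l g \<Longrightarrow> homogeneous_on S (k + l) (\<lambda>z. f z * g z)"
  by (simp add: homogeneous_on_def powr_add)

lemma homogeneous_on_cmult:
  fixes f :: "'x \<times> 'y::real_vector \<Rightarrow> real"
  shows "homogeneous_on S k f \<Longrightarrow> homogeneous_on S k (\<lambda>z. a * f z)"
  by (simp add: homogeneous_on_def)

lemma homogeneous_on_inverse:
  fixes f :: "'x \<times> 'y::real_vector \<Rightarrow> real"
  shows "homogeneous_on S k f \<Longrightarrow> homogeneous_on S (- k) (\<lambda>z. 1 / f z)"
  by (simp add: homogeneous_on_def powr_minus_divide)

text \<open>The curve \<open>t \<mapsto> f (x, t y)\<close> is differentiated at 1 by the chain rule
  and by homogeneity. As \<open>(0, y)\<close> is the coordinate expression of \<Gamma>, this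
  computes the derivative of \<open>f\<close> along \<Gamma>.\<close>

lemma euler_homogeneous:
  fixes f :: "'x::real_normed_vector \<times> 'y::real_normed_vector \<Rightarrow> 'z::real_normed_vector"
  assumes hom: "homogeneous_on S k f" and z: "z \<in> S" and f: "f differentiable (at z)"
  shows "frechet_derivative f (at z) (0, snd z) = k *\<^sub>R f z"
proof -
  let ?h = "\<lambda>t::real. (fst z, t *\<^sub>R snd z)"
  have "(?h has_derivative (\<lambda>s. (0, s *\<^sub>R snd z))) (at 1)"
    by (auto intro!: derivative_eq_intros)
  moreover have "(f has_derivative frechet_derivative f (at z)) (at (?h 1))"
    using f by (simp add: frechet_derivative_works)
  ultimately have 1: "((\<lambda>t. f (?h t)) has_derivative (\<lambda>s. frechet_derivative f (at z) (0, s *\<^sub>R snd z))) (at 1)"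
    by (rule has_derivative_compose)
  have "((\<lambda>t. t powr k *\<^sub>R f z) has_derivative (\<lambda>s. (s * k) *\<^sub>R f z)) (at (1::real))"
    by (auto intro!: derivative_eq_intros)
  then have "((\<lambda>t. f (?h t)) has_derivative (\<lambda>s. (s * k) *\<^sub>R f z)) (at 1)"
    by (rule has_derivative_transform_within_open[OF _ open_greaterThan[of 0]])
      (auto simp: homogeneous_onD[OF hom z])
  from has_derivative_unique[OF 1 this] show ?thesis
    by (auto dest: fun_cong[where x = 1])
qed

text \<open>Both sides of the homogeneity equation are differentiated with respect to the point,
  \<open>t\<close> being fixed; the dilation is linear and hence its own derivative. Base directions
  then keep the degree and fibre directions lose one.\<close>

lemma frechet_derivative_homogeneous:
  fixes f :: "'x::real_normed_vector \<times> 'y::real_normed_vector \<Rightarrow> 'z::real_normed_vector"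
  assumes hom: "homogeneous_on S k f" and S: "open S" "fibre_cone S" and sm: "smooth_on S f"
    and z: "z \<in> S" and t: "t > 0"
  shows "frechet_derivative f (at (fst z, t *\<^sub>R snd z)) (fst w, t *\<^sub>R snd w) =
    t powr k *\<^sub>R frechet_derivative f (at z) w"
proof -
  let ?s = "\<lambda>z::'x \<times> 'y. (fst z, t *\<^sub>R snd z)"
  have "(?s has_derivative ?s) (at z)"
    by (auto intro!: derivative_eq_intros)
  moreover have "(f has_derivative frechet_derivative f (at (?s z))) (at (?s z))"
    by (rule smooth_on_has_derivative[OF sm]) (use S z t in \<open>auto simp: fibre_cone_def\<close>)
  ultimately have 1: "((\<lambda>z. f (?s z)) has_derivative (\<lambda>w. frechet_derivative f (at (?s z)) (?s w))) (at z)"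
    by (rule has_derivative_compose)
  have "((\<lambda>z. t powr k *\<^sub>R f z) has_derivative (\<lambda>w. t powr k *\<^sub>R frechet_derivative f (at z) w)) (at z)"
    by (intro has_derivative_scaleR_right smooth_on_has_derivative[OF sm z])
  then have "((\<lambda>z. f (?s z)) has_derivative (\<lambda>w. t powr k *\<^sub>R frechet_derivative f (at z) w)) (at z)"
    by (rule has_derivative_transform_within_open[OF _ S(1) z])
      (auto simp: homogeneous_onD[OF hom _ t])
  from has_derivative_unique[OF 1 this] show ?thesis by metis
qed

lemma homogeneous_on_derivative_fst:
  fixes f :: "'x::real_normed_vector \<times> 'y::real_normed_vector \<Rightarrow> 'z::real_normed_vector"
  assumes "homogeneous_on S k f" "open S" "fibre_cone S" "smooth_on S f"
  shows "homogeneous_on S k (\<lambda>z. frechet_derivative f (at z) (v, 0))"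
  using frechet_derivative_homogeneous[OF assms, where w = "(v, 0)"] by (simp add: homogeneous_on_def)

lemma homogeneous_on_derivative_snd:
  fixes f :: "'x::real_normed_vector \<times> 'y::real_normed_vector \<Rightarrow> 'z::real_normed_vector"
  assumes "homogeneous_on S k f" "open S" "fibre_cone S" "smooth_on S f"
  shows "homogeneous_on S (k - 1) (\<lambda>z. frechet_derivative f (at z) (0, v))"
  unfolding homogeneous_on_def
proof (intro ballI allI impI)
  fix z and t :: real assume z: "z \<in> S" "t > 0"
  let ?D = "frechet_derivative f (at (fst z, t *\<^sub>R snd z))"
  have "linear ?D"
    by (rule smooth_on_linear_derivative[OF assms(4)]) (use z assms(3) in \<open>auto simp: fibre_cone_def\<close>)
  then have "?D (0, t *\<^sub>R v) = t *\<^sub>R ?D (0, v)"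
    using linear_cmul[of ?D t "(0, v)"] by simp
  then have *: "t *\<^sub>R ?D (0, v) = t powr k *\<^sub>R frechet_derivative f (at z) (0, v)"
    using frechet_derivative_homogeneous[OF assms z, where w = "(0, v)"] by simp
  have "?D (0, v) = (1 / t) *\<^sub>R (t *\<^sub>R ?D (0, v))" using z(2) by simp
  also have "\<dots> = (t powr k / t) *\<^sub>R frechet_derivative f (at z) (0, v)" unfolding * by simp
  also have "t powr k / t = t powr (k - 1)" using z(2) by (simp add: powr_diff)
  finally show "?D (0, v) = t powr (k - 1) *\<^sub>R frechet_derivative f (at z) (0, v)" .
qed

section \<open>The slit tangent bundle\<close>

context atlas begin

lemma fst_slit_chart:
  "c \<in> B \<Longrightarrow> fst (slit_chart B c) = {u. fst u \<in> fst c \<and> snd u \<in> tangent_space B (fst u) \<and> snd u \<noteq> 0}"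
  by (auto simp: slit_chart_def slit_bundle_def tangent_bundle_def mem_points)

lemma snd_slit_chart: "snd (slit_chart B c) u = (snd c (fst u), snd u c)"
  by (simp add: slit_chart_def split_beta)

lemma tangent_nonzero_component:
  "v \<in> tangent_space B p \<Longrightarrow> c \<in> B \<Longrightarrow> p \<in> fst c \<Longrightarrow> v c = 0 \<longleftrightarrow> v = 0"
  using tangent_eqI[of v p 0 c] tangent_space_0 by auto

lemma vec_in_chart_nonzero:
  "c \<in> B \<Longrightarrow> p \<in> fst c \<Longrightarrow> y \<noteq> 0 \<Longrightarrow> vec_in_chart B c p y \<noteq> 0"
  by (metis tangent_nonzero_component vec_in_chart_mem vec_in_chart_self)

text \<open>A nonzero tangent vector has nonzero components in every chart around its base point,
  and all nonzero components occur. A general \<open>V\<close> serves chart images, overlaps and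
  preimages of open sets of the base.\<close>

lemma image_slit_chart:
  assumes c: "c \<in> B" and V: "V \<subseteq> fst c"
  shows "snd (slit_chart B c) ` {u \<in> fst (slit_chart B c). fst u \<in> V} = (snd c ` V) \<times> (- {0})"
proof (intro set_eqI iffI)
  fix z :: "'e \<times> 'e" assume "z \<in> snd (slit_chart B c) ` {u \<in> fst (slit_chart B c). fst u \<in> V}"
  then show "z \<in> (snd c ` V) \<times> (- {0})"
    using tangent_nonzero_component[OF _ c] by (auto simp: fst_slit_chart[OF c] snd_slit_chart)
next
  fix z :: "'e \<times> 'e" assume "z \<in> (snd c ` V) \<times> (- {0})"
  then have "fst z \<in> snd c ` V" "snd z \<noteq> 0" by auto
  then obtain p where p: "p \<in> V" "fst z = snd c p" "snd z \<noteq> 0" by blast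
  then have pc: "p \<in> fst c" using V by blast
  show "z \<in> snd (slit_chart B c) ` {u \<in> fst (slit_chart B c). fst u \<in> V}"
    by (rule image_eqI[where x = "(p, vec_in_chart B c p (snd z))"])
      (use p c pc in \<open>auto simp: fst_slit_chart snd_slit_chart vec_in_chart_self vec_in_chart_mem
        vec_in_chart_nonzero prod_eq_iff\<close>)
qed

lemma chart_image_slit_chart: "c \<in> B \<Longrightarrow> chart_image (slit_chart B c) = chart_image c \<times> (- {0})"
  using image_slit_chart[of c "fst c"] by (simp add: chart_image_def fst_slit_chart cong: conj_cong)

lemma inj_slit_chart:
  assumes c: "c \<in> B"
  shows "inj_on (snd (slit_chart B c)) (fst (slit_chart B c))"
proof (rule inj_onI)
  fix u w assume u: "u \<in> fst (slit_chart B c)" "w \<in> fst (slit_chart B c)"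
    and eq: "snd (slit_chart B c) u = snd (slit_chart B c) w"
  then have "fst u = fst w"
    using inj[OF c] by (auto simp: fst_slit_chart[OF c] snd_slit_chart inj_on_def)
  moreover have "snd u = snd w"
    using u eq calculation tangent_eqI[of "snd u" "fst u" "snd w" c] c
    by (auto simp: fst_slit_chart[OF c] snd_slit_chart)
  ultimately show "u = w" by (simp add: prod_eq_iff)
qed

lemma chart_inv_slit_chart:
  assumes c: "c \<in> B" and z: "z \<in> chart_image (slit_chart B c)"
  shows "chart_inv (slit_chart B c) z = (chart_inv c (fst z), vec_in_chart B c (chart_inv c (fst z)) (snd z))"
proof -
  have z': "fst z \<in> chart_image c" "snd z \<noteq> 0" using z by (auto simp: chart_image_slit_chart[OF c])
  let ?p = "chart_inv c (fst z)"
  have p: "?p \<in> fst c" "snd c ?p = fst z" using z'(1) by (simp_all add: chart_inv_mem snd_chart_inv)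
  have "(?p, vec_in_chart B c ?p (snd z)) \<in> fst (slit_chart B c)"
    using c p z'(2) by (simp add: fst_slit_chart vec_in_chart_mem vec_in_chart_nonzero)
  moreover have "snd (slit_chart B c) (?p, vec_in_chart B c ?p (snd z)) = z"
    using c p by (simp add: snd_slit_chart vec_in_chart_self)
  ultimately show ?thesis
    using inv_into_f_f[OF inj_slit_chart[OF c]] by (metis chart_inv_def)
qed

lemma overlap_slit_chart:
  assumes c: "c \<in> B" and d: "d \<in> B"
  shows "snd (slit_chart B c) ` (fst (slit_chart B c) \<inter> fst (slit_chart B d)) =
    (snd c ` (fst c \<inter> fst d)) \<times> (- {0})"
proof -
  have "fst (slit_chart B c) \<inter> fst (slit_chart B d) = {u \<in> fst (slit_chart B c). fst u \<in> fst c \<inter> fst d}"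
    by (auto simp: fst_slit_chart c d)
  then show ?thesis using image_slit_chart[OF c, of "fst c \<inter> fst d"] by simp
qed

lemma transition_slit_chart:
  assumes c: "c \<in> B" and d: "d \<in> B" and z: "z \<in> (snd c ` (fst c \<inter> fst d)) \<times> (- {0})"
  shows "transition (slit_chart B c) (slit_chart B d) z =
    (transition c d (fst z), frechet_derivative (transition c d) (at (fst z)) (snd z))"
proof -
  have "fst z \<in> snd c ` (fst c \<inter> fst d)" using z by auto
  then obtain p where p: "p \<in> fst c" "p \<in> fst d" "fst z = snd c p" by blast
  have "z \<in> chart_image (slit_chart B c)"
    using z p by (auto simp: chart_image_slit_chart[OF c] snd_mem_chart_image)
  then show ?thesis
    by (simp add: transition_def[of "slit_chart B c"] chart_inv_slit_chart[OF c] snd_slit_chart p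
        chart_inv_snd c d transition_snd vec_in_chart_def)
qed

text \<open>The coordinate changes are the tangent maps of those of the base, restricted to nonzero
  vectors.\<close>

lemma smooth_atlas_slit_atlas: "smooth_atlas (slit_atlas B)"
proof -
  have "open (snd c' ` (fst c' \<inter> fst d')) \<and> smooth_on (snd c' ` (fst c' \<inter> fst d')) (transition c' d')"
    if c'd': "c' \<in> slit_atlas B" "d' \<in> slit_atlas B" for c' d'
  proof -
    obtain c d where c: "c \<in> B" "c' = slit_chart B c" and d: "d \<in> B" "d' = slit_chart B d"
      using c'd' unfolding slit_atlas_def by blast
    let ?O = "snd c ` (fst c \<inter> fst d)"
    have O: "open ?O" "open (?O \<times> (- {0::'e}))"
      using open_overlap[OF c(1) d(1)] by (auto intro!: open_Times open_Compl)
    note tr = smooth_transition[OF c(1) d(1)]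
    have f: "smooth_on (?O \<times> (- {0::'e})) (\<lambda>z. fst z)" "smooth_on (?O \<times> (- {0::'e})) (\<lambda>z. snd z)"
      using O by (auto intro!: smooth_on_bounded_linear bounded_linear_fst bounded_linear_snd)
    have "smooth_on (?O \<times> (- {0::'e})) (\<lambda>z. (transition c d (fst z), frechet_derivative (transition c d) (at (fst z)) (snd z)))"
      by (intro smooth_on_Pair O smooth_on_derivative_apply[OF O(2,1) _ f(1) tr f(2)]
          smooth_on_compose[OF O(2,1) _ f(1) tr]) auto
    then have "smooth_on (?O \<times> (- {0::'e})) (transition c' d')"
      unfolding c d by (rule smooth_on_transform[OF O(2)]) (simp add: transition_slit_chart[OF c(1) d(1)])
    then show ?thesis using O(2) overlap_slit_chart[OF c(1) d(1)] by (simp add: c d)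
  qed
  moreover have "inj_on (snd c') (fst c') \<and> open (chart_image c')" if "c' \<in> slit_atlas B" for c'
    using that by (auto simp: slit_atlas_def inj_slit_chart chart_image_slit_chart intro!: open_Times open_chart_image)
  ultimately show ?thesis unfolding smooth_atlas_def by blast
qed

lemma points_slit_atlas: "points (slit_atlas B) = slit_bundle B"
  by (auto simp: points_def slit_atlas_def slit_chart_def slit_bundle_def tangent_bundle_def)

end

section \<open>The Hausdorff property of the slit bundle\<close>

locale base_manifold = hausdorff_atlas A for A :: "('m, 'e::euclidean_space) chart set"

sublocale base_manifold \<subseteq> slit: atlas "slit_atlas A"
  by unfold_locales (rule smooth_atlas_slit_atlas)

context base_manifold begin

text \<open>Distinct base points are separated by sets pulled back from the base. Over a common base
  point the fibre components in one chart differ and are separated in Euclidean space.\<close>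

lemma hausdorff_slit_atlas: "Hausdorff_space (atlas_topology (slit_atlas A))"
  unfolding Hausdorff_space_def slit.topspace_atlas points_slit_atlas disjnt_def
proof (intro allI impI, elim conjE)
  fix u w assume u: "u \<in> slit_bundle A" and w: "w \<in> slit_bundle A" and uw: "u \<noteq> w"
  have up: "fst u \<in> points A" "fst w \<in> points A" "snd u \<in> tangent_space A (fst u)" "snd w \<in> tangent_space A (fst w)"
    using u w by (auto simp: slit_bundle_def tangent_bundle_def)
  show "\<exists>U V. openin (atlas_topology (slit_atlas A)) U \<and> openin (atlas_topology (slit_atlas A)) V \<and> u \<in> U \<and> w \<in> V \<and> U \<inter> V = {}"
  proof (cases "fst u = fst w")
    case False
    obtain U V where UV: "openin (atlas_topology A) U" "openin (atlas_topology A) V"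
      "fst u \<in> U" "fst w \<in> V" "U \<inter> V = {}"
      using hausdorff False up unfolding Hausdorff_space_def topspace_atlas disjnt_def by metis
    have op: "openin (atlas_topology (slit_atlas A)) {q \<in> slit_bundle A. fst q \<in> N}"
      if N: "openin (atlas_topology A) N" for N
    proof -
      have "open (snd c' ` (fst c' \<inter> {q \<in> slit_bundle A. fst q \<in> N}))" if c': "c' \<in> slit_atlas A" for c'
      proof -
        obtain c where c: "c \<in> A" "c' = slit_chart A c" using c' unfolding slit_atlas_def by blast
        have "fst c' \<inter> {q \<in> slit_bundle A. fst q \<in> N} = {u \<in> fst (slit_chart A c). fst u \<in> fst c \<inter> N}"
          by (auto simp: c(2) slit_chart_def)
        then show ?thesis
          using image_slit_chart[OF c(1), of "fst c \<inter> N"] open_chart_of_openin[OF N c(1)]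
          by (auto simp: c(2) intro!: open_Times)
      qed
      then show ?thesis by (auto simp: slit.openin_iff atlas_open_def points_slit_atlas)
    qed
    show ?thesis
      by (rule exI[of _ "{q \<in> slit_bundle A. fst q \<in> U}"], rule exI[of _ "{q \<in> slit_bundle A. fst q \<in> V}"])
        (use op UV u w in auto)
  next
    case True
    obtain c where c: "c \<in> A" "fst u \<in> fst c" using up by (auto simp: points_def)
    have "snd u c \<noteq> snd w c"
      using tangent_eqI[OF up(3) _ c] up(4) True uw by (auto simp: prod_eq_iff)
    then obtain U V where UV: "open U" "open V" "snd u c \<in> U" "snd w c \<in> V" "U \<inter> V = {}"
      using separation_t2 by metis
    let ?c = "slit_chart A c"
    have c': "?c \<in> slit_atlas A" using c by (simp add: slit_atlas_def)
    have "u \<in> fst ?c" "w \<in> fst ?c" using u w c True by (auto simp: slit_chart_def)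
    then show ?thesis
      using slit.openin_chart_preimage[OF c', of "UNIV \<times> U"] slit.openin_chart_preimage[OF c', of "UNIV \<times> V"] UV
      by (intro exI[of _ "{q \<in> fst ?c. snd ?c q \<in> UNIV \<times> U}"] exI[of _ "{q \<in> fst ?c. snd ?c q \<in> UNIV \<times> V}"])
        (auto simp: snd_slit_chart open_Times)
  qed
qed

end

sublocale base_manifold \<subseteq> slit: hausdorff_atlas "slit_atlas A"
  by unfold_locales (rule hausdorff_slit_atlas)

section \<open>Homogeneity of the induced coordinate changes\<close>

context base_manifold begin

lemma slit_chart_cases:
  assumes "d \<in> slit_atlas A"
  obtains c where "c \<in> A" "d = slit_chart A c"
  using assms by (auto simp: slit_atlas_def)

lemma fibre_cone_overlap:
  assumes "c \<in> slit_atlas A" "d \<in> slit_atlas A"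
  shows "fibre_cone (snd c ` (fst c \<inter> fst d))"
  using assms by (elim slit_chart_cases) (auto simp: overlap_slit_chart fibre_cone_def)

lemma fibre_cone_chart_image: "d \<in> slit_atlas A \<Longrightarrow> fibre_cone (chart_image d)"
  by (elim slit_chart_cases) (auto simp: chart_image_slit_chart fibre_cone_def)

text \<open>A tangent map is independent of the fibre variable in its base part and linear in it in
  its fibre part.\<close>

lemma homogeneous_transition:
  assumes c: "c \<in> slit_atlas A" and d: "d \<in> slit_atlas A"
  shows "homogeneous_on (snd c ` (fst c \<inter> fst d)) 0 (\<lambda>z. fst (transition c d z))"
    and "homogeneous_on (snd c ` (fst c \<inter> fst d)) 1 (\<lambda>z. snd (transition c d z))"
proof -
  obtain c' d' where c': "c' \<in> A" "c = slit_chart A c'" and d': "d' \<in> A" "d = slit_chart A d'"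
    using c d by (meson slit_chart_cases)
  let ?O = "snd c' ` (fst c' \<inter> fst d')"
  have O: "snd c ` (fst c \<inter> fst d) = ?O \<times> (- {0})"
    by (simp add: c' d' overlap_slit_chart)
  have tr: "transition c d (x, y) = (transition c' d' x, frechet_derivative (transition c' d') (at x) y)"
    if "x \<in> ?O" "y \<noteq> 0" for x y
    using transition_slit_chart[OF c'(1) d'(1), of "(x, y)"] that c' d' by simp
  have lin: "linear (frechet_derivative (transition c' d') (at x))" if "x \<in> ?O" for x
    by (rule smooth_on_linear_derivative[OF smooth_transition[OF c'(1) d'(1)] that])
  show "homogeneous_on (snd c ` (fst c \<inter> fst d)) 0 (\<lambda>z. fst (transition c d z))"
    "homogeneous_on (snd c ` (fst c \<inter> fst d)) 1 (\<lambda>z. snd (transition c d z))"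
    unfolding O homogeneous_on_def by (auto simp: tr linear_cmul[OF lin])
qed

lemma dtrans_components:
  assumes c: "c \<in> slit_atlas A" and d: "d \<in> slit_atlas A" and z: "z \<in> snd c ` (fst c \<inter> fst d)"
  shows "frechet_derivative (transition c d) (at z) v =
    (frechet_derivative (\<lambda>z. fst (transition c d z)) (at z) v, frechet_derivative (\<lambda>z. snd (transition c d z)) (at z) v)"
proof -
  have D: "(transition c d has_derivative frechet_derivative (transition c d) (at z)) (at z)"
    by (rule smooth_on_has_derivative[OF slit.smooth_transition[OF c d] z])
  show ?thesis
    using frechet_derivative_apply[OF has_derivative_fst[OF D]] frechet_derivative_apply[OF has_derivative_snd[OF D]]
    by simp
qed

lemma smooth_transition_components:
  assumes c: "c \<in> slit_atlas A" and d: "d \<in> slit_atlas A"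
  shows "smooth_on (snd c ` (fst c \<inter> fst d)) (\<lambda>z. fst (transition c d z))"
    and "smooth_on (snd c ` (fst c \<inter> fst d)) (\<lambda>z. snd (transition c d z))"
  using smooth_on_bounded_linear_compose[OF slit.open_overlap[OF c d] bounded_linear_fst slit.smooth_transition[OF c d]]
    smooth_on_bounded_linear_compose[OF slit.open_overlap[OF c d] bounded_linear_snd slit.smooth_transition[OF c d]]
  by auto

text \<open>Euler's theorem in degree 0 for the base part and degree 1 for the fibre part. This is
  what makes \<Gamma> a well-defined vector field.\<close>

lemma dtrans_vertical_position:
  assumes c: "c \<in> slit_atlas A" and d: "d \<in> slit_atlas A" and z: "z \<in> snd c ` (fst c \<inter> fst d)"
  shows "frechet_derivative (transition c d) (at z) (0, snd z) = (0, snd (transition c d z))"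
  using euler_homogeneous[OF homogeneous_transition(1)[OF c d] z smooth_on_differentiable[OF smooth_transition_components(1)[OF c d] z]]
    euler_homogeneous[OF homogeneous_transition(2)[OF c d] z smooth_on_differentiable[OF smooth_transition_components(2)[OF c d] z]]
  by (simp add: dtrans_components[OF c d z])

text \<open>The transition maps commute with the flow \<open>(x, y) \<mapsto> (x, t y)\<close> of the Liouville field; this is the
  infinitesimal version of that fact for their derivatives.\<close>
lemma derivative_of_dtrans_vertical_position:
  assumes c: "c \<in> slit_atlas A" and d: "d \<in> slit_atlas A" and z: "z \<in> snd c ` (fst c \<inter> fst d)"
  shows "frechet_derivative (\<lambda>z. frechet_derivative (transition c d) (at z) e) (at z) (0, snd z) =
    (0, snd (frechet_derivative (transition c d) (at z) e)) - frechet_derivative (transition c d) (at z) (0, snd e)"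
proof -
  let ?O = "snd c ` (fst c \<inter> fst d)"
  let ?T = "transition c d" and ?T1 = "\<lambda>z. fst (transition c d z)" and ?T2 = "\<lambda>z. snd (transition c d z)"
  note O = slit.open_overlap[OF c d] fibre_cone_overlap[OF c d]
  note s = smooth_transition_components[OF c d]
  note h = homogeneous_transition[OF c d]
  have eu1: "frechet_derivative (\<lambda>z. frechet_derivative f (at z) (v, 0)) (at z) (0, snd z) =
      k *\<^sub>R frechet_derivative f (at z) (v, 0)"
    if "homogeneous_on ?O k f" "smooth_on ?O f" for k v and f :: "'e \<times> 'e \<Rightarrow> 'e"
    by (rule euler_homogeneous[OF homogeneous_on_derivative_fst[OF that(1) O that(2)] z
          smooth_on_differentiable[OF smooth_on_derivative[OF that(2)] z]])
  have eu2: "frechet_derivative (\<lambda>z. frechet_derivative f (at z) (0, v)) (at z) (0, snd z) =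
      (k - 1) *\<^sub>R frechet_derivative f (at z) (0, v)"
    if "homogeneous_on ?O k f" "smooth_on ?O f" for k v and f :: "'e \<times> 'e \<Rightarrow> 'e"
    by (rule euler_homogeneous[OF homogeneous_on_derivative_snd[OF that(1) O that(2)] z
          smooth_on_differentiable[OF smooth_on_derivative[OF that(2)] z]])
  \<comment> \<open>Euler's theorem for the partial derivatives of \<open>f\<close>: the base part
    of \<open>e\<close> gives degree \<open>k\<close>, the fibre part degree
    \<open>k - 1\<close>.\<close>
  have split: "frechet_derivative (\<lambda>z. frechet_derivative f (at z) e) (at z) (0, snd z) =
      k *\<^sub>R frechet_derivative f (at z) (fst e, 0) + (k - 1) *\<^sub>R frechet_derivative f (at z) (0, snd e)"
    if f: "homogeneous_on ?O k f" "smooth_on ?O f" for k and f :: "'e \<times> 'e \<Rightarrow> 'e"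
  proof -
    let ?f = "\<lambda>e z. frechet_derivative f (at z) e"
    have "((\<lambda>z. ?f (fst e, 0) z + ?f (0, snd e) z) has_derivative
        (\<lambda>v. frechet_derivative (?f (fst e, 0)) (at z) v + frechet_derivative (?f (0, snd e)) (at z) v)) (at z)"
      by (intro has_derivative_add smooth_on_has_derivative[OF smooth_on_derivative[OF f(2)] z])
    then have "(?f e has_derivative
        (\<lambda>v. frechet_derivative (?f (fst e, 0)) (at z) v + frechet_derivative (?f (0, snd e)) (at z) v)) (at z)"
    proof (rule has_derivative_transform_within_open[OF _ O(1) z])
      fix x assume "x \<in> ?O"
      then have "linear (frechet_derivative f (at x))" by (rule smooth_on_linear_derivative[OF f(2)])
      from linear_add[OF this, of "(fst e, 0)" "(0, snd e)"]
      show "?f (fst e, 0) x + ?f (0, snd e) x = ?f e x" by simp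
    qed
    from frechet_derivative_apply[OF this] show ?thesis using eu1[OF f, of "fst e"] eu2[OF f, of "snd e"] by simp
  qed
  have lin: "frechet_derivative f (at z) e = frechet_derivative f (at z) (fst e, 0) + frechet_derivative f (at z) (0, snd e)"
    if "smooth_on ?O f" for f :: "'e \<times> 'e \<Rightarrow> 'e"
    using linear_add[OF smooth_on_linear_derivative[OF that z], of "(fst e, 0)" "(0, snd e)"] by simp
  have "((\<lambda>z. (frechet_derivative ?T1 (at z) e, frechet_derivative ?T2 (at z) e)) has_derivative
      (\<lambda>v. (frechet_derivative (\<lambda>z. frechet_derivative ?T1 (at z) e) (at z) v,
        frechet_derivative (\<lambda>z. frechet_derivative ?T2 (at z) e) (at z) v))) (at z)"
    by (intro has_derivative_Pair smooth_on_has_derivative[OF smooth_on_derivative z] s)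
  then have "((\<lambda>z. frechet_derivative ?T (at z) e) has_derivative
      (\<lambda>v. (frechet_derivative (\<lambda>z. frechet_derivative ?T1 (at z) e) (at z) v,
        frechet_derivative (\<lambda>z. frechet_derivative ?T2 (at z) e) (at z) v))) (at z)"
    by (rule has_derivative_transform_within_open[OF _ O(1) z]) (simp add: dtrans_components[OF c d])
  from frechet_derivative_apply[OF this]
  have "frechet_derivative (\<lambda>z. frechet_derivative ?T (at z) e) (at z) (0, snd z) =
      (frechet_derivative (\<lambda>z. frechet_derivative ?T1 (at z) e) (at z) (0, snd z),
        frechet_derivative (\<lambda>z. frechet_derivative ?T2 (at z) e) (at z) (0, snd z))" .
  \<comment> \<open>With \<open>k = 0\<close> for \<open>?T1\<close> only the fibre part of
    \<open>e\<close> survives, with sign -1; with \<open>k = 1\<close> for \<open>?T2\<close> only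
    its base part.\<close>
  then show ?thesis
    using split[OF h(1) s(1)] split[OF h(2) s(2)] lin[OF s(2)]
    by (simp add: dtrans_components[OF c d z])
qed

end

section \<open>The Liouville field and brackets with it\<close>

locale base_manifold_vec = base_manifold A for A :: "('m, real^'n::finite) chart set"
begin

lemma liouville_chart: "d \<in> slit_atlas A \<Longrightarrow> u \<in> fst d \<Longrightarrow> liouville A u d = (0, snd (snd d u))"
  by (simp add: liouville_def)

lemma liouville_tangent: "liouville A u \<in> tangent_space (slit_atlas A) u"
proof (rule slit.tangent_spaceI)
  show "liouville A u c = 0" if "\<not> (c \<in> slit_atlas A \<and> u \<in> fst c)" for c
    using that by (auto simp: liouville_def)
  fix c d assume c: "c \<in> slit_atlas A" "u \<in> fst c" and d: "d \<in> slit_atlas A" "u \<in> fst d"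
  then show "liouville A u d = dtrans c d u (liouville A u c)"
    using dtrans_vertical_position[OF c(1) d(1), of "snd c u"] by (auto simp: liouville_chart slit.transition_snd)
qed

lemma field_in_chart_liouville:
  "d \<in> slit_atlas A \<Longrightarrow> z \<in> chart_image d \<Longrightarrow> field_in_chart d (liouville A) z = (0, snd z)"
  by (simp add: field_in_chart_def liouville_chart chart_inv_mem snd_chart_inv)

lemma smooth_on_vertical_position: "open S \<Longrightarrow> smooth_on S (\<lambda>z::'x::real_normed_vector \<times> 'y::real_normed_vector. (0::'z::real_normed_vector, snd z))"
  by (intro smooth_on_bounded_linear bounded_linear_Pair bounded_linear_zero bounded_linear_snd)

lemma liouville_vector_field: "liouville A \<in> vector_fields (slit_atlas A)"
proof -
  have "liouville A u = 0" if "u \<notin> points (slit_atlas A)" for u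
  proof
    fix d show "liouville A u d = 0 d"
      using that mem_points[of d "slit_atlas A" u] by (auto simp: liouville_def)
  qed
  moreover have "smooth_on (chart_image d) (field_in_chart d (liouville A))" if d: "d \<in> slit_atlas A" for d
    by (rule smooth_on_transform[OF _ smooth_on_vertical_position])
      (simp_all add: slit.open_chart_image d field_in_chart_liouville)
  ultimately show ?thesis by (simp add: vector_fields_def liouville_tangent)
qed

text \<open>In coordinates \<Gamma> is the linear field \<open>(0, y)\<close>, whose derivative is
  the projection to the vertical part.\<close>

lemma lie_bracket_liouville_chart:
  assumes d: "d \<in> slit_atlas A" "u \<in> fst d"
  shows "lie_bracket (slit_atlas A) (liouville A) Y u d =
    frechet_derivative (field_in_chart d Y) (at (snd d u)) (0, snd (snd d u)) - (0, snd (Y u d))"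
proof -
  have "((\<lambda>z. (0, snd z)) has_derivative (\<lambda>v. (0, snd v))) (at (snd d u))"
    by (auto intro!: derivative_eq_intros)
  then have "(field_in_chart d (liouville A) has_derivative (\<lambda>v. (0, snd v))) (at (snd d u))"
    by (rule has_derivative_transform_within_open[OF _ slit.open_chart_image[OF d(1)] snd_mem_chart_image[OF d(2)]])
      (simp add: field_in_chart_liouville[OF d(1)])
  from frechet_derivative_apply[OF this] show ?thesis
    using d by (simp add: slit.lie_bracket_chart liouville_chart)
qed

text \<open>The transformation law of \<open>Y\<close> is differentiated in the direction
  \<open>(0, y)\<close>. The resulting second derivative of the transition map is exactly the defect
  between the vertical parts \<open>(0, snd (Y u c))\<close> and \<open>(0, snd (Y u d))\<close>,
  which the other half of the bracket subtracts.\<close>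

lemma lie_bracket_liouville_tangent:
  assumes Y: "Y \<in> vector_fields (slit_atlas A)"
  shows "lie_bracket (slit_atlas A) (liouville A) Y u \<in> tangent_space (slit_atlas A) u"
proof (rule slit.tangent_spaceI)
  let ?L = "lie_bracket (slit_atlas A) (liouville A) Y u"
  show "?L c = 0" if "\<not> (c \<in> slit_atlas A \<and> u \<in> fst c)" for c
    by (rule slit.lie_bracket_outside[OF that])
  fix c d assume c: "c \<in> slit_atlas A" and d: "d \<in> slit_atlas A" and uc: "u \<in> fst c" and ud: "u \<in> fst d"
  let ?z = "snd c u" and ?T = "transition c d" and ?O = "snd c ` (fst c \<inter> fst d)"
  let ?D = "frechet_derivative (transition c d) (at (snd c u))"
  have O: "open ?O" "?z \<in> ?O" "?O \<subseteq> chart_image c"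
    using slit.open_overlap[OF c d] uc ud by (auto simp: chart_image_def)
  have u: "u \<in> points (slit_atlas A)" by (rule mem_points[OF c uc])
  have Yd: "Y u d = ?D (Y u c)"
    by (rule slit.tangent_spaceD[OF slit.vector_fields_tangent[OF Y u] c d uc ud])
  have Yc: "field_in_chart c Y ?z = Y u c" by (simp add: field_in_chart_def slit.chart_inv_snd[OF c uc])
  have "(field_in_chart d Y has_derivative frechet_derivative (field_in_chart d Y) (at (snd d u))) (at (?T ?z))"
    unfolding slit.transition_snd[OF c uc] by (rule slit.vector_fields_has_derivative[OF Y d ud])
  from has_derivative_compose[OF slit.transition_has_derivative[OF c d uc ud] this]
  have "((\<lambda>z. field_in_chart d Y (?T z)) has_derivative
      (\<lambda>v. frechet_derivative (field_in_chart d Y) (at (snd d u)) (?D v))) (at ?z)" .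
  then have "((\<lambda>z. frechet_derivative ?T (at z) (field_in_chart c Y z)) has_derivative
      (\<lambda>v. frechet_derivative (field_in_chart d Y) (at (snd d u)) (?D v))) (at ?z)"
  proof (rule has_derivative_transform_within_open[OF _ O(1,2)])
    fix z assume z: "z \<in> ?O"
    have "chart_inv c z \<in> points (slit_atlas A)"
      by (rule mem_points[OF c chart_inv_mem[OF subsetD[OF O(3) z]]])
    from slit.field_in_chart_transition[where X = Y, OF slit.vector_fields_tangent[OF Y this] c d z]
    show "field_in_chart d Y (?T z) = frechet_derivative ?T (at z) (field_in_chart c Y z)" .
  qed
  from frechet_derivative_apply[OF this]
  have "frechet_derivative (field_in_chart d Y) (at (snd d u)) (?D (0, snd ?z)) =
      frechet_derivative (\<lambda>z. frechet_derivative ?T (at z) (field_in_chart c Y z)) (at ?z) (0, snd ?z)" by (rule sym)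
  \<comment> \<open>Product rule for the moving vector; the term with the vector frozen is evaluated
    through homogeneity of the transition map.\<close>
  also have "\<dots> = ?D (frechet_derivative (field_in_chart c Y) (at ?z) (0, snd ?z))
      + ((0, snd (?D (Y u c))) - ?D (0, snd (Y u c)))"
    unfolding frechet_derivative_of_derivative_apply[OF O(1,2) slit.smooth_transition[OF c d]
        smooth_on_subset[OF slit.vector_fields_smooth[OF Y c] O(3)]]
      Yc derivative_of_dtrans_vertical_position[OF c d O(2)] ..
  finally have eq: "frechet_derivative (field_in_chart d Y) (at (snd d u)) (0, snd (snd d u)) =
      ?D (frechet_derivative (field_in_chart c Y) (at ?z) (0, snd ?z)) + ((0, snd (Y u d)) - ?D (0, snd (Y u c)))"
    unfolding dtrans_vertical_position[OF c d O(2)] slit.transition_snd[OF c uc] Yd .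
  show "?L d = ?D (?L c)"
    unfolding lie_bracket_liouville_chart[OF c uc] lie_bracket_liouville_chart[OF d ud] eq
      linear_diff[OF slit.linear_dtrans[OF c d uc ud]] by simp
qed

end

section \<open>Homogeneity of the Finsler coefficients\<close>

lemma sum_scaleR_axis: "(\<Sum>j\<in>UNIV. a j *\<^sub>R (axis j 1 :: real^'n::finite)) = (\<chi> j. a j)"
  by (simp add: vec_eq_iff axis_def if_distrib sum.delta cong: if_cong)

lemma linear_vertical_expansion:
  fixes L :: "(real^'n::finite) \<times> (real^'n) \<Rightarrow> 'b::real_vector"
  assumes "linear L"
  shows "L (0, y) = (\<Sum>j\<in>UNIV. (y $ j) *\<^sub>R L (0, axis j 1))"
proof -
  have eq: "(0, y) = (\<Sum>j\<in>UNIV. (y $ j) *\<^sub>R ((0, axis j 1) :: (real^'n) \<times> (real^'n)))"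
    by (simp add: prod_eq_iff fst_sum snd_sum sum_scaleR_axis)
  show ?thesis
    by (subst eq) (simp add: linear_sum[OF assms] linear_cmul[OF assms] del: scaleR_Pair)
qed

lemma homogeneous_on_degree: "homogeneous_on S k f \<Longrightarrow> k = l \<Longrightarrow> homogeneous_on S l f"
  by simp

lemma homogeneous_on_pd_x:
  "homogeneous_on S k f \<Longrightarrow> open S \<Longrightarrow> fibre_cone S \<Longrightarrow> smooth_on S f \<Longrightarrow> homogeneous_on S k (pd_x i f)"
  using homogeneous_on_derivative_fst[of S k f "axis i 1"] by (simp add: pd_x_def[abs_def])

lemma homogeneous_on_pd_y:
  "homogeneous_on S k f \<Longrightarrow> open S \<Longrightarrow> fibre_cone S \<Longrightarrow> smooth_on S f \<Longrightarrow> homogeneous_on S (k - 1) (pd_y i f)"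
  using homogeneous_on_derivative_snd[of S k f "axis i 1"] by (simp add: pd_y_def[abs_def])

lemma smooth_on_pd_x: "smooth_on S f \<Longrightarrow> smooth_on S (pd_x i f)"
  using smooth_on_derivative[of S f "(axis i 1, 0)"] by (simp add: pd_x_def[abs_def])

lemma smooth_on_pd_y: "smooth_on S f \<Longrightarrow> smooth_on S (pd_y i f)"
  using smooth_on_derivative[of S f "(0, axis i 1)"] by (simp add: pd_y_def[abs_def])

lemma smooth_on_snd_nth: "open S \<Longrightarrow> smooth_on S (\<lambda>z. snd z $ h)"
  by (intro smooth_on_bounded_linear bounded_linear_compose[OF bounded_linear_vec_nth bounded_linear_snd])

lemma homogeneous_on_snd_nth: "homogeneous_on S 1 (\<lambda>z. snd z $ h)"
  by (simp add: homogeneous_on_def)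

lemma euler_pd_y:
  fixes f :: "(real^'n::finite) \<times> (real^'n) \<Rightarrow> real"
  assumes "homogeneous_on S k f" "smooth_on S f" "z \<in> S"
  shows "(\<Sum>j\<in>UNIV. snd z $ j * pd_y j f z) = k * f z"
  using euler_homogeneous[OF assms(1,3) smooth_on_differentiable[OF assms(2,3)]]
    linear_vertical_expansion[OF smooth_on_linear_derivative[OF assms(2,3)], of "snd z"]
  by (simp add: pd_y_def)

locale finsler =
  fixes A :: "('m, real^'n::finite) chart set" and F :: "('m, 'n) slit_pt \<Rightarrow> real"
  assumes finsler: "finsler_manifold A F"

sublocale finsler \<subseteq> base_manifold_vec A
  using finsler by unfold_locales (auto simp: finsler_manifold_def smooth_manifold_def)

context finsler begin

context
  fixes d :: "('m, 'n) slit_ch"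
  assumes d: "d \<in> slit_atlas A"
begin

lemma chart_open: "open (chart_image d)" and chart_cone: "fibre_cone (chart_image d)"
  using d by (auto simp: slit.open_chart_image fibre_cone_chart_image)

lemma chart_inv_slit_bundle: "z \<in> chart_image d \<Longrightarrow> chart_inv d z \<in> slit_bundle A"
  using mem_points[OF d chart_inv_mem[of z d]] by (simp add: points_slit_atlas)

lemma F_sq_smooth: "smooth_on (chart_image d) (F_sq F d)"
proof -
  have "smooth_on (chart_image d) (F \<circ> chart_inv d)"
    using finsler d by (auto simp: finsler_manifold_def smooth_functions_def)
  from smooth_on_mult[OF chart_open this this] show ?thesis
    by (simp add: F_sq_def[abs_def] power2_eq_square)
qed

lemma F_sq_pos: "z \<in> chart_image d \<Longrightarrow> F_sq F d z > 0"
  using finsler chart_inv_slit_bundle[of z] by (auto simp: finsler_manifold_def F_sq_def)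

text \<open>Induced coordinates are linear on each fibre, so homogeneity of \<open>F\<close> on
  tangent vectors passes to coordinates, and squaring doubles the degree.\<close>

lemma F_sq_homogeneous: "homogeneous_on (chart_image d) 2 (F_sq F d)"
  unfolding homogeneous_on_def
proof (intro ballI allI impI)
  fix z and t :: real assume z: "z \<in> chart_image d" and t: "t > 0"
  obtain c where c: "c \<in> A" "d = slit_chart A c" using d by (rule slit_chart_cases)
  let ?tz = "(fst z, t *\<^sub>R snd z)" and ?p = "chart_inv c (fst z)"
  have tz: "?tz \<in> chart_image d" using z t chart_cone by (auto simp: fibre_cone_def)
  have p: "?p \<in> fst c" using z by (auto simp: c chart_image_slit_chart chart_inv_mem)
  have "vec_in_chart A c ?p (t *\<^sub>R snd z) = t \<odot> vec_in_chart A c ?p (snd z)"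
    by (rule tangent_eqI[OF vec_in_chart_mem[OF c(1) p] tangent_space_vscale[OF vec_in_chart_mem[OF c(1) p]] c(1) p])
      (simp add: vec_in_chart_self c p)
  then have "chart_inv d ?tz = (?p, t \<odot> vec_in_chart A c ?p (snd z))"
    and "chart_inv d z = (?p, vec_in_chart A c ?p (snd z))"
    using chart_inv_slit_chart[OF c(1)] z tz by (simp_all add: c(2))
  moreover have "(?p, vec_in_chart A c ?p (snd z)) \<in> tangent_bundle A"
    using vec_in_chart_mem[OF c(1) p] mem_points[OF c(1) p] by (simp add: tangent_bundle_def)
  ultimately have "F (chart_inv d ?tz) = t * F (chart_inv d z)"
    using finsler t unfolding finsler_manifold_def by fastforce
  then show "F_sq F d ?tz = t powr 2 *\<^sub>R F_sq F d z"
    using t by (simp add: F_sq_def power_mult_distrib)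
qed

lemma fund_tensor_smooth: "smooth_on (chart_image d) (\<lambda>z. fund_tensor F d z $ i $ j)"
proof -
  have "smooth_on (chart_image d) (\<lambda>z. 1/2 * pd_y i (pd_y j (F_sq F d)) z)"
    by (intro smooth_on_mult smooth_on_const smooth_on_pd_y F_sq_smooth chart_open)
  then show ?thesis by (simp add: fund_tensor_def)
qed

lemma fund_tensor_homogeneous: "homogeneous_on (chart_image d) 0 (\<lambda>z. fund_tensor F d z $ i $ j)"
proof -
  have "homogeneous_on (chart_image d) (2 - 1 - 1) (\<lambda>z. 1/2 * pd_y i (pd_y j (F_sq F d)) z)"
    by (intro homogeneous_on_cmult homogeneous_on_pd_y F_sq_homogeneous chart_open chart_cone smooth_on_pd_y F_sq_smooth)
  then show ?thesis by (simp add: fund_tensor_def)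
qed

text \<open>A nonzero kernel vector would be a zero of the positive definite quadratic form.\<close>

lemma fund_tensor_invertible:
  assumes z: "z \<in> chart_image d"
  shows "invertible (fund_tensor F d z)"
proof -
  let ?g = "fund_tensor F d z"
  have pos: "(\<Sum>i\<in>UNIV. \<Sum>j\<in>UNIV. ?g $ i $ j * w $ i * w $ j) > 0" if "w \<noteq> 0" for w
    using finsler d z that by (auto simp: finsler_manifold_def)
  have "w = 0" if "?g *v w = 0" for w
  proof (rule ccontr)
    assume "w \<noteq> 0"
    have "(\<Sum>i\<in>UNIV. \<Sum>j\<in>UNIV. ?g $ i $ j * w $ i * w $ j) = (\<Sum>i\<in>UNIV. w $ i * (?g *v w) $ i)"
      by (simp add: matrix_vector_mult_def sum_distrib_left algebra_simps)
    then show False using pos[OF \<open>w \<noteq> 0\<close>] by (simp add: that)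
  qed
  then show ?thesis
    using matrix_left_invertible_ker[of ?g] invertible_left_inverse[of ?g] by blast
qed

lemma fund_tensor_inv_smooth: "smooth_on (chart_image d) (\<lambda>z. matrix_inv (fund_tensor F d z) $ i $ j)"
  by (intro smooth_on_matrix_inv chart_open fund_tensor_smooth fund_tensor_invertible)

text \<open>The fundamental tensor is constant along rays, hence so is its inverse.\<close>

lemma fund_tensor_inv_homogeneous:
  "homogeneous_on (chart_image d) 0 (\<lambda>z. matrix_inv (fund_tensor F d z) $ i $ j)"
  unfolding homogeneous_on_def
proof (intro ballI allI impI)
  fix z and t :: real assume z: "z \<in> chart_image d" and t: "t > 0"
  have "fund_tensor F d (fst z, t *\<^sub>R snd z) = fund_tensor F d z"
    using homogeneous_onD[OF fund_tensor_homogeneous z t] t by (simp add: vec_eq_iff)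
  then show "matrix_inv (fund_tensor F d (fst z, t *\<^sub>R snd z)) $ i $ j = t powr 0 *\<^sub>R matrix_inv (fund_tensor F d z) $ i $ j"
    using t by simp
qed

lemma spray_coeff_smooth: "smooth_on (chart_image d) (spray_coeff F d i)"
  unfolding spray_coeff_def[abs_def]
  by (intro smooth_on_mult smooth_on_sum smooth_on_diff smooth_on_const smooth_on_pd_y smooth_on_pd_x
      smooth_on_snd_nth F_sq_smooth chart_open fund_tensor_inv_smooth)

text \<open>Degree count: the mixed derivative of the square has degree 1 and is multiplied by a
  fibre coordinate, the base derivative keeps degree 2, and the inverse tensor contributes
  0.\<close>

lemma spray_coeff_homogeneous: "homogeneous_on (chart_image d) 2 (spray_coeff F d i)"
proof -
  have 1: "homogeneous_on (chart_image d) 2 (\<lambda>z. pd_y k (pd_x h (F_sq F d)) z * snd z $ h)" for k h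
    by (rule homogeneous_on_degree[OF homogeneous_on_mult[OF homogeneous_on_pd_y homogeneous_on_snd_nth]])
      (rule homogeneous_on_pd_x F_sq_homogeneous chart_open chart_cone smooth_on_pd_x F_sq_smooth | simp)+
  have 2: "homogeneous_on (chart_image d) 2 (\<lambda>z. (\<Sum>h\<in>UNIV. pd_y k (pd_x h (F_sq F d)) z * snd z $ h) - pd_x k (F_sq F d) z)" for k
    by (intro homogeneous_on_diff homogeneous_on_sum 1 homogeneous_on_pd_x F_sq_homogeneous chart_open chart_cone F_sq_smooth)
  have "homogeneous_on (chart_image d) (0 + 2) (\<lambda>z. matrix_inv (fund_tensor F d z) $ i $ k *
      ((\<Sum>h\<in>UNIV. pd_y k (pd_x h (F_sq F d)) z * snd z $ h) - pd_x k (F_sq F d) z))" for k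
    by (rule homogeneous_on_mult[OF fund_tensor_inv_homogeneous 2])
  then show ?thesis
    unfolding spray_coeff_def[abs_def] by (intro homogeneous_on_cmult homogeneous_on_sum) simp
qed

lemma nonlin_coeff_smooth: "smooth_on (chart_image d) (nonlin_coeff F d i j)"
  unfolding nonlin_coeff_def[abs_def] by (intro smooth_on_pd_y spray_coeff_smooth)

lemma nonlin_coeff_homogeneous: "homogeneous_on (chart_image d) 1 (nonlin_coeff F d i j)"
proof -
  have "homogeneous_on (chart_image d) (2 - 1) (\<lambda>z. pd_y i (spray_coeff F d j) z)"
    by (intro homogeneous_on_pd_y spray_coeff_homogeneous chart_open chart_cone spray_coeff_smooth)
  then show ?thesis unfolding nonlin_coeff_def[abs_def] by simp
qed

lemma t_coeff_smooth: "smooth_on (chart_image d) (t_coeff F d k)"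
  unfolding t_coeff_def[abs_def]
proof (intro smooth_on_mult smooth_on_divide smooth_on_sum smooth_on_const smooth_on_snd_nth F_sq_smooth
    chart_open fund_tensor_smooth)
  show "F_sq F d z \<noteq> 0" if "z \<in> chart_image d" for z using F_sq_pos[OF that] by simp
qed

lemma t_coeff_homogeneous: "homogeneous_on (chart_image d) (-1) (t_coeff F d k)"
proof -
  \<comment> \<open>The degrees are those of the inverse of \<open>F_sq\<close>, the fibre
    coordinate and the fundamental tensor.\<close>
  have "homogeneous_on (chart_image d) (- 2 + (1 + 0)) (t_coeff F d k)"
    unfolding t_coeff_def[abs_def]
    by (intro homogeneous_on_mult homogeneous_on_inverse homogeneous_on_sum F_sq_homogeneous
        homogeneous_on_snd_nth fund_tensor_homogeneous)
  then show ?thesis by simp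
qed

text \<open>Euler's theorem twice, in degree 1 for the first fibre derivatives and in degree 2 for
  the square itself; the factor 2 cancels the 1/2 in \<open>fund_tensor\<close>. The left side is
  the square of the length of \<Gamma>.\<close>

lemma fund_tensor_position:
  assumes z: "z \<in> chart_image d"
  shows "(\<Sum>k\<in>UNIV. snd z $ k * (\<Sum>i\<in>UNIV. snd z $ i * fund_tensor F d z $ k $ i)) = F_sq F d z"
proof -
  let ?Q = "F_sq F d"
  have 1: "(\<Sum>k\<in>UNIV. snd z $ k * pd_y k (pd_y i ?Q) z) = pd_y i ?Q z" for i
    using euler_pd_y[OF homogeneous_on_pd_y[OF F_sq_homogeneous chart_open chart_cone F_sq_smooth]
        smooth_on_pd_y[OF F_sq_smooth] z, of i] by simp
  have "(\<Sum>k\<in>UNIV. snd z $ k * (\<Sum>i\<in>UNIV. snd z $ i * fund_tensor F d z $ k $ i)) =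
      1/2 * (\<Sum>k\<in>UNIV. \<Sum>i\<in>UNIV. snd z $ i * (snd z $ k * pd_y k (pd_y i ?Q) z))"
    by (simp add: fund_tensor_def sum_distrib_left algebra_simps)
  \<comment> \<open>After the swap the outer derivative index \<open>k\<close> is contracted first,
    as fact \<open>1\<close> requires.\<close>
  also have "(\<Sum>k\<in>UNIV. \<Sum>i\<in>UNIV. snd z $ i * (snd z $ k * pd_y k (pd_y i ?Q) z)) =
      (\<Sum>i\<in>UNIV. snd z $ i * pd_y i ?Q z)"
    by (subst sum.swap) (simp add: sum_distrib_left[symmetric] 1)
  also have "\<dots> = 2 * ?Q z" by (rule euler_pd_y[OF F_sq_homogeneous F_sq_smooth z])
  finally show ?thesis by simp
qed

lemma sum_t_coeff: "(\<Sum>k\<in>UNIV. b k * t_coeff F d k z) =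
    1 / F_sq F d z * (\<Sum>k\<in>UNIV. b k * (\<Sum>i\<in>UNIV. snd z $ i * fund_tensor F d z $ k $ i))"
  by (simp add: t_coeff_def sum_distrib_left algebra_simps)

section \<open>The adapted frame\<close>

lemma dx_field_tangent: "u \<in> fst d \<Longrightarrow> dx_field A d i u \<in> tangent_space (slit_atlas A) u"
  and dy_field_tangent: "u \<in> fst d \<Longrightarrow> dy_field A d i u \<in> tangent_space (slit_atlas A) u"
  by (simp_all add: dx_field_def dy_field_def slit.vec_in_chart_mem d)

lemma delta_field_tangent: "u \<in> fst d \<Longrightarrow> delta_field A F d i u \<in> tangent_space (slit_atlas A) u"
  unfolding delta_field_def
  by (intro slit.tangent_space_diff slit.tangent_space_sum slit.tangent_space_vscale dx_field_tangent dy_field_tangent)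

lemma bar_dy_field_tangent: "u \<in> fst d \<Longrightarrow> bar_dy_field A F d i u \<in> tangent_space (slit_atlas A) u"
  unfolding bar_dy_field_def
  by (intro slit.tangent_space_diff slit.tangent_space_vscale liouville_tangent dy_field_tangent)

lemma dy_field_chart: "u \<in> fst d \<Longrightarrow> dy_field A d i u d = (0, axis i 1)"
  by (simp add: dy_field_def slit.vec_in_chart_self d)

lemma sum_dy_field_chart: "u \<in> fst d \<Longrightarrow> (\<Sum>j\<in>UNIV. a j \<odot> dy_field A d j u) d = (0, \<chi> j. a j)"
  by (simp add: sum_fun_apply dy_field_chart prod_eq_iff fst_sum snd_sum sum_scaleR_axis)

lemma delta_field_chart:
  "u \<in> fst d \<Longrightarrow> delta_field A F d i u d = (axis i 1, - (\<chi> j. nonlin_coeff F d i j (snd d u)))"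
  by (simp add: delta_field_def sum_dy_field_chart dx_field_def slit.vec_in_chart_self d)

lemma bar_dy_field_chart:
  "u \<in> fst d \<Longrightarrow> bar_dy_field A F d k u d = (0, axis k 1 - t_coeff F d k (snd d u) *\<^sub>R snd (snd d u))"
  by (simp add: bar_dy_field_def dy_field_chart liouville_chart d)

lemma liouville_eq_sum: "u \<in> fst d \<Longrightarrow> liouville A u = (\<Sum>j\<in>UNIV. (snd (snd d u) $ j) \<odot> dy_field A d j u)"
  by (rule slit.tangent_eqI[OF liouville_tangent _ d])
    (auto simp: liouville_chart d sum_dy_field_chart intro!: slit.tangent_space_sum slit.tangent_space_vscale dy_field_tangent)

lemma field_in_chart_delta:
  "z \<in> chart_image d \<Longrightarrow> field_in_chart d (delta_field A F d i) z = (axis i 1, - (\<chi> j. nonlin_coeff F d i j z))"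
  by (simp add: field_in_chart_def delta_field_chart chart_inv_mem snd_chart_inv)

lemma field_in_chart_bar_dy:
  "z \<in> chart_image d \<Longrightarrow> field_in_chart d (bar_dy_field A F d k) z = (0, axis k 1 - t_coeff F d k z *\<^sub>R snd z)"
  by (simp add: field_in_chart_def bar_dy_field_chart chart_inv_mem snd_chart_inv)

lemma smooth_delta_field: "smooth_on (chart_image d) (field_in_chart d (delta_field A F d i))"
proof -
  have "smooth_on (chart_image d) (\<lambda>z. (axis i 1 :: real^'n, - (\<chi> j. nonlin_coeff F d i j z) :: real^'n))"
    by (intro smooth_on_Pair smooth_on_const smooth_on_uminus smooth_on_vec_lambda chart_open nonlin_coeff_smooth)
  then show ?thesis by (rule smooth_on_transform[OF chart_open]) (simp add: field_in_chart_delta)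
qed

lemma smooth_bar_dy_field: "smooth_on (chart_image d) (field_in_chart d (bar_dy_field A F d k))"
proof -
  have "smooth_on (chart_image d) (\<lambda>z. (0 :: real^'n, axis k 1 - t_coeff F d k z *\<^sub>R snd z))"
    by (intro smooth_on_Pair smooth_on_const smooth_on_diff smooth_on_scaleR chart_open t_coeff_smooth
        smooth_on_bounded_linear bounded_linear_snd)
  then show ?thesis by (rule smooth_on_transform[OF chart_open]) (simp add: field_in_chart_bar_dy)
qed

text \<open>Brackets see only germs, so the bracket of a global extension is computed from the
  explicit local formula of the frame field \<open>Z\<close>.\<close>

lemma lie_bracket_liouville_germ:
  assumes W: "openin (atlas_topology (slit_atlas A)) W" "u \<in> W" "W \<subseteq> fst d" "\<And>p. p \<in> W \<Longrightarrow> Y p = Z p"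
  shows "lie_bracket (slit_atlas A) (liouville A) Y u d =
    frechet_derivative (field_in_chart d Z) (at (snd d u)) (0, snd (snd d u)) - (0, snd (Z u d))"
proof -
  have "frechet_derivative (field_in_chart d Y) (at (snd d u)) = frechet_derivative (field_in_chart d Z) (at (snd d u))"
    by (rule frechet_derivative_cong_open[OF slit.open_chart_of_openin[OF W(1) d]])
      (use W in \<open>auto simp: field_in_chart_def slit.chart_inv_snd d\<close>)
  moreover have "u \<in> fst d" using W by blast
  ultimately show ?thesis using lie_bracket_liouville_chart[OF d] W(2,4) by simp
qed

text \<open>The base part of the components is constant, and the vertical part has degree 1, so its
  Euler derivative is itself and cancels against the vertical part subtracted by the
  bracket.\<close>

lemma lie_bracket_liouville_delta:
  assumes W: "openin (atlas_topology (slit_atlas A)) W" "u \<in> W" "W \<subseteq> fst d" "\<And>p. p \<in> W \<Longrightarrow> Y p = delta_field A F d i p"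
    and Y: "Y \<in> vector_fields (slit_atlas A)"
  shows "lie_bracket (slit_atlas A) (liouville A) Y u = 0"
proof (rule slit.tangent_eqI[OF lie_bracket_liouville_tangent[OF Y] slit.tangent_space_0 d])
  show u: "u \<in> fst d" using W by blast
  let ?z = "snd d u"
  have z: "?z \<in> chart_image d" using u by (rule snd_mem_chart_image)
  let ?N = "\<lambda>z. (\<chi> j. nonlin_coeff F d i j z) :: real^'n"
  have dN: "(?N has_derivative (\<lambda>v. \<chi> j. frechet_derivative (nonlin_coeff F d i j) (at ?z) v)) (at ?z)"
  proof -
    have "((\<lambda>z. \<Sum>j\<in>UNIV. nonlin_coeff F d i j z *\<^sub>R (axis j 1 :: real^'n)) has_derivative
      (\<lambda>v. \<Sum>j\<in>UNIV. frechet_derivative (nonlin_coeff F d i j) (at ?z) v *\<^sub>R axis j 1)) (at ?z)"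
      by (intro has_derivative_sum has_derivative_scaleR_left smooth_on_has_derivative[OF nonlin_coeff_smooth z])
    then show ?thesis by (simp only: sum_scaleR_axis)
  qed
  have "((\<lambda>z. (axis i 1 :: real^'n, - ?N z)) has_derivative
      (\<lambda>v. (0, - (\<chi> j. frechet_derivative (nonlin_coeff F d i j) (at ?z) v)))) (at ?z)"
    by (intro has_derivative_Pair has_derivative_const has_derivative_minus dN)
  then have "(field_in_chart d (delta_field A F d i) has_derivative
      (\<lambda>v. (0, - (\<chi> j. frechet_derivative (nonlin_coeff F d i j) (at ?z) v)))) (at ?z)"
    by (rule has_derivative_transform_within_open[OF _ chart_open z]) (simp add: field_in_chart_delta)
  from frechet_derivative_apply[OF this]
  have "frechet_derivative (field_in_chart d (delta_field A F d i)) (at ?z) (0, snd ?z) = (0, - ?N ?z)"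
    using euler_homogeneous[OF nonlin_coeff_homogeneous z smooth_on_differentiable[OF nonlin_coeff_smooth z]] by simp
  then show "lie_bracket (slit_atlas A) (liouville A) Y u d = 0 d"
    using lie_bracket_liouville_germ[OF W] by (simp add: delta_field_chart u zero_prod_def)
qed

text \<open>The vertical components are a constant minus \<open>t_coeff\<close> times the position,
  both of degree 0. Their Euler derivative vanishes, and only the subtracted vertical part
  remains.\<close>

lemma lie_bracket_liouville_bar_dy:
  assumes W: "openin (atlas_topology (slit_atlas A)) W" "u \<in> W" "W \<subseteq> fst d" "\<And>p. p \<in> W \<Longrightarrow> Y p = bar_dy_field A F d k p"
    and Y: "Y \<in> vector_fields (slit_atlas A)"
  shows "lie_bracket (slit_atlas A) (liouville A) Y u = - bar_dy_field A F d k u"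
proof -
  have u: "u \<in> fst d" using W by blast
  let ?z = "snd d u"
  have z: "?z \<in> chart_image d" using u by (rule snd_mem_chart_image)
  let ?t = "t_coeff F d k"
  have "((\<lambda>z. (0 :: real^'n, axis k 1 - ?t z *\<^sub>R snd z)) has_derivative
      (\<lambda>v. (0, 0 - (?t ?z *\<^sub>R snd v + frechet_derivative ?t (at ?z) v *\<^sub>R snd ?z)))) (at ?z)"
    by (intro has_derivative_Pair has_derivative_const has_derivative_diff has_derivative_scaleR
        smooth_on_has_derivative[OF t_coeff_smooth z] has_derivative_snd has_derivative_ident)
  then have "(field_in_chart d (bar_dy_field A F d k) has_derivative
      (\<lambda>v. (0, 0 - (?t ?z *\<^sub>R snd v + frechet_derivative ?t (at ?z) v *\<^sub>R snd ?z)))) (at ?z)"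
    by (rule has_derivative_transform_within_open[OF _ chart_open z]) (simp add: field_in_chart_bar_dy)
  from frechet_derivative_apply[OF this]
  have "frechet_derivative (field_in_chart d (bar_dy_field A F d k)) (at ?z) (0, snd ?z) = 0"
    using euler_homogeneous[OF t_coeff_homogeneous z smooth_on_differentiable[OF t_coeff_smooth z]]
    by (simp add: zero_prod_def)
  then have "lie_bracket (slit_atlas A) (liouville A) Y u d = (- bar_dy_field A F d k u) d"
    using lie_bracket_liouville_germ[OF W] by (simp add: bar_dy_field_chart u)
  then show ?thesis
    by (rule slit.tangent_eqI[OF lie_bracket_liouville_tangent[OF Y] slit.tangent_space_uminus[OF bar_dy_field_tangent[OF u]] d u])
qed

end

text \<open>Smoothness of the factor is read off from the formula
  \<open>(Z \<bullet> y) / (y \<bullet> y)\<close> for the vertical components in a chart, where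
  \<open>y\<close> is nonzero on the slit bundle. Off the bundle the factor may be any number, since
  both fields are 0 there.\<close>

lemma vertical_multiple:
  assumes Z: "Z \<in> vector_fields (slit_atlas A)" and line: "\<And>u. u \<in> slit_bundle A \<Longrightarrow> Z u \<in> liouville_line A u"
  obtains a where "a \<in> smooth_functions (slit_atlas A)" "Z = fscale a (liouville A)"
proof -
  have "\<exists>a. Z u = a \<odot> liouville A u" for u
  proof (cases "u \<in> slit_bundle A")
    case True
    then show ?thesis using line[OF True] by (auto simp: liouville_line_def)
  next
    case False
    then have "Z u = 0 \<odot> liouville A u"
      using slit.vector_fields_outside[OF Z] by (simp add: points_slit_atlas vscale_def fun_eq_iff)
    then show ?thesis by blast
  qed
  then obtain a where a: "Z u = a u \<odot> liouville A u" for u by metis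
  have "a \<in> smooth_functions (slit_atlas A)"
    unfolding smooth_functions_def mem_Collect_eq
  proof
    fix d assume d: "d \<in> slit_atlas A"
    have nz: "snd z \<noteq> 0" if "z \<in> chart_image d" for z
      using that d by (elim slit_chart_cases) (auto simp: chart_image_slit_chart)
    let ?S = "chart_image d"
    have "smooth_on ?S (\<lambda>z. (snd (field_in_chart d Z z) \<bullet> snd z) / (snd z \<bullet> snd z))"
    proof (intro smooth_on_divide smooth_on_inner chart_open[OF d])
      show "smooth_on ?S (\<lambda>z. snd (field_in_chart d Z z))"
        by (rule smooth_on_bounded_linear_compose[OF chart_open[OF d] bounded_linear_snd slit.vector_fields_smooth[OF Z d]])
    qed (use nz in \<open>auto intro!: smooth_on_bounded_linear bounded_linear_snd chart_open[OF d]\<close>)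
    then show "smooth_on ?S (a \<circ> chart_inv d)"
      by (rule smooth_on_transform[OF chart_open[OF d]])
        (use nz in \<open>simp add: field_in_chart_def a liouville_chart[OF d] chart_inv_mem snd_chart_inv\<close>)
  qed
  moreover have "Z = fscale a (liouville A)" by (rule ext) (simp add: a)
  ultimately show thesis by (rule that)
qed

end

section \<open>The Sasaki lift and the normal bundle of the Liouville foliation\<close>

locale finsler_sasaki = finsler A F for A :: "('m, real^'n::finite) chart set" and F :: "('m, 'n) slit_pt \<Rightarrow> real" +
  fixes G :: "('m, 'n) slit_pt \<Rightarrow> ('m, 'n) slit_vec \<Rightarrow> ('m, 'n) slit_vec \<Rightarrow> real"
  assumes sasaki: "sasaki_metric A F G"
begin

abbreviation "B \<equiv> slit_atlas A"
abbreviation "perp \<equiv> liouville_perp A G"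
abbreviation "\<Gamma> \<equiv> liouville A"
abbreviation "proj \<equiv> proj_perp A G"

lemma G_sym: "u \<in> slit_bundle A \<Longrightarrow> v \<in> tangent_space B u \<Longrightarrow> w \<in> tangent_space B u \<Longrightarrow> G u v w = G u w v"
  and G_vscale: "u \<in> slit_bundle A \<Longrightarrow> v \<in> tangent_space B u \<Longrightarrow> w \<in> tangent_space B u \<Longrightarrow> G u (a \<odot> v) w = a * G u v w"
  and G_add: "u \<in> slit_bundle A \<Longrightarrow> v \<in> tangent_space B u \<Longrightarrow> v' \<in> tangent_space B u \<Longrightarrow> w \<in> tangent_space B u \<Longrightarrow>
    G u (v + v') w = G u v w + G u v' w"
  using sasaki by (auto simp: sasaki_metric_def)

lemma G_zero: "u \<in> slit_bundle A \<Longrightarrow> w \<in> tangent_space B u \<Longrightarrow> G u 0 w = 0"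
  using G_vscale[of u 0 w 0] slit.tangent_space_0 by (simp add: vscale_def func_zero)

lemma G_diff:
  assumes "u \<in> slit_bundle A" "v \<in> tangent_space B u" "v' \<in> tangent_space B u" "w \<in> tangent_space B u"
  shows "G u (v - v') w = G u v w - G u v' w"
  using G_add[of u "v - v'" v' w] assms slit.tangent_space_diff by simp

lemma G_sum:
  assumes u: "u \<in> slit_bundle A" and v: "\<And>i. i \<in> I \<Longrightarrow> v i \<in> tangent_space B u" and w: "w \<in> tangent_space B u"
  shows "G u (\<Sum>i\<in>I. a i \<odot> v i) w = (\<Sum>i\<in>I. a i * G u (v i) w)"
  using v
proof (induction I rule: infinite_finite_induct)
  case (insert i I)
  have "G u (a i \<odot> v i + (\<Sum>i\<in>I. a i \<odot> v i)) w = G u (a i \<odot> v i) w + G u (\<Sum>i\<in>I. a i \<odot> v i) w"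
    by (rule G_add[OF u _ _ w]) (use insert.prems in \<open>auto intro!: slit.tangent_space_vscale slit.tangent_space_sum\<close>)
  moreover have "G u (\<Sum>i\<in>I. a i \<odot> v i) w = (\<Sum>i\<in>I. a i * G u (v i) w)"
    by (rule insert.IH) (simp add: insert.prems)
  moreover have "G u (a i \<odot> v i) w = a i * G u (v i) w"
    by (rule G_vscale[OF u _ w]) (simp add: insert.prems)
  ultimately show ?case unfolding sum.insert[OF insert.hyps] by (simp only:)
qed (simp_all add: G_zero[OF u w])

lemma slit_bundle_chart:
  assumes "u \<in> slit_bundle A"
  obtains d where "d \<in> B" "u \<in> fst d"
proof -
  have "u \<in> points B" using assms by (simp add: points_slit_atlas)
  then show thesis unfolding points_def using that by blast
qed

lemma chart_slit_bundle: "d \<in> B \<Longrightarrow> u \<in> fst d \<Longrightarrow> u \<in> slit_bundle A"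
  using mem_points[of d B u] by (simp add: points_slit_atlas)

lemma G_delta_liouville:
  assumes d: "d \<in> B" "u \<in> fst d"
  shows "G u (delta_field A F d i u) (\<Gamma> u) = 0"
proof -
  note u = chart_slit_bundle[OF d]
  have 0: "G u (dy_field A d j u) (delta_field A F d i u) = 0" for j
    using sasaki d G_sym[OF u dy_field_tangent[OF d] delta_field_tangent[OF d]] by (simp add: sasaki_metric_def)
  have "G u (delta_field A F d i u) (\<Gamma> u) = G u (\<Gamma> u) (delta_field A F d i u)"
    by (rule G_sym[OF u delta_field_tangent[OF d] liouville_tangent])
  also have "\<dots> = 0"
    unfolding liouville_eq_sum[OF d]
    by (subst G_sum[OF u dy_field_tangent[OF d] delta_field_tangent[OF d]]) (simp add: 0)
  finally show ?thesis .
qed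

lemma G_dy_liouville:
  assumes d: "d \<in> B" "u \<in> fst d"
  shows "G u (dy_field A d k u) (\<Gamma> u) = (\<Sum>j\<in>UNIV. snd (snd d u) $ j * fund_tensor F d (snd d u) $ k $ j)"
proof -
  note u = chart_slit_bundle[OF d]
  have 0: "G u (dy_field A d j u) (dy_field A d k u) = fund_tensor F d (snd d u) $ k $ j" for j
    using sasaki d G_sym[OF u dy_field_tangent[OF d] dy_field_tangent[OF d]] by (simp add: sasaki_metric_def)
  have "G u (dy_field A d k u) (\<Gamma> u) = G u (\<Gamma> u) (dy_field A d k u)"
    by (rule G_sym[OF u dy_field_tangent[OF d] liouville_tangent])
  also have "\<dots> = (\<Sum>j\<in>UNIV. snd (snd d u) $ j * fund_tensor F d (snd d u) $ k $ j)"
    unfolding liouville_eq_sum[OF d]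
    by (subst G_sum[OF u dy_field_tangent[OF d] dy_field_tangent[OF d]]) (simp add: 0)
  finally show ?thesis .
qed

text \<open>Up to the factor \<open>F_sq\<close>, the \<open>t_coeff\<close> are the components of
  the covector dual to \<Gamma>. A vertical vector is therefore orthogonal to \<Gamma> exactly if
  its contraction with them vanishes.\<close>

lemma G_sum_dy_liouville:
  assumes d: "d \<in> B" "u \<in> fst d"
  shows "G u (\<Sum>k\<in>UNIV. b k \<odot> dy_field A d k u) (\<Gamma> u) = F_sq F d (snd d u) * (\<Sum>k\<in>UNIV. b k * t_coeff F d k (snd d u))"
proof -
  have "F_sq F d (snd d u) > 0" by (rule F_sq_pos[OF d(1) snd_mem_chart_image[OF d(2)]])
  then show ?thesis
    by (simp add: G_sum[OF chart_slit_bundle[OF d] dy_field_tangent[OF d] liouville_tangent]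
        G_dy_liouville[OF d] sum_t_coeff[OF d(1)])
qed

lemma G_liouville_liouville:
  assumes d: "d \<in> B" "u \<in> fst d"
  shows "G u (\<Gamma> u) (\<Gamma> u) = F_sq F d (snd d u)"
proof -
  have "G u (\<Gamma> u) (\<Gamma> u) = (\<Sum>k\<in>UNIV. snd (snd d u) $ k * G u (dy_field A d k u) (\<Gamma> u))"
    using G_sum[where I = UNIV and a = "\<lambda>k. snd (snd d u) $ k" and v = "\<lambda>k. dy_field A d k u",
        OF chart_slit_bundle[OF d] dy_field_tangent[OF d] liouville_tangent]
    unfolding liouville_eq_sum[OF d, symmetric] .
  then show ?thesis
    by (simp add: G_dy_liouville[OF d] fund_tensor_position[OF d(1) snd_mem_chart_image[OF d(2)]])
qed

lemma G_liouville_pos: "u \<in> slit_bundle A \<Longrightarrow> G u (\<Gamma> u) (\<Gamma> u) > 0"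
  by (metis slit_bundle_chart G_liouville_liouville F_sq_pos snd_mem_chart_image)

lemma delta_field_perp: "d \<in> B \<Longrightarrow> u \<in> fst d \<Longrightarrow> delta_field A F d i u \<in> perp u"
  by (simp add: liouville_perp_def delta_field_tangent G_delta_liouville)

text \<open>\<open>t_coeff\<close> is the quotient of the products of \<open>dy_field\<close> and of
  \<Gamma> with \<Gamma>, so the field is an orthogonal projection of
  \<open>dy_field\<close>.\<close>

lemma bar_dy_field_perp:
  assumes d: "d \<in> B" "u \<in> fst d"
  shows "bar_dy_field A F d k u \<in> perp u"
proof -
  note u = chart_slit_bundle[OF d]
  have "F_sq F d (snd d u) > 0" by (rule F_sq_pos[OF d(1) snd_mem_chart_image[OF d(2)]])
  then have "G u (bar_dy_field A F d k u) (\<Gamma> u) = 0"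
    unfolding bar_dy_field_def
    by (simp add: G_diff[OF u dy_field_tangent[OF d] slit.tangent_space_vscale[OF liouville_tangent] liouville_tangent]
        G_vscale[OF u liouville_tangent liouville_tangent] G_dy_liouville[OF d] G_liouville_liouville[OF d] t_coeff_def)
  then show ?thesis by (simp add: liouville_perp_def bar_dy_field_tangent[OF d])
qed

end

sublocale finsler_sasaki \<subseteq> perp: subbundle "slit_atlas A" "liouville_perp A G"
proof unfold_locales
  show "perp p \<subseteq> tangent_space B p" for p by (auto simp: liouville_perp_def)
qed (auto simp: liouville_perp_def points_slit_atlas slit.tangent_space_0 slit.tangent_space_add slit.tangent_space_vscale
      G_zero G_add G_vscale liouville_tangent)

section \<open>The projection along the Liouville line and the spanning frame\<close>

context finsler_sasaki begin

text \<open>Two candidates for the description differ by a multiple of \<Gamma> that is orthogonal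
  to \<Gamma>; positivity of the length of \<Gamma> makes it 0.\<close>

lemma proj_eq:
  assumes u: "u \<in> slit_bundle A" and w: "w \<in> perp u"
  shows "proj u (w + a \<odot> \<Gamma> u) = w"
  unfolding proj_perp_def
proof (rule the_equality)
  have "w + a \<odot> \<Gamma> u - w = a \<odot> \<Gamma> u" by simp
  then show "w \<in> perp u \<and> w + a \<odot> \<Gamma> u - w \<in> liouville_line A u"
    using w unfolding liouville_line_def by blast
  fix w' assume w': "w' \<in> perp u \<and> w + a \<odot> \<Gamma> u - w' \<in> liouville_line A u"
  then obtain b where b: "w + a \<odot> \<Gamma> u - w' = b \<odot> \<Gamma> u" by (auto simp: liouville_line_def)
  have eq: "w - w' = (b - a) \<odot> \<Gamma> u"
  proof
    fix c show "(w - w') c = ((b - a) \<odot> \<Gamma> u) c"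
      using fun_cong[OF b, of c] by (simp add: algebra_simps)
  qed
  have t: "w \<in> tangent_space B u" "w' \<in> tangent_space B u" and 0: "G u w (\<Gamma> u) = 0" "G u w' (\<Gamma> u) = 0"
    using w w' by (auto simp: liouville_perp_def)
  have "G u (w - w') (\<Gamma> u) = 0" by (simp add: G_diff[OF u t liouville_tangent] 0)
  then have "b - a = 0"
    using G_liouville_pos[OF u] unfolding eq by (simp add: G_vscale[OF u liouville_tangent liouville_tangent])
  then show "w' = w" using eq by (simp add: vscale_def fun_eq_iff)
qed

lemma proj_decomposition:
  assumes u: "u \<in> slit_bundle A" and v: "v \<in> tangent_space B u"
  obtains a where "proj u v \<in> perp u" "v = proj u v + a \<odot> \<Gamma> u"
proof -
  \<comment> \<open>The coefficient of the orthogonal projection to \<Gamma>.\<close>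
  let ?a = "G u v (\<Gamma> u) / G u (\<Gamma> u) (\<Gamma> u)"
  let ?w = "v - ?a \<odot> \<Gamma> u"
  have w: "?w \<in> perp u"
    using G_liouville_pos[OF u]
    by (simp add: liouville_perp_def slit.tangent_space_diff v slit.tangent_space_vscale liouville_tangent
        G_diff[OF u v slit.tangent_space_vscale[OF liouville_tangent] liouville_tangent] G_vscale[OF u liouville_tangent liouville_tangent])
  have "v = ?w + ?a \<odot> \<Gamma> u" by simp
  with proj_eq[OF u w, of ?a] w show thesis using that[of ?a] by simp
qed

lemma proj_perp_self: "u \<in> slit_bundle A \<Longrightarrow> w \<in> perp u \<Longrightarrow> proj u w = w"
proof -
  assume "u \<in> slit_bundle A" "w \<in> perp u"
  moreover have "w + 0 \<odot> \<Gamma> u = w" by (simp add: vscale_def fun_eq_iff)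
  ultimately show ?thesis using proj_eq[of u w 0] by simp
qed

lemma proj_add_vertical:
  assumes u: "u \<in> slit_bundle A" and v: "v \<in> tangent_space B u"
  shows "proj u (v + a \<odot> \<Gamma> u) = proj u v"
proof -
  obtain b where b: "proj u v \<in> perp u" "v = proj u v + b \<odot> \<Gamma> u" by (rule proj_decomposition[OF u v])
  have "v + a \<odot> \<Gamma> u = proj u v + (b + a) \<odot> \<Gamma> u"
    by (subst b(2)) (simp add: vscale_def fun_eq_iff algebra_simps)
  then show ?thesis using proj_eq[OF u b(1), of "b + a"] by simp
qed

lemma proj_add:
  assumes u: "u \<in> slit_bundle A" and v: "v \<in> tangent_space B u" and w: "w \<in> tangent_space B u"
  shows "proj u (v + w) = proj u v + proj u w"
proof -
  obtain b where b: "proj u v \<in> perp u" "v = proj u v + b \<odot> \<Gamma> u" by (rule proj_decomposition[OF u v])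
  obtain c where c: "proj u w \<in> perp u" "w = proj u w + c \<odot> \<Gamma> u" by (rule proj_decomposition[OF u w])
  have "v + w = (proj u v + proj u w) + (b + c) \<odot> \<Gamma> u"
    by (subst b(2), subst c(2)) (simp add: vscale_def fun_eq_iff algebra_simps)
  moreover have "proj u v + proj u w \<in> perp u"
    using perp.D_add b(1) c(1) u by (simp add: points_slit_atlas)
  ultimately show ?thesis using proj_eq[OF u, of "proj u v + proj u w" "b + c"] by simp
qed

lemma proj_vscale:
  assumes u: "u \<in> slit_bundle A" and v: "v \<in> tangent_space B u"
  shows "proj u (a \<odot> v) = a \<odot> proj u v"
proof -
  obtain b where b: "proj u v \<in> perp u" "v = proj u v + b \<odot> \<Gamma> u" by (rule proj_decomposition[OF u v])
  have "a \<odot> v = a \<odot> proj u v + (a * b) \<odot> \<Gamma> u"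
    by (subst b(2)) (simp add: vscale_def fun_eq_iff algebra_simps)
  moreover have "a \<odot> proj u v \<in> perp u"
    using perp.D_vscale b(1) u by (simp add: points_slit_atlas)
  ultimately show ?thesis using proj_eq[OF u, of "a \<odot> proj u v" "a * b"] by simp
qed

lemma extend_delta_field:
  assumes d: "d \<in> B" "u \<in> fst d"
  obtains Y W where "Y \<in> sections B perp" "openin (atlas_topology B) W" "u \<in> W" "W \<subseteq> fst d"
    "\<And>p. p \<in> W \<Longrightarrow> Y p = delta_field A F d i p"
proof (rule slit.extend_section[OF d smooth_delta_field[OF d(1)] delta_field_tangent[OF d(1)], where D = perp])
  show "a \<odot> delta_field A F d i p \<in> perp p" if "p \<in> fst d" for p a
    by (rule perp.D_vscale[OF mem_points[OF d(1) that] delta_field_perp[OF d(1) that]])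
qed (use that perp.D_0 in auto)

lemma extend_bar_dy_field:
  assumes d: "d \<in> B" "u \<in> fst d"
  obtains Y W where "Y \<in> sections B perp" "openin (atlas_topology B) W" "u \<in> W" "W \<subseteq> fst d"
    "\<And>p. p \<in> W \<Longrightarrow> Y p = bar_dy_field A F d i p"
proof (rule slit.extend_section[OF d smooth_bar_dy_field[OF d(1)] bar_dy_field_tangent[OF d(1)], where D = perp])
  show "a \<odot> bar_dy_field A F d i p \<in> perp p" if "p \<in> fst d" for p a
    by (rule perp.D_vscale[OF mem_points[OF d(1) that] bar_dy_field_perp[OF d(1) that]])
qed (use that perp.D_0 in auto)

text \<open>The base components fix the horizontal coefficients, and removing the nonlinear
  connection leaves the vertical ones. Replacing \<open>dy_field\<close> by
  \<open>bar_dy_field\<close> changes the vertical sum by the multiple of \<Gamma> with factor the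
  contraction of the coefficients with \<open>t_coeff\<close>, which is 0 by orthogonality. The
  explicit coefficients are smooth whenever the components of \<open>v\<close> are.\<close>

lemma perp_frame_expansion:
  assumes d: "d \<in> B" "u \<in> fst d" and v: "v \<in> perp u"
  shows "v = (\<Sum>i\<in>UNIV. (fst (v d) $ i) \<odot> delta_field A F d i u)
    + (\<Sum>k\<in>UNIV. (snd (v d) $ k + (\<Sum>i\<in>UNIV. fst (v d) $ i * nonlin_coeff F d i k (snd d u))) \<odot> bar_dy_field A F d k u)"
    (is "v = ?H + (\<Sum>k\<in>UNIV. ?b k \<odot> _)")
proof -
  note u = chart_slit_bundle[OF d]
  have vt: "v \<in> tangent_space B u" and v0: "G u v (\<Gamma> u) = 0" using v by (auto simp: liouville_perp_def)
  let ?V = "\<Sum>k\<in>UNIV. ?b k \<odot> dy_field A d k u"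
  have Ht: "?H \<in> tangent_space B u"
    by (intro slit.tangent_space_sum slit.tangent_space_vscale delta_field_tangent[OF d])
  have Vt: "?V \<in> tangent_space B u"
    by (intro slit.tangent_space_sum slit.tangent_space_vscale dy_field_tangent[OF d])
  have Hd: "?H d = (fst (v d), - (\<chi> k. \<Sum>i\<in>UNIV. fst (v d) $ i * nonlin_coeff F d i k (snd d u)))"
  proof -
    have "?H d = (\<Sum>i\<in>UNIV. (fst (v d) $ i) *\<^sub>R (axis i 1, - (\<chi> j. nonlin_coeff F d i j (snd d u))))"
      by (simp only: sum_fun_apply vscale_apply delta_field_chart[OF d])
    then show ?thesis
      by (simp add: prod_eq_iff fst_sum snd_sum sum_scaleR_axis vec_eq_iff sum_negf)
  qed
  have "v = ?H + ?V"
    by (rule slit.tangent_eqI[OF vt slit.tangent_space_add[OF Ht Vt] d])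
      (simp add: Hd sum_dy_field_chart[OF d] prod_eq_iff vec_eq_iff)
  moreover have "G u ?H (\<Gamma> u) = 0"
    by (simp add: G_sum[OF u delta_field_tangent[OF d] liouville_tangent] G_delta_liouville[OF d])
  ultimately have "G u ?V (\<Gamma> u) = 0"
    using v0 G_add[OF u Ht Vt liouville_tangent] by simp
  \<comment> \<open>The horizontal part is orthogonal to \<Gamma>, so orthogonality of
    \<open>v\<close> is a condition on the vertical coefficients alone.\<close>
  then have t0: "(\<Sum>k\<in>UNIV. ?b k * t_coeff F d k (snd d u)) = 0"
    using F_sq_pos[OF d(1) snd_mem_chart_image[OF d(2)]] by (simp only: G_sum_dy_liouville[OF d]) simp
  have "(\<Sum>k\<in>UNIV. ?b k \<odot> bar_dy_field A F d k u) = ?V"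
  proof
    fix c
    have "(\<Sum>k\<in>UNIV. ?b k \<odot> bar_dy_field A F d k u) c =
        (\<Sum>k\<in>UNIV. ?b k *\<^sub>R dy_field A d k u c) - (\<Sum>k\<in>UNIV. ?b k * t_coeff F d k (snd d u)) *\<^sub>R \<Gamma> u c"
      by (simp only: sum_fun_apply vscale_apply bar_dy_field_def fun_diff_def scaleR_diff_right sum_subtractf
          scaleR_sum_left scaleR_scaleR)
    also have "\<dots> = ?V c" unfolding t0 by (simp add: sum_fun_apply)
    finally show "(\<Sum>k\<in>UNIV. ?b k \<odot> bar_dy_field A F d k u) c = ?V c" .
  qed
  with \<open>v = ?H + ?V\<close> show ?thesis by metis
qed

section \<open>The two characterisations of basic connections\<close>

lemma lie_bracket_liouville_self: "lie_bracket B \<Gamma> \<Gamma> u = 0"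
  by (rule ext) (simp add: lie_bracket_def)

text \<open>For \<open>X = a \<Gamma>\<close> and \<open>Y' = Y + b \<Gamma>\<close> the terms of \<open>[X, Y']\<close> in which \<open>a\<close> or \<open>b\<close> is
  differentiated are multiples of \<open>\<Gamma>\<close>, so only \<open>X = \<Gamma>\<close> and \<open>Y' = Y\<close> matter.\<close>
lemma basic_connection_iff:
  assumes conn: "connection_on B perp conn"
  shows "basic_connection A G conn \<longleftrightarrow>
    (\<forall>Y\<in>sections B perp. \<forall>u\<in>slit_bundle A. conn \<Gamma> Y u = proj u (lie_bracket B \<Gamma> Y u))"
    (is "_ \<longleftrightarrow> ?R")
proof
  assume basic: "basic_connection A G conn"
  have "\<Gamma> u \<in> liouville_line A u" for u
    unfolding liouville_line_def mem_Collect_eq by (rule exI[of _ 1]) (simp add: vscale_def)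
  then have "\<Gamma> \<in> sections B (liouville_line A)"
    using liouville_vector_field by (simp add: sections_def)
  moreover have "proj u (Y u) = Y u" if "Y \<in> sections B perp" "u \<in> slit_bundle A" for Y u
    using that perp.sections_mem proj_perp_self by (simp add: points_slit_atlas)
  ultimately show ?R
    using basic perp.sections_vector_fields unfolding basic_connection_def by blast
next
  assume R: ?R
  show "basic_connection A G conn"
    unfolding basic_connection_def
  proof (intro ballI impI)
    fix X Y Y' u
    assume X: "X \<in> sections B (liouville_line A)" and Y: "Y \<in> sections B perp"
      and Y': "Y' \<in> vector_fields B" and pr: "\<forall>u\<in>slit_bundle A. proj u (Y' u) = Y u" and u: "u \<in> slit_bundle A"
    have Yv: "Y \<in> vector_fields B" by (rule perp.sections_vector_fields[OF Y])
    have up: "u \<in> points B" using u by (simp add: points_slit_atlas)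
    have "X \<in> vector_fields B" "\<And>u. u \<in> slit_bundle A \<Longrightarrow> X u \<in> liouville_line A u"
      using X by (auto simp: sections_def points_slit_atlas)
    then obtain a where a: "a \<in> smooth_functions B" "X = fscale a \<Gamma>" by (rule vertical_multiple)
    \<comment> \<open>The difference of \<open>Y'\<close> and \<open>Y\<close>, with the sign as a
      constant function so that closure under \<open>fscale\<close> applies; it is vertical because
      \<open>Y'\<close> projects to \<open>Y\<close>.\<close>
    let ?Z = "Y' + fscale (\<lambda>p. -1) Y"
    have "?Z \<in> vector_fields B"
      by (intro slit.vector_fields_add Y' slit.vector_fields_fscale slit.smooth_functions_const Yv)
    moreover have "?Z p \<in> liouville_line A p" if p: "p \<in> slit_bundle A" for p
    proof -
      have "Y' p \<in> tangent_space B p"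
        using slit.vector_fields_tangent[OF Y'] p by (simp add: points_slit_atlas)
      then obtain b where "Y' p = proj p (Y' p) + b \<odot> \<Gamma> p" by (rule proj_decomposition[OF p])
      then have "Y' p = Y p + b \<odot> \<Gamma> p" using pr p by simp
      then have "?Z p = b \<odot> \<Gamma> p" by (simp add: vscale_def fun_eq_iff)
      then show ?thesis unfolding liouville_line_def by blast
    qed
    ultimately obtain b where b: "b \<in> smooth_functions B" "?Z = fscale b \<Gamma>" by (rule vertical_multiple)
    have Y'_eq: "Y' = Y + fscale b \<Gamma>"
      unfolding b(2)[symmetric] by (simp add: vscale_def fun_eq_iff)
    let ?L = "lie_bracket B \<Gamma> Y u"
    have L1: "lie_bracket B \<Gamma> Y' u = ?L + deriv_along B \<Gamma> b u \<odot> \<Gamma> u"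
      unfolding Y'_eq slit.lie_bracket_add[OF liouville_vector_field Yv slit.vector_fields_fscale[OF b(1) liouville_vector_field]]
        slit.lie_bracket_fscale[OF liouville_vector_field liouville_vector_field b(1)] lie_bracket_liouville_self
      by (simp add: vscale_def fun_eq_iff)
    \<comment> \<open>The Leibniz rule is available in the second slot, so the factor
      \<open>a\<close> is brought there by antisymmetry and the bracket is turned back
      afterwards.\<close>
    have "lie_bracket B X Y' u = - lie_bracket B Y' (fscale a \<Gamma>) u"
      unfolding a(2) by (rule slit.lie_bracket_antisym)
    also have "\<dots> = - (a u \<odot> lie_bracket B Y' \<Gamma> u + deriv_along B Y' a u \<odot> \<Gamma> u)"
      unfolding slit.lie_bracket_fscale[OF Y' liouville_vector_field a(1)] ..
    also have "lie_bracket B Y' \<Gamma> u = - (?L + deriv_along B \<Gamma> b u \<odot> \<Gamma> u)"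
      unfolding L1[symmetric] by (rule slit.lie_bracket_antisym)
    also have "- (a u \<odot> - (?L + deriv_along B \<Gamma> b u \<odot> \<Gamma> u) + deriv_along B Y' a u \<odot> \<Gamma> u) =
        a u \<odot> ?L + (a u * deriv_along B \<Gamma> b u - deriv_along B Y' a u) \<odot> \<Gamma> u"
      by (simp add: vscale_def fun_eq_iff algebra_simps)
    finally have "proj u (lie_bracket B X Y' u) = a u \<odot> proj u ?L"
      using proj_add_vertical[OF u slit.tangent_space_vscale[OF lie_bracket_liouville_tangent[OF Yv]]]
        proj_vscale[OF u lie_bracket_liouville_tangent[OF Yv]] by simp
    moreover have "conn X Y u = a u \<odot> conn \<Gamma> Y u"
    proof -
      have "conn (fscale a \<Gamma>) Y = fscale a (conn \<Gamma> Y)"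
        using conn a(1) liouville_vector_field Y unfolding connection_on_def by blast
      then show ?thesis by (simp add: a(2))
    qed
    ultimately show "conn X Y u = proj u (lie_bracket B X Y' u)"
      using R Y u by simp
  qed
qed

text \<open>From left to right the brackets of the extended frame fields already lie in the
  complement, where the projection is the identity. From right to left both the frame and the
  coefficients of a section are extended near \<open>u\<close>, which turns the local hypothesis
  into one on global sections.\<close>

lemma frame_iff:
  assumes conn: "connection_on B perp conn"
  shows "(\<forall>Y\<in>sections B perp. \<forall>u\<in>slit_bundle A. conn \<Gamma> Y u = proj u (lie_bracket B \<Gamma> Y u)) \<longleftrightarrow>
    (\<forall>d\<in>B. \<forall>u\<in>fst d. \<forall>i.
       local_connection B perp conn \<Gamma> (delta_field A F d i) u = 0 \<and>
       local_connection B perp conn \<Gamma> (bar_dy_field A F d i) u = - bar_dy_field A F d i u)"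
    (is "?L \<longleftrightarrow> ?R")
proof
  assume L: ?L
  show ?R
  proof (intro ballI allI conjI)
    fix d u i assume d: "d \<in> B" "u \<in> fst d"
    note u = chart_slit_bundle[OF d]
    have up: "u \<in> points B" by (rule mem_points[OF d])
    obtain Y W where Y: "Y \<in> sections B perp" and W: "openin (atlas_topology B) W" "u \<in> W" "W \<subseteq> fst d"
      "\<And>p. p \<in> W \<Longrightarrow> Y p = delta_field A F d i p"
      using extend_delta_field[OF d, of i] by metis
    have "conn \<Gamma> Y u = proj u 0"
      using L Y u lie_bracket_liouville_delta[OF d(1) W perp.sections_vector_fields[OF Y]] by simp
    also have "\<dots> = 0" by (rule proj_perp_self[OF u perp.D_0[OF up]])
    finally show "local_connection B perp conn \<Gamma> (delta_field A F d i) u = 0"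
      using perp.local_connection_eq[OF conn liouville_vector_field Y W(1,2,4)] by simp
    obtain Y W where Y: "Y \<in> sections B perp" and W: "openin (atlas_topology B) W" "u \<in> W" "W \<subseteq> fst d"
      "\<And>p. p \<in> W \<Longrightarrow> Y p = bar_dy_field A F d i p"
      using extend_bar_dy_field[OF d, of i] by metis
    have m: "- bar_dy_field A F d i u \<in> perp u"
      using perp.D_vscale[OF up bar_dy_field_perp[OF d], of "-1"] by (simp add: vscale_def fun_Compl_def)
    have "conn \<Gamma> Y u = proj u (- bar_dy_field A F d i u)"
      using L Y u lie_bracket_liouville_bar_dy[OF d(1) W perp.sections_vector_fields[OF Y]] by simp
    also have "\<dots> = - bar_dy_field A F d i u" by (rule proj_perp_self[OF u m])
    finally show "local_connection B perp conn \<Gamma> (bar_dy_field A F d i) u = - bar_dy_field A F d i u"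
      using perp.local_connection_eq[OF conn liouville_vector_field Y W(1,2,4)] by simp
  qed
next
  assume R: ?R
  show ?L
  proof (intro ballI)
    fix Y u assume Y: "Y \<in> sections B perp" and u: "u \<in> slit_bundle A"
    obtain d where d: "d \<in> B" "u \<in> fst d" by (rule slit_bundle_chart[OF u])
    have up: "u \<in> points B" by (rule mem_points[OF d])
    \<comment> \<open>The defect at the fixed point \<open>u\<close>; tensoriality at this single
      point is enough for \<open>tensorial_vanish\<close>.\<close>
    define T where "T Y = conn \<Gamma> Y u - proj u (lie_bracket B \<Gamma> Y u)" for Y
    have T_add: "T (Y + Z) = T Y + T Z" if YZ: "Y \<in> sections B perp" "Z \<in> sections B perp" for Y Z
    proof -
      note v = perp.sections_vector_fields[OF YZ(1)] perp.sections_vector_fields[OF YZ(2)]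
      have "conn \<Gamma> (Y + Z) = conn \<Gamma> Y + conn \<Gamma> Z"
        using conn YZ liouville_vector_field unfolding connection_on_def by blast
      then show ?thesis
        unfolding T_def slit.lie_bracket_add[OF liouville_vector_field v]
          proj_add[OF u lie_bracket_liouville_tangent[OF v(1)] lie_bracket_liouville_tangent[OF v(2)]]
        by (simp add: algebra_simps)
    qed
    have T_scale: "T (fscale f Y) = f u \<odot> T Y" if f: "f \<in> smooth_functions B" and Y: "Y \<in> sections B perp" for f Y
    proof -
      have v: "Y \<in> vector_fields B" by (rule perp.sections_vector_fields[OF Y])
      have Yu: "Y u \<in> perp u" by (rule perp.sections_mem[OF Y up])
      have Yt: "Y u \<in> tangent_space B u" by (rule slit.vector_fields_tangent[OF v up])
      have "conn \<Gamma> (fscale f Y) = fscale f (conn \<Gamma> Y) + fscale (deriv_along B \<Gamma> f) Y"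
        using conn f Y liouville_vector_field unfolding connection_on_def by blast
      then have "conn \<Gamma> (fscale f Y) u = f u \<odot> conn \<Gamma> Y u + deriv_along B \<Gamma> f u \<odot> Y u" by simp
      \<comment> \<open>Both operators produce the term with the derivative of \<open>f\<close>, and
        the projection fixes \<open>Y u\<close>, so these terms cancel.\<close>
      then show ?thesis
        unfolding T_def slit.lie_bracket_fscale[OF liouville_vector_field v f]
          proj_add[OF u slit.tangent_space_vscale[OF lie_bracket_liouville_tangent[OF v]] slit.tangent_space_vscale[OF Yt]]
          proj_vscale[OF u lie_bracket_liouville_tangent[OF v]] proj_vscale[OF u Yt] proj_perp_self[OF u Yu]
        by (simp add: vscale_def fun_eq_iff algebra_simps)
    qed
    have "\<exists>Z W. Z \<in> sections B perp \<and> openin (atlas_topology B) W \<and> u \<in> W \<and> W \<subseteq> fst d \<and>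
        (\<forall>p\<in>W. Z p = delta_field A F d i p) \<and> T Z = 0" for i
    proof -
      obtain Z W where Z: "Z \<in> sections B perp" and W: "openin (atlas_topology B) W" "u \<in> W" "W \<subseteq> fst d"
        "\<And>p. p \<in> W \<Longrightarrow> Z p = delta_field A F d i p"
        using extend_delta_field[OF d, of i] by metis
      have "conn \<Gamma> Z u = 0"
        using R d perp.local_connection_eq[OF conn liouville_vector_field Z W(1,2,4)] by simp
      moreover have "lie_bracket B \<Gamma> Z u = 0"
        by (rule lie_bracket_liouville_delta[OF d(1) W perp.sections_vector_fields[OF Z]])
      ultimately have "T Z = 0"
        unfolding T_def using proj_perp_self[OF u perp.D_0[OF up]] by simp
      then show ?thesis using Z W by blast
    qed
    then obtain E WE where E: "\<And>i. E i \<in> sections B perp" "\<And>i. T (E i) = 0"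
      and WE: "\<And>i. openin (atlas_topology B) (WE i)" "\<And>i. u \<in> WE i" "\<And>i. WE i \<subseteq> fst d"
        "\<And>i p. p \<in> WE i \<Longrightarrow> E i p = delta_field A F d i p"
      by metis
    have "\<exists>Z W. Z \<in> sections B perp \<and> openin (atlas_topology B) W \<and> u \<in> W \<and> W \<subseteq> fst d \<and>
        (\<forall>p\<in>W. Z p = bar_dy_field A F d i p) \<and> T Z = 0" for i
    proof -
      obtain Z W where Z: "Z \<in> sections B perp" and W: "openin (atlas_topology B) W" "u \<in> W" "W \<subseteq> fst d"
        "\<And>p. p \<in> W \<Longrightarrow> Z p = bar_dy_field A F d i p"
        using extend_bar_dy_field[OF d, of i] by metis
      have m: "- bar_dy_field A F d i u \<in> perp u"
        using perp.D_vscale[OF up bar_dy_field_perp[OF d], of "-1"] by (simp add: vscale_def fun_Compl_def)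
      have "conn \<Gamma> Z u = - bar_dy_field A F d i u"
        using R d perp.local_connection_eq[OF conn liouville_vector_field Z W(1,2,4)] by simp
      moreover have "lie_bracket B \<Gamma> Z u = - bar_dy_field A F d i u"
        by (rule lie_bracket_liouville_bar_dy[OF d(1) W perp.sections_vector_fields[OF Z]])
      ultimately have "T Z = 0"
        unfolding T_def using proj_perp_self[OF u m] by simp
      then show ?thesis using Z W by blast
    qed
    then obtain H WH where H: "\<And>i. H i \<in> sections B perp" "\<And>i. T (H i) = 0"
      and WH: "\<And>i. openin (atlas_topology B) (WH i)" "\<And>i. u \<in> WH i" "\<And>i. WH i \<subseteq> fst d"
        "\<And>i p. p \<in> WH i \<Longrightarrow> H i p = bar_dy_field A F d i p"
      by metis
    \<comment> \<open>The coefficients of \<open>perp_frame_expansion\<close>, defined through the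
      chart \<open>d\<close> and smooth only there.\<close>
    define \<alpha> where "\<alpha> i p = fst (Y p d) $ i" for i p
    define \<beta> where "\<beta> k p = snd (Y p d) $ k + (\<Sum>i\<in>UNIV. fst (Y p d) $ i * nonlin_coeff F d i k (snd d p))" for k p
    have smY: "smooth_on (chart_image d) (\<lambda>z. fst (Y (chart_inv d z) d) $ i)"
      "smooth_on (chart_image d) (\<lambda>z. snd (Y (chart_inv d z) d) $ i)" for i
      using smooth_on_bounded_linear_compose[OF chart_open[OF d(1)]
          bounded_linear_compose[OF bounded_linear_vec_nth bounded_linear_fst]
          slit.vector_fields_smooth[OF perp.sections_vector_fields[OF Y] d(1)]]
        smooth_on_bounded_linear_compose[OF chart_open[OF d(1)]
          bounded_linear_compose[OF bounded_linear_vec_nth bounded_linear_snd]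
          slit.vector_fields_smooth[OF perp.sections_vector_fields[OF Y] d(1)]]
      by (simp_all add: field_in_chart_def)
    have sma: "smooth_on (chart_image d) (\<alpha> i \<circ> chart_inv d)" for i
      using smY(1) by (simp add: \<alpha>_def comp_def)
    have smb: "smooth_on (chart_image d) (\<beta> k \<circ> chart_inv d)" for k
    proof -
      have "smooth_on (chart_image d) (\<lambda>z. snd (Y (chart_inv d z) d) $ k +
          (\<Sum>i\<in>UNIV. fst (Y (chart_inv d z) d) $ i * nonlin_coeff F d i k z))"
        by (intro smooth_on_add smooth_on_sum smooth_on_mult smY chart_open[OF d(1)] nonlin_coeff_smooth[OF d(1)])
      then show ?thesis
        by (rule smooth_on_transform[OF chart_open[OF d(1)]]) (simp add: \<beta>_def snd_chart_inv)
    qed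
    have "\<exists>f W. f \<in> smooth_functions B \<and> openin (atlas_topology B) W \<and> u \<in> W \<and> (\<forall>p\<in>W. f p = \<alpha> i p)" for i
      using slit.extend_smooth_function[OF d sma[of i]] by metis
    then obtain a Wa where a: "\<And>i. a i \<in> smooth_functions B"
      and Wa: "\<And>i. openin (atlas_topology B) (Wa i)" "\<And>i. u \<in> Wa i" "\<And>i p. p \<in> Wa i \<Longrightarrow> a i p = \<alpha> i p"
      by metis
    have "\<exists>f W. f \<in> smooth_functions B \<and> openin (atlas_topology B) W \<and> u \<in> W \<and> (\<forall>p\<in>W. f p = \<beta> i p)" for i
      using slit.extend_smooth_function[OF d smb[of i]] by metis
    then obtain b Wb where b: "\<And>i. b i \<in> smooth_functions B"
      and Wb: "\<And>i. openin (atlas_topology B) (Wb i)" "\<And>i. u \<in> Wb i" "\<And>i p. p \<in> Wb i \<Longrightarrow> b i p = \<beta> i p"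
      by metis
    \<comment> \<open>On this finite intersection all extended fields and coefficients agree with
      the local ones at once.\<close>
    define W where "W = (\<Inter>i\<in>UNIV. WE i \<inter> WH i \<inter> (Wa i \<inter> Wb i))"
    have "openin (atlas_topology B) W"
      unfolding W_def by (intro openin_INT2 openin_Int WE(1) WH(1) Wa(1) Wb(1)) auto
    moreover have "u \<in> W" unfolding W_def using WE(2) WH(2) Wa(2) Wb(2) by blast
    ultimately have W: "openin (atlas_topology B) W" "u \<in> W" .
    have Wp: "p \<in> fst d" "E i p = delta_field A F d i p" "H i p = bar_dy_field A F d i p" "a i p = \<alpha> i p" "b i p = \<beta> i p"
      if "p \<in> W" for p i
    proof -
      have p: "p \<in> WE i" "p \<in> WH i" "p \<in> Wa i" "p \<in> Wb i" using that by (simp_all add: W_def)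
      show "p \<in> fst d" by (rule subsetD[OF WE(3) p(1)])
      show "E i p = delta_field A F d i p" "H i p = bar_dy_field A F d i p" "a i p = \<alpha> i p" "b i p = \<beta> i p"
        by (rule WE(4)[OF p(1)] WH(4)[OF p(2)] Wa(3)[OF p(3)] Wb(3)[OF p(4)])+
    qed
    \<comment> \<open>The disjoint union of two copies of the index type enumerates the horizontal
      frame on the left and the vertical one on the right.\<close>
    let ?E = "case_sum E H" and ?f = "case_sum a b"
    have "T Y = 0"
    proof (rule perp.tensorial_vanish[where u = u and I = "UNIV <+> UNIV" and E = ?E and f = ?f, OF T_add T_scale])
      show "Y p = (\<Sum>i\<in>UNIV <+> UNIV. ?f i p \<odot> ?E i p)" if p: "p \<in> W" for p
      proof -
        have "Y p \<in> perp p" by (rule perp.sections_mem[OF Y mem_points[OF d(1) Wp(1)[OF p]]])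
        from perp_frame_expansion[OF d(1) Wp(1)[OF p] this]
        have "Y p = (\<Sum>i\<in>UNIV. \<alpha> i p \<odot> delta_field A F d i p) + (\<Sum>k\<in>UNIV. \<beta> k p \<odot> bar_dy_field A F d k p)"
          by (simp only: \<alpha>_def \<beta>_def)
        \<comment> \<open>\<open>UNIV_Plus_UNIV\<close> would fold the index set into one universe
          before \<open>sum.Plus\<close> can split the sum.\<close>
        also have "\<dots> = (\<Sum>i\<in>UNIV <+> UNIV. ?f i p \<odot> ?E i p)"
          by (simp add: sum.Plus Wp(2-5)[OF p] del: UNIV_Plus_UNIV)
        finally show ?thesis .
      qed
      show "?E i \<in> sections B perp" "T (?E i) = 0" "?f i \<in> smooth_functions B" for i
        by (cases i; simp only: sum.case E H a b)+
    qed (simp_all add: Y W)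
    then show "conn \<Gamma> Y u = proj u (lie_bracket B \<Gamma> Y u)" by (simp add: T_def)
  qed
qed

end

theorem proposition3p4:
  fixes A :: "('m, real^'n::finite) chart set"
    and F :: "('m, 'n) slit_pt \<Rightarrow> real"
    and G :: "('m, 'n) slit_pt \<Rightarrow> ('m, 'n) slit_vec \<Rightarrow> ('m, 'n) slit_vec \<Rightarrow> real"
    and conn :: "(('m, 'n) slit_pt \<Rightarrow> ('m, 'n) slit_vec) \<Rightarrow> (('m, 'n) slit_pt \<Rightarrow> ('m, 'n) slit_vec)
                \<Rightarrow> ('m, 'n) slit_pt \<Rightarrow> ('m, 'n) slit_vec"
  assumes "finsler_manifold A F"
    and "sasaki_metric A F G"
    and "connection_on (slit_atlas A) (liouville_perp A G) conn"
  shows "basic_connection A G conn \<longleftrightarrow>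
    (\<forall>d\<in>slit_atlas A. \<forall>u\<in>fst d. \<forall>i.
       local_connection (slit_atlas A) (liouville_perp A G) conn (liouville A) (delta_field A F d i) u
         = 0 \<and>
       local_connection (slit_atlas A) (liouville_perp A G) conn (liouville A) (bar_dy_field A F d i) u
         = - bar_dy_field A F d i u)"
proof -
  interpret finsler_sasaki A F G
    using assms(1,2) by unfold_locales
  show ?thesis
    using basic_connection_iff[OF assms(3)] frame_iff[OF assms(3)] by blast
qed

end
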